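(* Let $G$ be a countable group, $0<\delta<1/2$, and let $(\mu_g)_{g\in G}$ be probability measures on $\{0,1\}$ with $\mu_g(0) \in [\delta,1-\delta]$ for all $g \in G$. Define $c_g(k)=\mu_k(0)-\mu_{g^{-1}k}(0)$ and assume that $c_g\in\ell^2(G)$ for all $g\in G$, so that the Bernoulli action $G \curvearrowright (X,\mu)=\prod_{g\in G}(\{0,1\},\mu_g)$ is nonsingular. Assume that $\kappa > \delta^{-1} (1-\delta)^{-1}$ and that $$\sum_{g \in G} \exp(- 4\kappa \, \|c_g\|_2^2) = +\infty \; .$$ Then the Bernoulli action $G \curvearrowright (X,\mu)$ is strongly conservative. More precisely, whenever $\delta^{-1} (1-\delta)^{-1} < \kappa_1 < \kappa$, there exists a sequence of probability measures $\eta_n$ on $G$ satisfying $$\sum_{k,g \in G} \eta_n(g)^2 \, \eta_n(gk^{-1}) \, \exp\bigl(\kappa_1 \, \|c_k\|_2^2\bigr) \to 0 \quad\text{as } n \to \infty. \qquad ( * )$$ Each sequence of probability measures $\eta_n$ on $G$ satisfying $( * )$ is strongly recurrent for $G \curvearrowright (X,\mu)$. Also, for every such $\kappa_1$ there exists an $\alpha_0 > 0$ such that each sequence $\eta_n$ satisfying $( * )$ is strongly recurrent for the Maharam extension $G \curvearrowright (X \times \mathbb{R},\mu \times \nu_\alpha)$ for every $\alpha \in (0,\alpha_0)$, where $\nu_\alpha$ is the probability measure on $\mathbb{R}$ given by $d\nu_\alpha(t) = \frac{\alpha}{2} \exp(-\alpha |t|) \, dt$.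
   Context: The Bernoulli action is given by $(g\cdot x)_h=x_{g^{-1}h}$. For a nonsingular action $G\curvearrowright(X,\mu)$ on a standard probability space (i.e. one preserving the class of null sets), write $\frac{d\mu(g\cdot x)}{d\mu(x)}$ for the Radon-Nikodym derivative at $x$ of $\mathcal{U}\mapsto \mu(g\cdot \mathcal{U})$ with respect to $\mu$. The Maharam extension is the action $G\curvearrowright X\times\mathbb{R}$ given by $g\cdot(x,t)=(g\cdot x, t+\log\frac{d\mu(g\cdot x)}{d\mu(x)})$. A sequence of probability measures $\eta_n$ on $G$ is strongly recurrent for a nonsingular action $G\curvearrowright(X,\mu)$ on a standard probability space if $$\sum_{g \in G} \eta_n(g)^2 \int_X \Bigl( \sum_{k \in G} \eta_n(gk^{-1}) \, \frac{d \mu(k \cdot x)}{d \mu(x)} \Bigr)^{-1} d \mu(x) \to 0$$ as $n\to\infty$ (terms with $\eta_n(g)=0$ are zero). The action is strongly conservative if such a sequence exists. For the Maharam extension these notions are used with $X\times\mathbb{R}$ and the probability measure $\mu\times\nu_\alpha$ in place of $(X,\mu)$. *)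

theory Defs
  imports "HOL-Probability.Probability" "HOL-Algebra.Group"
begin

text \<open>
  Sums of nonnegative extended reals over a group are written as integrals against the
  counting measure on its carrier.
\<close>

definition standard_prob_space :: "'x measure \<Rightarrow> bool" where
  "standard_prob_space M \<longleftrightarrow>
     prob_space M \<and>
     (\<exists>T. completely_metrizable_space T \<and> second_countable T \<and> topspace T = space M \<and>
          sets M = sigma_sets (topspace T) {U. openin T U})"

text \<open>
  The measure \<open>U \<mapsto> M (\<phi> g ` U)\<close>. It is used for bijections \<open>\<phi> g\<close> of \<open>space M\<close> that are measurable
  in both directions, where the set function on the right is indeed a measure.
\<close>

definition translated_measure :: "'x measure \<Rightarrow> ('g \<Rightarrow> 'x \<Rightarrow> 'x) \<Rightarrow> 'g \<Rightarrow> 'x measure" where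
  "translated_measure M \<phi> g = measure_of (space M) (sets M) (\<lambda>U. emeasure M (\<phi> g ` U))"

definition translation_deriv :: "'x measure \<Rightarrow> ('g \<Rightarrow> 'x \<Rightarrow> 'x) \<Rightarrow> 'g \<Rightarrow> 'x \<Rightarrow> ennreal" where
  "translation_deriv M \<phi> g = RN_deriv M (translated_measure M \<phi> g)"

text \<open>
  Each group element acts by an automorphism of the measurable space that preserves the class of
  null sets. As usual in ergodic theory of countable groups, the action identities are only
  required almost everywhere: the Maharam extension is built from Radon-Nikodym derivatives, which
  satisfy the cocycle identity only outside a null set.
\<close>

definition nonsingular_action ::
  "('g, 'b) monoid_scheme \<Rightarrow> 'x measure \<Rightarrow> ('g \<Rightarrow> 'x \<Rightarrow> 'x) \<Rightarrow> bool" where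
  "nonsingular_action G M \<phi> \<longleftrightarrow>
     standard_prob_space M \<and>
     (\<forall>g\<in>carrier G.
        \<phi> g \<in> measurable M M \<and> bij_betw (\<phi> g) (space M) (space M) \<and>
        (\<forall>U\<in>sets M. \<phi> g ` U \<in> sets M) \<and>
        (\<forall>U\<in>sets M. emeasure M (\<phi> g ` U) = 0 \<longleftrightarrow> emeasure M U = 0)) \<and>
     (AE x in M. \<phi> \<one>\<^bsub>G\<^esub> x = x) \<and>
     (\<forall>g\<in>carrier G. \<forall>h\<in>carrier G. AE x in M. \<phi> (g \<otimes>\<^bsub>G\<^esub> h) x = \<phi> g (\<phi> h x))"

definition prob_sequence_on :: "('g, 'b) monoid_scheme \<Rightarrow> (nat \<Rightarrow> 'g pmf) \<Rightarrow> bool" where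
  "prob_sequence_on G \<eta> \<longleftrightarrow> (\<forall>n. set_pmf (\<eta> n) \<subseteq> carrier G)"

text \<open>
  In \<^typ>\<open>ennreal\<close> we have \<open>inverse 0 = \<infinity>\<close> and \<open>0 * \<infinity> = 0\<close>, so that terms with \<open>\<eta> n\<close> vanishing
  at \<open>g\<close> contribute zero.
\<close>

definition strongly_recurrent ::
  "('g, 'b) monoid_scheme \<Rightarrow> 'x measure \<Rightarrow> ('g \<Rightarrow> 'x \<Rightarrow> 'x) \<Rightarrow> (nat \<Rightarrow> 'g pmf) \<Rightarrow> bool" where
  "strongly_recurrent G M \<phi> \<eta> \<longleftrightarrow>
     nonsingular_action G M \<phi> \<and> prob_sequence_on G \<eta> \<and>
     (\<lambda>n. \<integral>\<^sup>+ g. ennreal ((pmf (\<eta> n) g)\<^sup>2) *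
            (\<integral>\<^sup>+ x. inverse (\<integral>\<^sup>+ k. ennreal (pmf (\<eta> n) (g \<otimes>\<^bsub>G\<^esub> inv\<^bsub>G\<^esub> k)) * translation_deriv M \<phi> k x
                                \<partial>count_space (carrier G)) \<partial>M)
          \<partial>count_space (carrier G)) \<longlonglongrightarrow> 0"

definition strongly_conservative ::
  "('g, 'b) monoid_scheme \<Rightarrow> 'x measure \<Rightarrow> ('g \<Rightarrow> 'x \<Rightarrow> 'x) \<Rightarrow> bool" where
  "strongly_conservative G M \<phi> \<longleftrightarrow> (\<exists>\<eta>. strongly_recurrent G M \<phi> \<eta>)"

definition maharam_map :: "'x measure \<Rightarrow> ('g \<Rightarrow> 'x \<Rightarrow> 'x) \<Rightarrow> 'g \<Rightarrow> 'x \<times> real \<Rightarrow> 'x \<times> real" where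
  "maharam_map M \<phi> g = (\<lambda>(x, t). (\<phi> g x, t + ln (enn2real (translation_deriv M \<phi> g x))))"

definition two_sided_exp :: "real \<Rightarrow> real measure" where
  "two_sided_exp \<alpha> = density lborel (\<lambda>t. ennreal (\<alpha> / 2 * exp (- \<alpha> * \<bar>t\<bar>)))"

definition bernoulli_space :: "('g, 'b) monoid_scheme \<Rightarrow> ('g \<Rightarrow> nat measure) \<Rightarrow> ('g \<Rightarrow> nat) measure" where
  "bernoulli_space G m = PiM (carrier G) m"

definition bernoulli_map :: "('g, 'b) monoid_scheme \<Rightarrow> 'g \<Rightarrow> ('g \<Rightarrow> nat) \<Rightarrow> ('g \<Rightarrow> nat)" where
  "bernoulli_map G g x = (\<lambda>h\<in>carrier G. x (inv\<^bsub>G\<^esub> g \<otimes>\<^bsub>G\<^esub> h))"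

definition shift_diff :: "('g, 'b) monoid_scheme \<Rightarrow> ('g \<Rightarrow> nat measure) \<Rightarrow> 'g \<Rightarrow> 'g \<Rightarrow> real" where
  "shift_diff G m g k = measure (m k) {0} - measure (m (inv\<^bsub>G\<^esub> g \<otimes>\<^bsub>G\<^esub> k)) {0}"

definition l2_norm_sq :: "('g, 'b) monoid_scheme \<Rightarrow> ('g \<Rightarrow> real) \<Rightarrow> real" where
  "l2_norm_sq G f = (\<Sum>\<^sub>\<infinity>k\<in>carrier G. (f k)\<^sup>2)"

definition exp_weight_condition ::
  "('g, 'b) monoid_scheme \<Rightarrow> ('g \<Rightarrow> nat measure) \<Rightarrow> real \<Rightarrow> (nat \<Rightarrow> 'g pmf) \<Rightarrow> bool" where
  "exp_weight_condition G m \<kappa>\<^sub>1 \<eta> \<longleftrightarrow>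
     prob_sequence_on G \<eta> \<and>
     (\<lambda>n. \<integral>\<^sup>+ k. \<integral>\<^sup>+ g. ennreal ((pmf (\<eta> n) g)\<^sup>2 * pmf (\<eta> n) (g \<otimes>\<^bsub>G\<^esub> inv\<^bsub>G\<^esub> k) *
              exp (\<kappa>\<^sub>1 * l2_norm_sq G (shift_diff G m k)))
            \<partial>count_space (carrier G) \<partial>count_space (carrier G)) \<longlonglongrightarrow> 0"

end

theory Submission
  imports Defs
begin

text \<open>
  By Jensen's inequality, strong recurrence of \<open>\<eta>\<close> follows from a bound
  \<open>\<integral> 1 / D\<^sub>k \<le> C exp (\<kappa>\<^sub>1 \<parallel>c\<^sub>k\<parallel>\<^sup>2)\<close> on the Radon-Nikodym derivatives \<open>D\<^sub>k\<close>. For the Bernoulli action \<open>D\<^sub>k\<close> is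
  an infinite product of two-point density ratios, so that by Fatou's lemma \<open>\<integral> D\<^sub>k powr - (1 + \<alpha>)\<close> is
  controlled one coordinate at a time, where a second-order Taylor expansion produces the constant
  \<open>1 / (\<delta> (1 - \<delta>))\<close> as \<open>\<alpha>\<close> tends to \<open>0\<close>. The case \<open>\<alpha> = 0\<close> settles the Bernoulli action. In the Maharam
  extension the inverse derivative is at most \<open>1 + D\<^sub>k powr - (1 + \<alpha>)\<close>, and the margin in
  \<open>\<kappa>\<^sub>1 > 1 / (\<delta> (1 - \<delta>))\<close> pays for \<open>\<alpha> > 0\<close>. For the existence of \<open>\<eta>\<close> take uniform
  measures on finite subsets \<open>F\<close> of level sets \<open>{g. \<parallel>c\<^sub>g\<parallel>\<^sup>2 \<le> t}\<close>: by the cocycle identity the sum to be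
  estimated is at most \<open>exp (4 \<kappa>\<^sub>1 t) / card F\<close>, and the divergence hypothesis makes some level sets
  much larger than \<open>exp (4 \<kappa>\<^sub>1 t)\<close>.
\<close>

section \<open>Standard probability spaces\<close>

text \<open>The infinite product has to be constructed before it can be estimated. Each coordinate
  ratio has mean one, so the finite partial products have orthogonal increments, and
  square-summability of the shift differences makes them Cauchy in the mean-square sense. The limit
  could still vanish on a set of positive measure; this is excluded by absolute continuity for both
  \<open>k\<close> and its inverse. Constants: expanding \<open>u powr (2 + \<alpha>)\<close> at
  \<open>u = 1\<close> gives the second-order coefficient
  \<open>(2 + \<alpha>) (1 + \<alpha>) / 2\<close>, inflated by at most
  \<open>R powr \<alpha>\<close>, where \<open>R = (1 - \<delta>) / \<delta>\<close> bounds all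
  ratios. Their product is \<open>1\<close> at \<open>\<alpha> = 0\<close>, and the two points
  contribute \<open>1/q + 1/(1-q) = 1/(q (1-q))\<close>. The extra exponent \<open>\<alpha>\<close>
  is the cost of translating the two-sided exponential measure by the logarithm of the derivative.
  The factor \<open>4\<close> is \<open>2 + 2\<close>: a shift of \<open>c\<close> at
  \<open>inv h \<otimes> g\<close> is the difference of \<open>c\<close> at \<open>g\<close> and at
  \<open>h\<close>, and \<open>(a - b)^2 \<le> 2 a^2 + 2 b^2\<close>. Finite subsets are taken
  because a level set may be infinite.\<close>

lemma prod_topology_base:
  assumes B: "\<And>U x. openin X U \<Longrightarrow> x \<in> U \<Longrightarrow> \<exists>V\<in>B. x \<in> V \<and> V \<subseteq> U"
    and C: "\<And>U y. openin Y U \<Longrightarrow> y \<in> U \<Longrightarrow> \<exists>V\<in>C. y \<in> V \<and> V \<subseteq> U"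
    and W: "openin (prod_topology X Y) W" "z \<in> W"
  shows "\<exists>V\<in>(\<lambda>(U, V). U \<times> V) ` (B \<times> C). z \<in> V \<and> V \<subseteq> W"
proof -
  obtain U V where UV: "openin X U" "openin Y V" "fst z \<in> U" "snd z \<in> V" "U \<times> V \<subseteq> W"
    using W by (auto simp: openin_prod_topology_alt) (metis prod.collapse)
  obtain U' V' where "U' \<in> B" "fst z \<in> U'" "U' \<subseteq> U" "V' \<in> C" "snd z \<in> V'" "V' \<subseteq> V"
    using B[OF UV(1,3)] C[OF UV(2,4)] by auto
  with UV(5) show ?thesis
    by (intro bexI[of _ "U' \<times> V'"]) (auto simp: mem_Times_iff)
qed

lemma second_countable_prod_topology:
  assumes "second_countable X" "second_countable Y"
  shows "second_countable (prod_topology X Y)"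
proof -
  obtain B where B: "countable B" "\<And>V. V \<in> B \<Longrightarrow> openin X V"
      "\<And>U x. openin X U \<Longrightarrow> x \<in> U \<Longrightarrow> \<exists>V\<in>B. x \<in> V \<and> V \<subseteq> U"
    using assms(1) by (auto simp: second_countable_def)
  obtain C where C: "countable C" "\<And>V. V \<in> C \<Longrightarrow> openin Y V"
      "\<And>U x. openin Y U \<Longrightarrow> x \<in> U \<Longrightarrow> \<exists>V\<in>C. x \<in> V \<and> V \<subseteq> U"
    using assms(2) by (auto simp: second_countable_def)
  let ?D = "(\<lambda>(U, V). U \<times> V) ` (B \<times> C)"
  show ?thesis
    unfolding second_countable_def
  proof (intro exI[of _ ?D] conjI ballI allI impI)
    show "countable ?D" using B C by auto
    show "openin (prod_topology X Y) V" if "V \<in> ?D" for V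
      using that B(2) C(2) by (auto simp: openin_prod_Times_iff)
    show "\<exists>V\<in>?D. z \<in> V \<and> V \<subseteq> W" if "openin (prod_topology X Y) W \<and> z \<in> W" for W z
      by (rule prod_topology_base[OF B(3) C(3) that[THEN conjunct1] that[THEN conjunct2]])
  qed
qed

lemma openin_in_sigma_sets_of_base:
  assumes "countable B" and "\<And>U x. openin T U \<Longrightarrow> x \<in> U \<Longrightarrow> \<exists>V\<in>B. x \<in> V \<and> V \<subseteq> U"
    and "B \<subseteq> sets M" and "openin T U"
  shows "U \<in> sets M"
proof -
  have "U = \<Union>{V \<in> B. V \<subseteq> U}"
    using assms(2)[OF assms(4)] by blast
  also have "\<dots> \<in> sets M"
    by (rule sets.countable_Union) (use assms(1,3) in \<open>auto intro: countable_subset\<close>)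
  finally show ?thesis .
qed

text \<open>The inclusion of \<open>sets M\<close> in the Borel sets is encoded as measurability of
  the identity out of the Borel space; on a product this can be checked coordinate by
  coordinate.\<close>

lemma sets_eq_sigma_sets_open:
  assumes open_sets: "\<And>U. openin T U \<Longrightarrow> U \<in> sets M" and "topspace T = space M"
    and id: "(\<lambda>x. x) \<in> measurable (sigma (topspace T) {U. openin T U}) M"
  shows "sets M = sigma_sets (topspace T) {U. openin T U}"
proof
  have sub: "{U. openin T U} \<subseteq> Pow (topspace T)" by (auto dest: openin_subset)
  show "sigma_sets (topspace T) {U. openin T U} \<subseteq> sets M"
    unfolding assms(2) by (rule sets.sigma_sets_subset) (use open_sets in auto)
  show "sets M \<subseteq> sigma_sets (topspace T) {U. openin T U}"
  proof
    fix A assume A: "A \<in> sets M"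
    then have "(\<lambda>x. x) -` A \<inter> space (sigma (topspace T) {U. openin T U})
        \<in> sets (sigma (topspace T) {U. openin T U})"
      by (rule measurable_sets[OF id])
    moreover have "A \<subseteq> topspace T" using A assms(2) by (auto dest: sets.sets_into_space)
    ultimately show "A \<in> sigma_sets (topspace T) {U. openin T U}"
      using sub by (simp add: Int_absorb2)
  qed
qed

lemma standard_prob_space_pair_real:
  assumes std: "standard_prob_space M" and \<nu>: "prob_space \<nu>" "sets \<nu> = sets (borel :: real measure)"
  shows "standard_prob_space (M \<Otimes>\<^sub>M \<nu>)"
proof -
  interpret \<nu>: prob_space \<nu> by fact
  obtain T where T: "prob_space M" "completely_metrizable_space T" "second_countable T"
      "topspace T = space M" "sets M = sigma_sets (topspace T) {U. openin T U}"
    using std by (auto simp: standard_prob_space_def)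
  interpret M: prob_space M by fact
  interpret P: pair_prob_space M \<nu> ..
  have space_\<nu>: "space \<nu> = UNIV" using sets_eq_imp_space_eq[OF \<nu>(2)] by simp
  let ?P = "prod_topology T (euclidean :: real topology)"
  let ?S = "sigma (topspace ?P) {U. openin ?P U}"
  have sub: "{U. openin ?P U} \<subseteq> Pow (topspace ?P)" using openin_subset by blast
  have top: "topspace ?P = space (M \<Otimes>\<^sub>M \<nu>)"
    by (simp add: T(4) space_pair_measure space_\<nu>)
  obtain B where B: "countable B" "\<And>V. V \<in> B \<Longrightarrow> openin T V"
      "\<And>U x. openin T U \<Longrightarrow> x \<in> U \<Longrightarrow> \<exists>V\<in>B. x \<in> V \<and> V \<subseteq> U"
    using T(3) by (auto simp: second_countable_def)
  have sc: "second_countable (euclidean :: real topology)"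
  proof -
    obtain B :: "real set set" where "countable B" "\<And>C. C \<in> B \<Longrightarrow> open C"
        "\<And>S. open S \<Longrightarrow> \<exists>U. U \<subseteq> B \<and> S = \<Union>U"
      using univ_second_countable by blast
    then show ?thesis
      unfolding second_countable_def by (intro exI[of _ B]) (simp add: open_openin[symmetric], blast)
  qed
  then obtain C where C: "countable C" "\<And>V. V \<in> C \<Longrightarrow> open (V :: real set)"
      "\<And>U x. open U \<Longrightarrow> x \<in> U \<Longrightarrow> \<exists>V\<in>C. x \<in> V \<and> V \<subseteq> U"
    by (auto simp: second_countable_def)
  have open_sets: "U \<in> sets (M \<Otimes>\<^sub>M \<nu>)" if "openin ?P U" for U
  proof (rule openin_in_sigma_sets_of_base[OF _ _ _ that])
    let ?D = "(\<lambda>(U, V). U \<times> V) ` (B \<times> C)"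
    show "countable ?D" using B C by auto
    show "?D \<subseteq> sets (M \<Otimes>\<^sub>M \<nu>)"
      using B(2) C(2) by (auto simp: T(5) \<nu>(2) intro!: pair_measureI)
    show "\<exists>V\<in>?D. z \<in> V \<and> V \<subseteq> W" if "openin ?P W" "z \<in> W" for W z
      by (rule prod_topology_base[OF B(3) C(3) that]) simp_all
  qed
  have fst: "fst \<in> measurable ?S M"
  proof (rule measurable_sigma_sets[OF T(5)])
    show "fst \<in> space ?S \<rightarrow> topspace T" using sub by auto
    show "fst -` y \<inter> space ?S \<in> sets ?S" if "y \<in> {U. openin T U}" for y
    proof -
      have "fst -` y \<inter> space ?S = y \<times> UNIV"
        using sub that openin_subset[of T y] by auto
      moreover have "openin ?P (y \<times> UNIV)"
        using that by (simp add: openin_prod_Times_iff)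
      ultimately show ?thesis using sub by auto
    qed
  qed (auto dest: openin_subset)
  have snd: "snd \<in> measurable ?S borel"
  proof (rule borel_measurableI)
    fix S :: "real set" assume "open S"
    then have "openin ?P (topspace T \<times> S)"
      by (simp add: openin_prod_Times_iff)
    moreover have "snd -` S \<inter> space ?S = topspace T \<times> S"
      using sub by auto
    ultimately show "snd -` S \<inter> space ?S \<in> sets ?S" using sub by auto
  qed
  have id: "(\<lambda>z. z) \<in> measurable ?S (M \<Otimes>\<^sub>M \<nu>)"
    using measurable_Pair[OF fst snd] measurable_cong_sets[OF refl sets_pair_measure_cong[OF refl \<nu>(2), of M], of ?S]
    by simp
  have "sets (M \<Otimes>\<^sub>M \<nu>) = sigma_sets (topspace ?P) {U. openin ?P U}"
    by (rule sets_eq_sigma_sets_open[OF open_sets top id])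
  moreover have "completely_metrizable_space ?P"
    by (simp add: completely_metrizable_space_prod_topology T(2) completely_metrizable_space_euclidean)
  moreover have "second_countable ?P"
    by (rule second_countable_prod_topology[OF T(3) sc])
  ultimately show ?thesis
    unfolding standard_prob_space_def using top P.prob_space_axioms by blast
qed

text \<open>These are the cylinders. A cylinder is determined by its finite set \<open>J\<close> of
  restricted coordinates and a choice of a subset of \<open>S\<close> for each of them: there are
  countably many \<open>J\<close>, and finitely many choices for each because \<open>S\<close> is
  finite.\<close>

lemma countable_PiE_finitely_restricted:
  assumes I: "countable I" and S: "finite S"
  shows "countable {PiE I U | U. (\<forall>i\<in>I. U i \<subseteq> S) \<and> finite {i \<in> I. U i \<noteq> S}}" (is "countable ?B")
proof -
  let ?F = "{J. finite J \<and> J \<subseteq> I}"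
  let ?C = "(\<Union>J\<in>?F. (\<lambda>g. PiE I (\<lambda>i. if i \<in> J then g i else S)) ` (PiE J (\<lambda>_. Pow S)))"
  have F: "countable ?F" by (rule countable_Collect_finite_subset[OF I])
  have "countable ?C"
  proof (rule countable_UN[OF F])
    fix J assume "J \<in> ?F"
    then have "finite (PiE J (\<lambda>_. Pow S))" using S by (auto intro: finite_PiE)
    then show "countable ((\<lambda>g. PiE I (\<lambda>i. if i \<in> J then g i else S)) ` (PiE J (\<lambda>_. Pow S)))"
      by (auto intro: countable_finite)
  qed
  moreover have "?B \<subseteq> ?C"
  proof
    fix W assume "W \<in> ?B"
    then obtain U where U: "W = PiE I U" "\<forall>i\<in>I. U i \<subseteq> S" "finite {i \<in> I. U i \<noteq> S}" by auto
    let ?J = "{i \<in> I. U i \<noteq> S}"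
    have "W = PiE I (\<lambda>i. if i \<in> ?J then restrict U ?J i else S)"
      unfolding U(1) by (rule PiE_cong) auto
    moreover have "restrict U ?J \<in> PiE ?J (\<lambda>_. Pow S)" using U(2) by auto
    ultimately have "W \<in> (\<lambda>g. PiE I (\<lambda>i. if i \<in> ?J then g i else S)) ` (PiE ?J (\<lambda>_. Pow S))"
      by (rule image_eqI)
    then show "W \<in> ?C" using U(3) by (intro UN_I[of ?J]) auto
  qed
  ultimately show ?thesis by (rule countable_subset[rotated])
qed

text \<open>The witness is the product of discrete topologies. Its countable base of cylinders lies
  in the product sigma-algebra, so topology and measure structure generate the same sets.\<close>

lemma standard_prob_space_PiM_finite_discrete:
  assumes I: "countable I" and S: "finite S"
    and m: "\<And>i. i \<in> I \<Longrightarrow> prob_space (m i)" "\<And>i. i \<in> I \<Longrightarrow> sets (m i) = Pow S"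
  shows "standard_prob_space (PiM I m)"
proof -
  interpret prob_space "PiM I m" by (rule prob_space_PiM[OF m(1)])
  let ?P = "product_topology (\<lambda>_. discrete_topology S) I"
  let ?S = "sigma (topspace ?P) {U. openin ?P U}"
  let ?B = "{PiE I U | U. (\<forall>i\<in>I. U i \<subseteq> S) \<and> finite {i \<in> I. U i \<noteq> S}}"
  have sub: "{U. openin ?P U} \<subseteq> Pow (topspace ?P)" using openin_subset by blast
  have space_m: "space (m i) = S" if "i \<in> I" for i
    using sets_eq_imp_space_eq[of "m i" "count_space S"] m(2)[OF that] by simp
  have top: "topspace ?P = space (PiM I m)"
    unfolding topspace_product_topology space_PiM by (rule PiE_cong) (simp add: space_m)
  have cB: "countable ?B" by (rule countable_PiE_finitely_restricted[OF I S])
  have base: "\<exists>V\<in>?B. x \<in> V \<and> V \<subseteq> U" if U: "openin ?P U" "x \<in> U" for U x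
  proof -
    obtain V where V: "finite {i \<in> I. V i \<noteq> S}" "\<forall>i\<in>I. V i \<subseteq> S" "x \<in> PiE I V" "PiE I V \<subseteq> U"
      using U unfolding openin_product_topology_alt by (auto dest!: bspec[of _ _ x])
    then have "PiE I V \<in> ?B" by blast
    with V(3,4) show ?thesis by blast
  qed
  have B_sets: "?B \<subseteq> sets (PiM I m)"
  proof
    fix W assume "W \<in> ?B"
    then obtain U where U: "W = PiE I U" "\<forall>i\<in>I. U i \<subseteq> S" by auto
    show "W \<in> sets (PiM I m)"
      unfolding U(1) by (rule sets_PiM_I_countable[OF I]) (use U(2) m(2) in auto)
  qed
  have B_open: "openin ?P V" if "V \<in> ?B" for V
    using that by (auto simp: openin_PiE_gen)
  have sc: "second_countable ?P"
    unfolding second_countable_def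
  proof (intro exI[of _ ?B] conjI ballI allI impI)
    show "countable ?B" by (rule cB)
    show "openin ?P V" if "V \<in> ?B" for V by (rule B_open[OF that])
    show "\<exists>V\<in>?B. x \<in> V \<and> V \<subseteq> U" if "openin ?P U \<and> x \<in> U" for U x
      using base that by auto
  qed
  have id: "(\<lambda>x. x) \<in> measurable ?S (PiM I m)"
  proof (rule measurable_PiM_single')
    show "(\<lambda>x. x i) \<in> measurable ?S (m i)" if i: "i \<in> I" for i
    proof (rule measurableI)
      show "x i \<in> space (m i)" if "x \<in> space ?S" for x
        using that i sub by (auto simp: space_m)
      fix A assume A: "A \<in> sets (m i)"
      have "openin ?P {x \<in> topspace ?P. x i \<in> A}"
        by (rule openin_continuous_map_preimage[OF continuous_map_product_projection[OF i]])
           (use A m(2)[OF i] in auto)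
      moreover have "(\<lambda>x. x i) -` A \<inter> space ?S = {x \<in> topspace ?P. x i \<in> A}"
        using sub by auto
      ultimately show "(\<lambda>x. x i) -` A \<inter> space ?S \<in> sets ?S" using sub by auto
    qed
    show "(\<lambda>x. x) \<in> space ?S \<rightarrow> (\<Pi>\<^sub>E i\<in>I. space (m i))"
      using sub top by (auto simp: space_PiM)
  qed
  have "sets (PiM I m) = sigma_sets (topspace ?P) {U. openin ?P U}"
    by (rule sets_eq_sigma_sets_open[OF openin_in_sigma_sets_of_base[OF cB base B_sets] top id])
  moreover have "completely_metrizable_space ?P"
    using I by (auto simp: completely_metrizable_space_product_topology completely_metrizable_space_discrete_topology
        intro: countable_subset)
  ultimately show ?thesis
    unfolding standard_prob_space_def using top sc prob_space_axioms by blast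
qed

section \<open>Densities of infinite products\<close>

text \<open>The integrand only sees the coordinates in \<open>J\<close>, so the integral is pushed
  forward to the finite product over \<open>J\<close>, where Tonelli factorises it.\<close>

lemma nn_integral_PiM_prod:
  fixes u :: "'i \<Rightarrow> 'a \<Rightarrow> ennreal"
  assumes M: "\<And>i. i \<in> I \<Longrightarrow> prob_space (M i)" and J: "finite J" "J \<subseteq> I"
    and u: "\<And>i. i \<in> J \<Longrightarrow> u i \<in> borel_measurable (M i)"
  shows "(\<integral>\<^sup>+ x. (\<Prod>i\<in>J. u i (x i)) \<partial>PiM I M) = (\<Prod>i\<in>J. \<integral>\<^sup>+ y. u i y \<partial>M i)"
proof -
  \<comment> \<open>\<open>product_sigma_finite\<close> speaks about every index of the type;
    outside \<open>I\<close> the family is filled up with one-point probability spaces.\<close>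
  let ?M = "\<lambda>i. if i \<in> I then M i else count_space {undefined}"
  interpret M': prob_space "?M i" for i
    using M by (cases "i \<in> I") (auto intro!: prob_spaceI)
  interpret product_sigma_finite ?M by unfold_locales
  have meas: "(\<lambda>x. \<Prod>i\<in>J. u i (x i)) \<in> borel_measurable (PiM J M)"
    by (intro borel_measurable_prod_ennreal) (rule measurable_compose[OF measurable_component_singleton], auto intro: u)
  have "(\<integral>\<^sup>+ x. (\<Prod>i\<in>J. u i (x i)) \<partial>PiM I M)
      = (\<integral>\<^sup>+ x. (\<Prod>i\<in>J. u i ((\<lambda>n\<in>J. x n) i)) \<partial>PiM I M)"
    by (intro nn_integral_cong prod.cong) auto
  also have "\<dots> = (\<integral>\<^sup>+ x. (\<Prod>i\<in>J. u i (x i)) \<partial>distr (PiM I M) (PiM J M) (\<lambda>x. \<lambda>n\<in>J. x n))"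
    using meas J(2) by (subst nn_integral_distr) (auto intro!: measurable_restrict_subset)
  also have "distr (PiM I M) (PiM J M) (\<lambda>x. \<lambda>n\<in>J. x n) = PiM J M"
    using distr_PiM_reindex[where K = I and M = M and f = "\<lambda>x. x" and I = J] M J(2) by auto
  also have "PiM J M = PiM J ?M"
    using J(2) by (intro PiM_cong) auto
  also have "(\<integral>\<^sup>+ x. (\<Prod>i\<in>J. u i (x i)) \<partial>PiM J ?M) = (\<Prod>i\<in>J. \<integral>\<^sup>+ y. u i y \<partial>?M i)"
    using J u by (intro product_nn_integral_prod) auto
  also have "\<dots> = (\<Prod>i\<in>J. \<integral>\<^sup>+ y. u i y \<partial>M i)"
    using J by (intro prod.cong) auto
  finally show ?thesis .
qed

lemma summable_on_finite_tail:
  fixes a :: "'i \<Rightarrow> real"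
  assumes a: "a summable_on I" "\<And>i. i \<in> I \<Longrightarrow> 0 \<le> a i" and "0 < \<epsilon>"
  obtains F where "finite F" "F \<subseteq> I" "\<And>K. finite K \<Longrightarrow> K \<subseteq> I \<Longrightarrow> K \<inter> F = {} \<Longrightarrow> sum a K \<le> \<epsilon>"
proof -
  have "infsum a I - \<epsilon> < infsum a I" using assms by simp
  moreover have "infsum a I = (SUP F\<in>{F. finite F \<and> F \<subseteq> I}. sum a F)"
    by (rule infsum_nonneg_is_SUPREMUM_real[OF a])
  ultimately obtain F where F: "finite F" "F \<subseteq> I" "infsum a I - \<epsilon> < sum a F"
    using infsum_le_finite_sums[OF a(1), of "infsum a I - \<epsilon>"] by (meson linorder_not_less)
  show thesis
  proof (rule that[OF F(1,2)])
    fix K assume K: "finite K" "K \<subseteq> I" "K \<inter> F = {}"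
    have "sum a K + sum a F = sum a (K \<union> F)"
      using K F by (simp add: sum.union_disjoint)
    also have "\<dots> \<le> infsum a I"
      using K F a by (intro finite_sum_le_infsum) auto
    finally show "sum a K \<le> \<epsilon>" using F(3) by simp
  qed
qed

lemma exhausting_finite_sets_with_small_tails:
  fixes a :: "'i \<Rightarrow> real" and \<epsilon> :: "nat \<Rightarrow> real"
  assumes I: "countable I" and a: "a summable_on I" "\<And>i. i \<in> I \<Longrightarrow> 0 \<le> a i" and \<epsilon>: "\<And>n. 0 < \<epsilon> n"
  obtains J where "\<And>n. finite (J n)" "\<And>n. J n \<subseteq> I" "incseq J" "(\<Union>n. J n) = I"
    "\<And>n K. finite K \<Longrightarrow> K \<subseteq> I \<Longrightarrow> K \<inter> J n = {} \<Longrightarrow> sum a K \<le> \<epsilon> n"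
proof -
  have "\<exists>F. finite F \<and> F \<subseteq> I \<and> (\<forall>K. finite K \<longrightarrow> K \<subseteq> I \<longrightarrow> K \<inter> F = {} \<longrightarrow> sum a K \<le> \<epsilon> n)" for n
    using summable_on_finite_tail[OF a \<epsilon>[of n]] by metis
  then obtain F where F: "\<And>n. finite (F n)" "\<And>n. F n \<subseteq> I"
      "\<And>n K. finite K \<Longrightarrow> K \<subseteq> I \<Longrightarrow> K \<inter> F n = {} \<Longrightarrow> sum a K \<le> \<epsilon> n"
    by metis
  \<comment> \<open>The union over \<open>m \<le> n\<close> makes the sequence increasing. The
    enumerated elements make it exhaust \<open>I\<close>, which the tail sets alone might not do:
    they may omit indices where \<open>a\<close> vanishes.\<close>
  define J where "J n = (\<Union>m\<le>n. F m) \<union> {i \<in> I. to_nat_on I i \<le> n}" for n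
  show thesis
  proof (rule that[of J])
    show "finite (J n)" for n
    proof -
      have "finite {i \<in> I. to_nat_on I i \<le> n}"
        using inj_on_to_nat_on[OF I]
        by (intro inj_on_finite[of "to_nat_on I" _ "{..n}"]) (auto intro: inj_on_subset)
      then show ?thesis using F(1) by (simp add: J_def)
    qed
    show "J n \<subseteq> I" for n using F(2) by (auto simp: J_def)
    show "incseq J" unfolding incseq_def J_def by (auto 4 3 intro: order_trans)
    show "(\<Union>n. J n) = I" using F(2) by (auto simp: J_def)
    show "sum a K \<le> \<epsilon> n" if "finite K" "K \<subseteq> I" "K \<inter> J n = {}" for n K
      using that by (intro F(3)) (auto simp: J_def)
  qed
qed

text \<open>\<open>r i\<close> is a density at coordinate \<open>i\<close>, and summability of
  \<open>a\<close> is a mean-square form of Kakutani's criterion. Second moments are used because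
  distances of partial products can then be computed exactly; writing the bound as
  \<open>exp (a i)\<close> turns products into sums. Positivity is asked at all points, so that
  products and real powers can be handled without reference to the underlying space.\<close>

locale product_density =
  fixes I :: "'i set" and M :: "'i \<Rightarrow> 'a measure" and r :: "'i \<Rightarrow> 'a \<Rightarrow> real" and a :: "'i \<Rightarrow> real"
  assumes countable_I: "countable I"
    and prob_space_M: "\<And>i. i \<in> I \<Longrightarrow> prob_space (M i)"
    and r_measurable: "\<And>i. i \<in> I \<Longrightarrow> r i \<in> borel_measurable (M i)"
    and r_pos: "\<And>i y. i \<in> I \<Longrightarrow> 0 < r i y"
    and r_one: "\<And>i. i \<in> I \<Longrightarrow> (\<integral>\<^sup>+ y. ennreal (r i y) \<partial>M i) = 1"
    and r_sq: "\<And>i. i \<in> I \<Longrightarrow> (\<integral>\<^sup>+ y. ennreal ((r i y)\<^sup>2) \<partial>M i) \<le> ennreal (exp (a i))"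
    and a_nonneg: "\<And>i. i \<in> I \<Longrightarrow> 0 \<le> a i"
    and a_summable: "a summable_on I"
begin

sublocale P: prob_space "PiM I M" by (rule prob_space_PiM[OF prob_space_M])

definition pr :: "'i set \<Rightarrow> ('i \<Rightarrow> 'a) \<Rightarrow> real" where
  "pr J x = (\<Prod>i\<in>J. r i (x i))"

lemma pr_pos: "J \<subseteq> I \<Longrightarrow> 0 < pr J x"
  unfolding pr_def by (rule prod_pos) (auto intro: r_pos)

lemma pr_measurable: "J \<subseteq> I \<Longrightarrow> pr J \<in> borel_measurable (PiM I M)"
  unfolding pr_def
  by (intro borel_measurable_prod) (rule measurable_compose[OF measurable_component_singleton], auto intro: r_measurable)

lemma pr_sq_eq:
  assumes "finite J" "J \<subseteq> I"
  shows "(\<integral>\<^sup>+ x. ennreal ((pr J x)\<^sup>2) \<partial>PiM I M) = (\<Prod>i\<in>J. \<integral>\<^sup>+ y. ennreal ((r i y)\<^sup>2) \<partial>M i)"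
proof -
  have "(\<integral>\<^sup>+ x. ennreal ((pr J x)\<^sup>2) \<partial>PiM I M) = (\<integral>\<^sup>+ x. (\<Prod>i\<in>J. ennreal ((r i (x i))\<^sup>2)) \<partial>PiM I M)"
    by (simp add: pr_def prod_ennreal prod_power_distrib)
  also have "\<dots> = (\<Prod>i\<in>J. \<integral>\<^sup>+ y. ennreal ((r i y)\<^sup>2) \<partial>M i)"
    using assms r_measurable by (intro nn_integral_PiM_prod prob_space_M) auto
  finally show ?thesis .
qed

lemma prod_sq_le:
  assumes "finite J" "J \<subseteq> I"
  shows "(\<Prod>i\<in>J. \<integral>\<^sup>+ y. ennreal ((r i y)\<^sup>2) \<partial>M i) \<le> ennreal (exp (sum a J))"
proof -
  have "(\<Prod>i\<in>J. \<integral>\<^sup>+ y. ennreal ((r i y)\<^sup>2) \<partial>M i) \<le> (\<Prod>i\<in>J. ennreal (exp (a i)))"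
    using assms r_sq by (intro prod_mono_ennreal) auto
  also have "\<dots> = ennreal (exp (sum a J))"
    using assms by (simp add: prod_ennreal exp_sum)
  finally show ?thesis .
qed

text \<open>Orthogonality of martingale increments: the inner product of \<open>pr J\<close> and
  \<open>pr J'\<close> is the squared norm of \<open>pr J\<close>. Hence the squared distance is the
  squared norm of \<open>pr J\<close> times the squared norm of \<open>pr (J' - J)\<close> minus
  one.\<close>

lemma pr_diff_sq_le:
  assumes J: "finite J'" "J \<subseteq> J'" "J' \<subseteq> I"
  shows "(\<integral>\<^sup>+ x. ennreal ((pr J' x - pr J x)\<^sup>2) \<partial>PiM I M)
    \<le> ennreal (exp (infsum a I) * (exp (sum a (J' - J)) - 1))"
proof -
  have J_fin: "finite J" "J \<subseteq> I" using J finite_subset by auto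
  note [measurable] = pr_measurable[OF J(3)] pr_measurable[OF J_fin(2)]
  let ?S = "\<Prod>i\<in>J. \<integral>\<^sup>+ y. ennreal ((r i y)\<^sup>2) \<partial>M i"
  let ?D = "\<integral>\<^sup>+ x. ennreal ((pr J' x - pr J x)\<^sup>2) \<partial>PiM I M"
  have S_le: "?S \<le> ennreal (exp (infsum a I))"
  proof -
    have "sum a J \<le> infsum a I"
      using a_summable a_nonneg J_fin by (intro finite_sum_le_infsum) auto
    then show ?thesis
      using prod_sq_le[OF J_fin] by (meson ennreal_leI exp_le_cancel_iff order_trans)
  qed
  then obtain s where s: "?S = ennreal s" "0 \<le> s"
    by (cases ?S) (auto simp: top_unique)
  \<comment> \<open>On \<open>J\<close> the factor appears twice; on \<open>J' - J\<close> it
    appears once and integrates to one.\<close>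
  have cross: "(\<integral>\<^sup>+ x. ennreal (pr J x * pr J' x) \<partial>PiM I M) = ?S"
  proof -
    have "(\<integral>\<^sup>+ x. ennreal (pr J x * pr J' x) \<partial>PiM I M)
        = (\<integral>\<^sup>+ x. (\<Prod>i\<in>J'. ennreal (if i \<in> J then (r i (x i))\<^sup>2 else r i (x i))) \<partial>PiM I M)"
    proof (rule nn_integral_cong)
      fix x
      have "pr J' x = pr J x * pr (J' - J) x"
        unfolding pr_def using J by (simp add: prod.subset_diff mult.commute)
      then have "pr J x * pr J' x = (\<Prod>i\<in>J. (r i (x i))\<^sup>2) * (\<Prod>i\<in>J'-J. r i (x i))"
        by (simp add: pr_def prod.distrib power2_eq_square)
      also have "\<dots> = (\<Prod>i\<in>J'. if i \<in> J then (r i (x i))\<^sup>2 else r i (x i))"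
        using J by (simp add: prod.If_cases Int_absorb1 Diff_eq)
      finally have "pr J x * pr J' x = (\<Prod>i\<in>J'. if i \<in> J then (r i (x i))\<^sup>2 else r i (x i))" .
      moreover have "0 \<le> (if i \<in> J then (r i (x i))\<^sup>2 else r i (x i))" if "i \<in> J'" for i
        using r_pos[of i "x i"] that J by auto
      ultimately show "ennreal (pr J x * pr J' x)
          = (\<Prod>i\<in>J'. ennreal (if i \<in> J then (r i (x i))\<^sup>2 else r i (x i)))"
        by (simp add: prod_ennreal)
    qed
    also have "\<dots> = (\<Prod>i\<in>J'. \<integral>\<^sup>+ y. ennreal (if i \<in> J then (r i y)\<^sup>2 else r i y) \<partial>M i)"
    proof (rule nn_integral_PiM_prod[OF prob_space_M J(1,3)])
      fix i assume "i \<in> J'"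
      then have [measurable]: "r i \<in> borel_measurable (M i)" using J r_measurable by auto
      show "(\<lambda>y. ennreal (if i \<in> J then (r i y)\<^sup>2 else r i y)) \<in> borel_measurable (M i)" by measurable
    qed
    also have "\<dots> = (\<Prod>i\<in>J'. if i \<in> J then \<integral>\<^sup>+ y. ennreal ((r i y)\<^sup>2) \<partial>M i else 1)"
      using J r_one by (intro prod.cong) auto
    also have "\<dots> = ?S"
      using J by (simp add: prod.If_cases Int_absorb1)
    finally show ?thesis .
  qed
  \<comment> \<open>The binomial formula is used with the cross term on the left, so that nothing
    has to be subtracted in \<open>ennreal\<close>.\<close>
  have "?D + 2 * ?S = (\<integral>\<^sup>+ x. ennreal ((pr J' x - pr J x)\<^sup>2) + 2 * ennreal (pr J x * pr J' x) \<partial>PiM I M)"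
    unfolding cross[symmetric] by (subst nn_integral_add) (auto simp: nn_integral_cmult)
  also have "\<dots> = (\<integral>\<^sup>+ x. ennreal ((pr J' x)\<^sup>2) + ennreal ((pr J x)\<^sup>2) \<partial>PiM I M)"
  proof (rule nn_integral_cong)
    fix x
    have "0 < pr J x" "0 < pr J' x" using pr_pos J J_fin by auto
    then have "ennreal ((pr J' x - pr J x)\<^sup>2) + 2 * ennreal (pr J x * pr J' x)
        = ennreal ((pr J' x - pr J x)\<^sup>2 + 2 * (pr J x * pr J' x))"
      by (subst ennreal_plus) (simp_all add: ennreal_mult)
    also have "(pr J' x - pr J x)\<^sup>2 + 2 * (pr J x * pr J' x) = (pr J' x)\<^sup>2 + (pr J x)\<^sup>2"
      by (simp add: power2_diff)
    finally show "ennreal ((pr J' x - pr J x)\<^sup>2) + 2 * ennreal (pr J x * pr J' x)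
        = ennreal ((pr J' x)\<^sup>2) + ennreal ((pr J x)\<^sup>2)"
      by simp
  qed
  also have "\<dots> = (\<Prod>i\<in>J'. \<integral>\<^sup>+ y. ennreal ((r i y)\<^sup>2) \<partial>M i) + ?S"
    by (subst nn_integral_add) (simp_all add: pr_sq_eq J J_fin)
  also have "(\<Prod>i\<in>J'. \<integral>\<^sup>+ y. ennreal ((r i y)\<^sup>2) \<partial>M i)
      = (\<Prod>i\<in>J'-J. \<integral>\<^sup>+ y. ennreal ((r i y)\<^sup>2) \<partial>M i) * ?S"
    using J by (simp add: prod.subset_diff)
  also have "\<dots> \<le> ennreal (exp (sum a (J' - J))) * ?S"
    using J by (intro mult_right_mono prod_sq_le) auto
  finally have "?D + ennreal (2 * s) \<le> ennreal (exp (sum a (J' - J)) * s + s)"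
    using s by (simp add: ennreal_mult add_mono)
  then obtain d where d: "?D = ennreal d" "0 \<le> d" "ennreal (d + 2 * s) \<le> ennreal (exp (sum a (J' - J)) * s + s)"
    using s by (cases ?D) (auto simp: top_unique)
  then have d_le: "d + 2 * s \<le> exp (sum a (J' - J)) * s + s"
    using s by (simp add: ennreal_le_iff del: ennreal_plus)
  have "0 \<le> sum a (J' - J)" using J a_nonneg by (intro sum_nonneg) auto
  then have "(exp (sum a (J' - J)) - 1) * s \<le> (exp (sum a (J' - J)) - 1) * exp (infsum a I)"
    using S_le s by (intro mult_left_mono) (auto simp: ennreal_le_iff)
  then show ?thesis
    unfolding d(1) by (intro ennreal_leI) (use d_le in \<open>simp add: algebra_simps\<close>)
qed

text \<open>Instead of Cauchy-Schwarz, the pointwise inequality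
  \<open>t \<le> (1/2)^n + 2^n * t^2\<close> passes from the square to the absolute value. Its
  weights are balanced so that a tail of size \<open>(1/4)^n\<close> yields a summable bound of
  order \<open>(1/2)^n\<close>.\<close>

lemma pr_diff_L1_le:
  assumes J: "finite J'" "J \<subseteq> J'" "J' \<subseteq> I" and tail: "sum a (J' - J) \<le> (1/4) ^ n"
  shows "(\<integral>\<^sup>+ x. ennreal \<bar>pr J' x - pr J x\<bar> \<partial>PiM I M) \<le> ennreal ((1 + 2 * exp (infsum a I)) * (1/2) ^ n)"
proof -
  have JI: "J \<subseteq> I" using J by auto
  note [measurable] = pr_measurable[OF J(3)] pr_measurable[OF JI]
  have "(\<integral>\<^sup>+ x. ennreal \<bar>pr J' x - pr J x\<bar> \<partial>PiM I M)
      \<le> (\<integral>\<^sup>+ x. ennreal ((1/2) ^ n) + ennreal (2 ^ n) * ennreal ((pr J' x - pr J x)\<^sup>2) \<partial>PiM I M)"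
  proof (rule nn_integral_mono)
    fix x
    define t where "t = \<bar>pr J' x - pr J x\<bar>"
    have "t \<le> (1/2) ^ n + 2 ^ n * t\<^sup>2"
    proof (cases "t \<le> (1/2) ^ n")
      case False
      then have "1 \<le> 2 ^ n * t" by (simp add: power_divide field_simps)
      then have "1 * t \<le> (2 ^ n * t) * t" by (intro mult_right_mono) (auto simp: t_def)
      then have "t \<le> 2 ^ n * t\<^sup>2" by (simp add: power2_eq_square mult.assoc)
      moreover have "0 \<le> (1/2::real) ^ n" by simp
      ultimately show ?thesis by linarith
    qed (simp add: add_increasing2)
    then have "t \<le> (1/2) ^ n + 2 ^ n * (pr J' x - pr J x)\<^sup>2" by (simp add: t_def)
    then have "ennreal t \<le> ennreal ((1/2) ^ n + 2 ^ n * (pr J' x - pr J x)\<^sup>2)" by (rule ennreal_leI)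
    also have "\<dots> = ennreal ((1/2) ^ n) + ennreal (2 ^ n) * ennreal ((pr J' x - pr J x)\<^sup>2)"
      by (subst ennreal_plus) (auto simp: ennreal_mult)
    finally show "ennreal \<bar>pr J' x - pr J x\<bar> \<le> ennreal ((1/2) ^ n) + ennreal (2 ^ n) * ennreal ((pr J' x - pr J x)\<^sup>2)"
      by (simp add: t_def)
  qed
  also have "\<dots> = ennreal ((1/2) ^ n) + ennreal (2 ^ n) * (\<integral>\<^sup>+ x. ennreal ((pr J' x - pr J x)\<^sup>2) \<partial>PiM I M)"
    by (subst nn_integral_add) (auto simp: nn_integral_cmult P.emeasure_space_1)
  also have "\<dots> \<le> ennreal ((1/2) ^ n) + ennreal (2 ^ n) * ennreal (exp (infsum a I) * (exp (sum a (J' - J)) - 1))"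
    by (intro add_left_mono mult_left_mono pr_diff_sq_le J) auto
  also have "\<dots> \<le> ennreal ((1/2) ^ n) + ennreal (2 ^ n) * ennreal (exp (infsum a I) * (2 * (1/4) ^ n))"
  proof -
    \<comment> \<open>For \<open>0 \<le> s \<le> 1\<close> one has
      \<open>exp s \<le> 1 + s + s^2 \<le> 1 + 2 * s\<close>; this is the origin of the factor
      \<open>2\<close>.\<close>
    have s0: "0 \<le> sum a (J' - J)" using J a_nonneg by (intro sum_nonneg) auto
    have "(1/4::real) ^ n \<le> 1" by (intro power_le_one) auto
    then have s1: "sum a (J' - J) \<le> 1" using tail by linarith
    have "exp (sum a (J' - J)) \<le> 1 + sum a (J' - J) + (sum a (J' - J))\<^sup>2"
      by (rule exp_bound[OF s0 s1])
    moreover have "(sum a (J' - J))\<^sup>2 \<le> sum a (J' - J)"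
      using mult_left_mono[OF s1 s0] by (simp add: power2_eq_square)
    ultimately have "exp (sum a (J' - J)) - 1 \<le> 2 * (1/4) ^ n" using tail by linarith
    then show ?thesis
      by (intro add_left_mono mult_left_mono ennreal_leI) auto
  qed
  also have "\<dots> = ennreal ((1 + 2 * exp (infsum a I)) * (1/2) ^ n)"
  proof -
    have "(2::real) ^ n * (1/4) ^ n = (1/2) ^ n"
      by (simp add: power_mult_distrib[symmetric])
    then have "(1/2) ^ n + 2 ^ n * (exp (infsum a I) * (2 * (1/4) ^ n)) = (1 + 2 * exp (infsum a I)) * (1/2::real) ^ n"
      by (simp add: algebra_simps)
    then show ?thesis
      by (simp add: ennreal_mult[symmetric] ennreal_plus[symmetric] del: ennreal_plus)
  qed
  finally show ?thesis .
qed

lemma nn_integral_pr: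
  assumes J: "finite J" "J \<subseteq> I"
  shows "(\<integral>\<^sup>+ x. ennreal (pr J x) \<partial>PiM I M) = 1"
proof -
  have "(\<integral>\<^sup>+ x. ennreal (pr J x) \<partial>PiM I M) = (\<integral>\<^sup>+ x. (\<Prod>i\<in>J. ennreal (r i (x i))) \<partial>PiM I M)"
    unfolding pr_def using J r_pos by (intro nn_integral_cong prod_ennreal[symmetric]) (auto intro: less_imp_le)
  also have "\<dots> = (\<Prod>i\<in>J. \<integral>\<^sup>+ y. ennreal (r i y) \<partial>M i)"
    using J r_measurable by (intro nn_integral_PiM_prod[OF prob_space_M]) auto
  also have "\<dots> = 1"
    using J r_one by (intro prod.neutral) auto
  finally show ?thesis .
qed

text \<open>Factors outside \<open>K\<close> have mean one, so a partial product that covers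
  \<open>K\<close> already gives the cylinder its final mass. Along growing \<open>J\<close> these
  integrals are eventually constant, which identifies the limit measure.\<close>

lemma nn_integral_pr_cylinder:
  assumes N: "\<And>i. i \<in> I \<Longrightarrow> N i = density (M i) (\<lambda>y. ennreal (r i y))"
    and J: "finite J" "J \<subseteq> I" and K: "K \<subseteq> J" and A: "\<And>i. i \<in> K \<Longrightarrow> A i \<in> sets (M i)"
  shows "(\<integral>\<^sup>+ x. ennreal (pr J x) * indicator (prod_emb I M K (PiE K A)) x \<partial>PiM I M)
    = (\<Prod>i\<in>K. emeasure (N i) (A i))"
proof -
  let ?u = "\<lambda>i y. ennreal (r i y) * (if i \<in> K then indicator (A i) y else 1)"
  have fin: "finite K" using J K finite_subset by auto
  have "(\<integral>\<^sup>+ x. ennreal (pr J x) * indicator (prod_emb I M K (PiE K A)) x \<partial>PiM I M)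
      = (\<integral>\<^sup>+ x. (\<Prod>i\<in>J. ?u i (x i)) \<partial>PiM I M)"
  proof (rule nn_integral_cong)
    fix x assume x: "x \<in> space (PiM I M)"
    have "indicator (prod_emb I M K (PiE K A)) x = (\<Prod>i\<in>K. indicator (A i) (x i) :: ennreal)"
      using x fin by (auto simp: prod_emb_def space_PiM indicator_def PiE_iff)
    also have "\<dots> = (\<Prod>i\<in>J. if i \<in> K then indicator (A i) (x i) else 1)"
      using J K by (simp add: prod.If_cases Int_absorb1)
    moreover have "ennreal (pr J x) = (\<Prod>i\<in>J. ennreal (r i (x i)))"
      unfolding pr_def using J r_pos by (intro prod_ennreal[symmetric]) (auto intro: less_imp_le)
    ultimately show "ennreal (pr J x) * indicator (prod_emb I M K (PiE K A)) x = (\<Prod>i\<in>J. ?u i (x i))"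
      by (simp add: prod.distrib)
  qed
  also have "\<dots> = (\<Prod>i\<in>J. \<integral>\<^sup>+ y. ?u i y \<partial>M i)"
  proof (rule nn_integral_PiM_prod[OF prob_space_M J])
    fix i assume i: "i \<in> J"
    then have [measurable]: "r i \<in> borel_measurable (M i)" using J r_measurable by auto
    show "?u i \<in> borel_measurable (M i)"
      using A by (cases "i \<in> K") auto
  qed
  also have "\<dots> = (\<Prod>i\<in>J. if i \<in> K then emeasure (N i) (A i) else 1)"
  proof (rule prod.cong[OF refl])
    fix i assume i: "i \<in> J"
    then have iI: "i \<in> I" using J by auto
    have "(\<lambda>y. ennreal (r i y)) \<in> borel_measurable (M i)" using r_measurable[OF iI] by measurable
    then show "(\<integral>\<^sup>+ y. ?u i y \<partial>M i) = (if i \<in> K then emeasure (N i) (A i) else 1)"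
      using A r_one[OF iI] by (simp add: N[OF iI] emeasure_density)
  qed
  also have "\<dots> = (\<Prod>i\<in>K. emeasure (N i) (A i))"
    using J K by (simp add: prod.If_cases Int_absorb1)
  finally show ?thesis .
qed

text \<open>The partial products along sufficiently fast growing finite sets have summable increments in
  \<open>L\<^sup>1\<close>, hence converge almost surely and dominatedly; their limit is the density.\<close>

theorem density_PiM:
  assumes N: "\<And>i. i \<in> I \<Longrightarrow> N i = density (M i) (\<lambda>y. ennreal (r i y))"
  obtains J f where "\<And>n. finite (J n)" "\<And>n. J n \<subseteq> I" "f \<in> borel_measurable (PiM I M)"
    "\<And>x. 0 \<le> f x" "AE x in PiM I M. (\<lambda>n. pr (J n) x) \<longlonglongrightarrow> f x"
    "density (PiM I M) (\<lambda>x. ennreal (f x)) = PiM I N"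
proof -
  obtain J where J: "\<And>n. finite (J n)" "\<And>n. J n \<subseteq> I" "incseq J" "(\<Union>n. J n) = I"
    "\<And>n K. finite K \<Longrightarrow> K \<subseteq> I \<Longrightarrow> K \<inter> J n = {} \<Longrightarrow> sum a K \<le> (1/4) ^ n"
    by (rule exhausting_finite_sets_with_small_tails[OF countable_I a_summable a_nonneg, of "\<lambda>n. (1/4) ^ n"]) auto
  note [measurable] = pr_measurable[OF J(2)]
  define d where "d n x = pr (J (Suc n)) x - pr (J n) x" for n x
  have [measurable]: "d n \<in> borel_measurable (PiM I M)" for n
    unfolding d_def by measurable
  let ?C = "1 + 2 * exp (infsum a I)"
  have d_L1: "(\<integral>\<^sup>+ x. ennreal \<bar>d n x\<bar> \<partial>PiM I M) \<le> ennreal (?C * (1/2) ^ n)" for n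
    unfolding d_def
  proof (rule pr_diff_L1_le[OF J(1) _ J(2)])
    show "J n \<subseteq> J (Suc n)" using J(3) by (auto simp: incseq_Suc_iff)
    show "sum a (J (Suc n) - J n) \<le> (1/4) ^ n" by (rule J(5)) (use J(1,2) in auto)
  qed
  have geo: "(\<lambda>n. ?C * (1/2) ^ n) sums (?C * 2)"
    using geometric_sums[of "1/2::real"] by (intro sums_mult) simp
  have total: "(\<integral>\<^sup>+ x. (\<Sum>n. ennreal \<bar>d n x\<bar>) \<partial>PiM I M) < \<infinity>"
  proof -
    have "(\<integral>\<^sup>+ x. (\<Sum>n. ennreal \<bar>d n x\<bar>) \<partial>PiM I M) = (\<Sum>n. \<integral>\<^sup>+ x. ennreal \<bar>d n x\<bar> \<partial>PiM I M)"
      by (rule nn_integral_suminf) measurable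
    also have "\<dots> \<le> (\<Sum>n. ennreal (?C * (1/2) ^ n))"
      by (rule suminf_le) (auto intro: d_L1)
    also have "\<dots> = ennreal (?C * 2)"
      by (rule suminf_ennreal_eq[OF _ geo]) (simp add: add_nonneg_nonneg)
    finally show ?thesis by (simp add: le_less_trans)
  qed
  have "AE x in PiM I M. (\<Sum>n. ennreal \<bar>d n x\<bar>) \<noteq> \<infinity>"
    by (rule nn_integral_noteq_infinite) (use total in \<open>auto simp: less_top\<close>)
  then have conv: "AE x in PiM I M. summable (\<lambda>n. \<bar>d n x\<bar>)"
    by eventually_elim (auto intro: summable_suminf_not_top)
  \<comment> \<open>Where the partial products diverge, \<open>lim\<close> is unspecified. The
    \<open>max\<close> keeps the density nonnegative there and changes nothing at points of
    convergence.\<close>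
  define f where "f x = max 0 (lim (\<lambda>n. pr (J n) x))" for x
  have f_meas [measurable]: "f \<in> borel_measurable (PiM I M)"
    unfolding f_def by measurable
  have pr_eq: "pr (J n) x = pr (J 0) x + (\<Sum>k<n. d k x)" for n x
    using sum_lessThan_telescope[of "\<lambda>k. pr (J k) x" n] by (simp add: d_def)
  have lim: "AE x in PiM I M. (\<lambda>n. pr (J n) x) \<longlonglongrightarrow> f x"
    using conv
  proof eventually_elim
    case (elim x)
    have pr_eq': "(\<lambda>n. pr (J n) x) = (\<lambda>n. pr (J 0) x + (\<Sum>k<n. d k x))"
      by (rule ext) (rule pr_eq)
    have "summable (\<lambda>n. d n x)" using summable_rabs_cancel[OF elim] .
    then have "convergent (\<lambda>n. pr (J n) x)"
      unfolding pr_eq' by (intro convergent_add convergent_const) (simp add: summable_iff_convergent)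
    then have l: "(\<lambda>n. pr (J n) x) \<longlonglongrightarrow> lim (\<lambda>n. pr (J n) x)" by (simp add: convergent_LIMSEQ_iff)
    have "0 \<le> lim (\<lambda>n. pr (J n) x)"
      by (rule LIMSEQ_le_const[OF l]) (auto intro!: less_imp_le pr_pos J(2))
    with l show ?case by (simp add: f_def max_def)
  qed
  let ?w = "\<lambda>x. ennreal (pr (J 0) x) + (\<Sum>n. ennreal \<bar>d n x\<bar>)"
  have w_int: "(\<integral>\<^sup>+ x. ?w x \<partial>PiM I M) < \<infinity>"
  proof -
    have "(\<integral>\<^sup>+ x. ennreal (pr (J 0) x) \<partial>PiM I M) = 1"
      by (rule nn_integral_pr[OF J(1,2)])
    then show ?thesis using total by (subst nn_integral_add) auto
  qed
  have w_bound: "ennreal (pr (J n) x) \<le> ?w x" for n x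
  proof -
    have "pr (J n) x \<le> pr (J 0) x + (\<Sum>k<n. \<bar>d k x\<bar>)"
      unfolding pr_eq[of n x] by (intro add_left_mono sum_mono) auto
    then have "ennreal (pr (J n) x) \<le> ennreal (pr (J 0) x + (\<Sum>k<n. \<bar>d k x\<bar>))" by (rule ennreal_leI)
    also have "\<dots> = ennreal (pr (J 0) x) + (\<Sum>k<n. ennreal \<bar>d k x\<bar>)"
      using pr_pos[OF J(2)] by (subst ennreal_plus) (auto simp: sum_nonneg less_imp_le sum_ennreal)
    also have "\<dots> \<le> ?w x"
      by (intro add_left_mono sum_le_suminf) auto
    finally show ?thesis .
  qed
  have "PiM I N = density (PiM I M) (\<lambda>x. ennreal (f x))"
  proof (rule measure_eqI_PiM_infinite)
    have sets_N: "sets (N i) = sets (M i)" if "i \<in> I" for i using N[OF that] by simp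
    show "sets (PiM I N) = sets (PiM I M)" by (rule sets_PiM_cong[OF refl sets_N])
    show "sets (density (PiM I M) (\<lambda>x. ennreal (f x))) = sets (PiM I M)" by simp
    have prob_N: "prob_space (N i)" if "i \<in> I" for i
    proof
      show "emeasure (N i) (space (N i)) = 1"
        using r_one[OF that] r_measurable[OF that] by (simp add: N[OF that] emeasure_density)
    qed
    interpret N: prob_space "PiM I N" by (rule prob_space_PiM[OF prob_N])
    show "finite_measure (PiM I N)" by unfold_locales
    fix A K assume K: "finite K" "K \<subseteq> I" and A: "\<And>i. i \<in> K \<Longrightarrow> A i \<in> sets (M i)"
    let ?E = "prod_emb I M K (PiE K A)"
    have E [measurable]: "?E \<in> sets (PiM I M)" using K A by (intro sets_PiM_I) auto
    have emb: "?E = prod_emb I N K (PiE K A)"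
    proof -
      have "space (N i) = space (M i)" if "i \<in> I" for i using N[OF that] by simp
      then show ?thesis by (auto simp: prod_emb_def PiE_iff)
    qed
    have QE: "emeasure (PiM I N) ?E = (\<Prod>i\<in>K. emeasure (N i) (A i))"
      unfolding emb using K A sets_N by (intro emeasure_PiM_emb prob_N) auto
    obtain n0 where n0: "K \<subseteq> J n0"
    proof -
      have "\<forall>i\<in>K. \<exists>n. i \<in> J n" using K(2) J(4) by auto
      then obtain h where h: "\<And>i. i \<in> K \<Longrightarrow> i \<in> J (h i)" by metis
      have "i \<in> J (sum h K)" if "i \<in> K" for i
        using h[OF that] J(3) member_le_sum[OF that, of h] K(1) by (auto simp: incseq_def)
      then show thesis by (intro that) auto
    qed
    have "(\<lambda>n. \<integral>\<^sup>+ x. ennreal (pr (J n) x) * indicator ?E x \<partial>PiM I M)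
        \<longlonglongrightarrow> (\<integral>\<^sup>+ x. ennreal (f x) * indicator ?E x \<partial>PiM I M)"
    proof (rule nn_integral_dominated_convergence[where w = ?w])
      show "(\<integral>\<^sup>+ x. ?w x \<partial>PiM I M) < \<infinity>" by (rule w_int)
      show "AE x in PiM I M. ennreal (pr (J n) x) * indicator ?E x \<le> ?w x" for n
        using w_bound[of n] by (auto simp: indicator_def)
      show "AE x in PiM I M. (\<lambda>n. ennreal (pr (J n) x) * indicator ?E x) \<longlonglongrightarrow> ennreal (f x) * indicator ?E x"
        using lim by eventually_elim (auto simp: indicator_def)
    qed measurable
    moreover have "(\<lambda>n. \<integral>\<^sup>+ x. ennreal (pr (J n) x) * indicator ?E x \<partial>PiM I M)
        \<longlonglongrightarrow> emeasure (PiM I N) ?E"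
    proof (rule tendsto_eventually)
      show "eventually (\<lambda>n. (\<integral>\<^sup>+ x. ennreal (pr (J n) x) * indicator ?E x \<partial>PiM I M) = emeasure (PiM I N) ?E) sequentially"
        using eventually_ge_at_top[of n0]
      proof eventually_elim
        case (elim n)
        then have KJ: "K \<subseteq> J n" using n0 J(3) by (auto simp: incseq_def)
        show ?case unfolding QE by (rule nn_integral_pr_cylinder[OF N J(1) J(2) KJ A])
      qed
    qed
    ultimately have "emeasure (PiM I N) ?E = (\<integral>\<^sup>+ x. ennreal (f x) * indicator ?E x \<partial>PiM I M)"
      by (rule LIMSEQ_unique[rotated])
    then show "emeasure (PiM I N) ?E = emeasure (density (PiM I M) (\<lambda>x. ennreal (f x))) ?E"
      by (simp add: emeasure_density)
  qed
  then show thesis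
    by (intro that[of J f] J(1,2) lim f_meas) (auto simp: f_def)
qed

text \<open>At a zero of \<open>f\<close> the term \<open>f x powr - \<beta>\<close> is \<open>0\<close>, so the bound carries information only
  where \<open>f\<close> is positive.\<close>

lemma nn_integral_powr_limit_le:
  assumes J: "\<And>n. finite (J n)" "\<And>n. J n \<subseteq> I"
    and f: "\<And>x. 0 \<le> f x" "AE x in PiM I M. (\<lambda>n. pr (J n) x) \<longlonglongrightarrow> f x"
    and b: "\<And>i. i \<in> I \<Longrightarrow> (\<integral>\<^sup>+ y. ennreal (r i y powr - \<beta>) \<partial>M i) \<le> ennreal (exp (b i))"
    and b_sum: "b summable_on I" and b_nonneg: "\<And>i. i \<in> I \<Longrightarrow> 0 \<le> b i"
  shows "(\<integral>\<^sup>+ x. ennreal (f x powr - \<beta>) \<partial>PiM I M) \<le> ennreal (exp (infsum b I))"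
proof -
  note [measurable] = pr_measurable[OF J(2)]
  have "(\<integral>\<^sup>+ x. ennreal (f x powr - \<beta>) \<partial>PiM I M)
      \<le> (\<integral>\<^sup>+ x. liminf (\<lambda>n. ennreal (pr (J n) x powr - \<beta>)) \<partial>PiM I M)"
  proof (rule nn_integral_mono_AE)
    show "AE x in PiM I M. ennreal (f x powr - \<beta>) \<le> liminf (\<lambda>n. ennreal (pr (J n) x powr - \<beta>))"
      using f(2)
    proof eventually_elim
      case (elim x)
      show ?case
      proof (cases "f x = 0")
        case False
        then have "(\<lambda>n. ennreal (pr (J n) x powr - \<beta>)) \<longlonglongrightarrow> ennreal (f x powr - \<beta>)"
          by (intro tendsto_ennrealI tendsto_powr elim tendsto_const)
        from lim_imp_Liminf[OF sequentially_bot this] show ?thesis by simp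
      qed simp
    qed
  qed
  also have "\<dots> \<le> liminf (\<lambda>n. \<integral>\<^sup>+ x. ennreal (pr (J n) x powr - \<beta>) \<partial>PiM I M)"
    by (rule nn_integral_liminf) measurable
  also have "\<dots> \<le> ennreal (exp (infsum b I))"
  proof (rule Liminf_le)
    show "\<forall>\<^sub>F n in sequentially. (\<integral>\<^sup>+ x. ennreal (pr (J n) x powr - \<beta>) \<partial>PiM I M) \<le> ennreal (exp (infsum b I))"
    proof (intro always_eventually allI)
      fix n
      have "(\<integral>\<^sup>+ x. ennreal (pr (J n) x powr - \<beta>) \<partial>PiM I M)
          = (\<integral>\<^sup>+ x. (\<Prod>i\<in>J n. ennreal (r i (x i) powr - \<beta>)) \<partial>PiM I M)"
        using J r_pos by (intro nn_integral_cong) (auto simp: pr_def prod_ennreal prod_powr_distrib less_imp_le subset_eq)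
      also have "\<dots> = (\<Prod>i\<in>J n. \<integral>\<^sup>+ y. ennreal (r i y powr - \<beta>) \<partial>M i)"
      proof (rule nn_integral_PiM_prod[OF prob_space_M J])
        fix i assume "i \<in> J n"
        then have [measurable]: "r i \<in> borel_measurable (M i)" using J r_measurable by auto
        show "(\<lambda>y. ennreal (r i y powr - \<beta>)) \<in> borel_measurable (M i)" by measurable
      qed
      also have "\<dots> \<le> (\<Prod>i\<in>J n. ennreal (exp (b i)))"
        using J b by (intro prod_mono_ennreal) auto
      also have "\<dots> = ennreal (exp (sum b (J n)))"
        using J by (simp add: prod_ennreal exp_sum)
      also have "\<dots> \<le> ennreal (exp (infsum b I))"
        using b_sum b_nonneg J by (intro ennreal_leI) (auto intro!: finite_sum_le_infsum)
      finally show "(\<integral>\<^sup>+ x. ennreal (pr (J n) x powr - \<beta>) \<partial>PiM I M) \<le> ennreal (exp (infsum b I))" .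
    qed
  qed simp
  finally show ?thesis .
qed

end

section \<open>Nonsingular actions and the Maharam extension\<close>

lemma translated_measure_eq_density:
  assumes "\<And>U. U \<in> sets M \<Longrightarrow> emeasure M (\<phi> g ` U) = (\<integral>\<^sup>+ x. f x * indicator U x \<partial>M)"
  shows "translated_measure M \<phi> g = density M f"
  unfolding translated_measure_def density_def
proof (rule measure_of_eq[OF sets.space_closed])
  show "emeasure M (\<phi> g ` U) = (\<integral>\<^sup>+ x. f x * indicator U x \<partial>M)" if "U \<in> sigma_sets (space M) (sets M)" for U
    by (rule assms) (use that in \<open>simp add: sets.sigma_sets_eq\<close>)
qed

lemma translated_measure_eq_distr:
  assumes \<psi>: "\<psi> \<in> measurable M M"
    and inv: "\<And>x. x \<in> space M \<Longrightarrow> \<phi> g x \<in> space M \<and> \<psi> (\<phi> g x) = x \<and> \<psi> x \<in> space M \<and> \<phi> g (\<psi> x) = x"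
  shows "translated_measure M \<phi> g = distr M M \<psi>"
  unfolding translated_measure_def distr_def
proof (rule measure_of_eq)
  show "sets M \<subseteq> Pow (space M)" by (rule sets.space_closed)
  fix U assume "U \<in> sigma_sets (space M) (sets M)"
  then have U: "U \<subseteq> space M" by (auto simp: sets.sigma_sets_eq dest: sets.sets_into_space)
  have "\<phi> g ` U = \<psi> -` U \<inter> space M"
  proof safe
    fix y assume "y \<in> space M" "\<psi> y \<in> U"
    then show "y \<in> \<phi> g ` U" using inv[of y] by (metis imageI)
  qed (use U inv in auto)
  then show "emeasure M (\<phi> g ` U) = emeasure M (\<psi> -` U \<inter> space M)" by simp
qed

lemma image_eq_vimage_inv_into:
  assumes "bij_betw f S S" "U \<subseteq> S"
  shows "f ` U = inv_into S f -` U \<inter> S"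
proof (intro equalityI subsetI)
  fix y assume "y \<in> f ` U"
  then obtain x where x: "x \<in> U" "y = f x" by auto
  then have "x \<in> S" using assms(2) by auto
  with x assms(1) show "y \<in> inv_into S f -` U \<inter> S"
    by (auto simp: bij_betw_inv_into_left bij_betw_def)
next
  fix y assume "y \<in> inv_into S f -` U \<inter> S"
  then show "y \<in> f ` U"
    using bij_betw_inv_into_right[OF assms(1), of y] by (auto intro!: image_eqI[of _ f "inv_into S f y"])
qed

text \<open>Transfers almost-everywhere facts about the base action to the Maharam
  extension.\<close>

lemma AE_pair_fst:
  assumes "AE x in M. P x" and "sigma_finite_measure M" and "sigma_finite_measure N"
  shows "AE z in M \<Otimes>\<^sub>M N. P (fst z)"
proof -
  interpret N: sigma_finite_measure N by fact
  obtain A where A: "A \<in> null_sets M" "{x \<in> space M. \<not> P x} \<subseteq> A"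
    using assms(1) by (auto simp: eventually_ae_filter)
  have "A \<times> space N \<in> null_sets (M \<Otimes>\<^sub>M N)"
    using A(1) by (auto simp: null_sets_def N.emeasure_pair_measure_Times)
  then show ?thesis
    by (rule AE_I') (use A(2) in \<open>auto simp: space_pair_measure\<close>)
qed

lemma standard_prob_spaceD: "standard_prob_space M \<Longrightarrow> prob_space M"
  by (simp add: standard_prob_space_def)

lemma nonsingular_actionD:
  assumes "nonsingular_action G M \<phi>"
  shows "prob_space M"
    and "g \<in> carrier G \<Longrightarrow> \<phi> g \<in> measurable M M"
    and "g \<in> carrier G \<Longrightarrow> bij_betw (\<phi> g) (space M) (space M)"
    and "g \<in> carrier G \<Longrightarrow> U \<in> sets M \<Longrightarrow> \<phi> g ` U \<in> sets M"
    and "g \<in> carrier G \<Longrightarrow> U \<in> sets M \<Longrightarrow> emeasure M (\<phi> g ` U) = 0 \<longleftrightarrow> emeasure M U = 0"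
    and "g \<in> carrier G \<Longrightarrow> x \<in> space M \<Longrightarrow> \<phi> g x \<in> space M"
    and "g \<in> carrier G \<Longrightarrow> inj_on (\<phi> g) (space M)"
    and "g \<in> carrier G \<Longrightarrow> inv_into (space M) (\<phi> g) \<in> measurable M M"
proof -
  show *: "prob_space M"
    "g \<in> carrier G \<Longrightarrow> \<phi> g \<in> measurable M M"
    "g \<in> carrier G \<Longrightarrow> bij_betw (\<phi> g) (space M) (space M)"
    "g \<in> carrier G \<Longrightarrow> U \<in> sets M \<Longrightarrow> \<phi> g ` U \<in> sets M"
    "g \<in> carrier G \<Longrightarrow> U \<in> sets M \<Longrightarrow> emeasure M (\<phi> g ` U) = 0 \<longleftrightarrow> emeasure M U = 0"
    "g \<in> carrier G \<Longrightarrow> x \<in> space M \<Longrightarrow> \<phi> g x \<in> space M"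
    using assms unfolding nonsingular_action_def
    by (auto simp: standard_prob_spaceD dest: measurable_space)
  show "inj_on (\<phi> g) (space M)" if "g \<in> carrier G"
    using *(3)[OF that] by (simp add: bij_betw_def)
  show "inv_into (space M) (\<phi> g) \<in> measurable M M" if g: "g \<in> carrier G"
  proof (rule measurableI)
    have bij: "bij_betw (\<phi> g) (space M) (space M)"
      using assms g by (auto simp: nonsingular_action_def)
    show "inv_into (space M) (\<phi> g) x \<in> space M" if "x \<in> space M" for x
      using that bij by (metis bij_betw_imp_surj_on inv_into_into)
    have im: "\<phi> g ` A \<in> sets M" if "A \<in> sets M" for A
      using assms g that by (auto simp: nonsingular_action_def)
    show "inv_into (space M) (\<phi> g) -` A \<inter> space M \<in> sets M" if "A \<in> sets M" for A
      using im[OF that] image_eq_vimage_inv_into[OF bij sets.sets_into_space[OF that]] by simp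
  qed
qed

lemma nonsingular_action_translated:
  assumes ns: "nonsingular_action G M \<phi>" and g: "g \<in> carrier G"
  shows "translated_measure M \<phi> g = distr M M (inv_into (space M) (\<phi> g))"
    and "U \<in> sets M \<Longrightarrow> emeasure (translated_measure M \<phi> g) U = emeasure M (\<phi> g ` U)"
    and "density M (translation_deriv M \<phi> g) = translated_measure M \<phi> g"
    and "AE x in M. translation_deriv M \<phi> g x \<noteq> \<infinity>"
    and "AE x in M. translation_deriv M \<phi> g x \<noteq> 0"
proof -
  note D = nonsingular_actionD[OF ns]
  interpret prob_space M by (rule D)
  let ?\<psi> = "inv_into (space M) (\<phi> g)"
  have inv: "\<phi> g x \<in> space M \<and> ?\<psi> (\<phi> g x) = x \<and> ?\<psi> x \<in> space M \<and> \<phi> g (?\<psi> x) = x"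
    if "x \<in> space M" for x
    using that D(3)[OF g] D(6)[OF g that] measurable_space[OF D(8)[OF g] that]
    by (auto simp: bij_betw_inv_into_left bij_betw_inv_into_right)
  show eq: "translated_measure M \<phi> g = distr M M ?\<psi>"
    by (rule translated_measure_eq_distr[OF D(8)[OF g]]) (use inv in auto)
  have em: "emeasure (translated_measure M \<phi> g) U = emeasure M (\<phi> g ` U)" if "U \<in> sets M" for U
    unfolding eq using that D(8)[OF g]
    by (simp add: emeasure_distr image_eq_vimage_inv_into[OF D(3)[OF g] sets.sets_into_space[OF that]])
  then show "U \<in> sets M \<Longrightarrow> emeasure (translated_measure M \<phi> g) U = emeasure M (\<phi> g ` U)" .
  interpret T: prob_space "translated_measure M \<phi> g"
    unfolding eq by (rule prob_space_distr[OF D(8)[OF g]])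
  have sets: "sets (translated_measure M \<phi> g) = sets M" by (simp add: eq)
  have ac: "absolutely_continuous M (translated_measure M \<phi> g)"
    unfolding absolutely_continuous_def
    using em D(5)[OF g] by (auto simp: null_sets_def sets)
  show dens: "density M (translation_deriv M \<phi> g) = translated_measure M \<phi> g"
    unfolding translation_deriv_def by (rule density_RN_deriv[OF ac sets])
  show "AE x in M. translation_deriv M \<phi> g x \<noteq> \<infinity>"
    unfolding translation_deriv_def by (rule RN_deriv_finite[OF _ ac sets]) unfold_locales
  have [measurable]: "translation_deriv M \<phi> g \<in> borel_measurable M"
    by (simp add: translation_deriv_def)
  \<comment> \<open>The zero set of the derivative has an image of measure zero, hence is itself
    null by nonsingularity. Existence of the derivative uses the other direction.\<close>
  let ?Z = "{x \<in> space M. translation_deriv M \<phi> g x = 0}"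
  have Z: "?Z \<in> sets M" by measurable
  have "emeasure M (\<phi> g ` ?Z) = emeasure (density M (translation_deriv M \<phi> g)) ?Z"
    by (simp add: dens em[OF Z])
  also have "\<dots> = (\<integral>\<^sup>+ x. translation_deriv M \<phi> g x * indicator ?Z x \<partial>M)"
    by (rule emeasure_density[OF _ Z]) measurable
  also have "\<dots> = (\<integral>\<^sup>+ x. 0 \<partial>M)"
    by (rule nn_integral_cong) (auto simp: indicator_def)
  finally have "emeasure M ?Z = 0"
    using D(5)[OF g Z] by simp
  then show "AE x in M. translation_deriv M \<phi> g x \<noteq> 0"
    using Z by (subst AE_iff_measurable[OF Z]) auto
qed

section \<open>Change of variables and the cocycle identity\<close>

lemma borel_measurable_translation_deriv [measurable]:
  "translation_deriv M \<phi> g \<in> borel_measurable M"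
  by (simp add: translation_deriv_def)

lemma translation_deriv_change_of_variables:
  assumes ns: "nonsingular_action G M \<phi>" and g: "g \<in> carrier G"
    and F [measurable]: "F \<in> borel_measurable M"
  shows "(\<integral>\<^sup>+ x. F x \<partial>M) = (\<integral>\<^sup>+ x. translation_deriv M \<phi> g x * F (\<phi> g x) \<partial>M)"
proof -
  note D = nonsingular_actionD[OF ns]
  note T = nonsingular_action_translated[OF ns g]
  note [measurable] = D(2)[OF g] D(8)[OF g]
  have "(\<integral>\<^sup>+ x. translation_deriv M \<phi> g x * F (\<phi> g x) \<partial>M)
      = (\<integral>\<^sup>+ x. F (\<phi> g x) \<partial>density M (translation_deriv M \<phi> g))"
    by (rule nn_integral_density[symmetric]) auto
  also have "\<dots> = (\<integral>\<^sup>+ x. F (\<phi> g (inv_into (space M) (\<phi> g) x)) \<partial>M)"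
    unfolding T(1,3) by (rule nn_integral_distr) auto
  also have "\<dots> = (\<integral>\<^sup>+ x. F x \<partial>M)"
    by (rule nn_integral_cong) (use D(3)[OF g] in \<open>auto simp: bij_betw_inv_into_right\<close>)
  finally show ?thesis by simp
qed

text \<open>The tool by which every concrete derivative below is computed: it suffices to represent
  the measures of images by an integral.\<close>

lemma translation_deriv_unique:
  assumes "prob_space M" and [measurable]: "f \<in> borel_measurable M"
    and "\<And>U. U \<in> sets M \<Longrightarrow> emeasure M (\<phi> g ` U) = (\<integral>\<^sup>+ x. f x * indicator U x \<partial>M)"
  shows "AE x in M. translation_deriv M \<phi> g x = f x"
proof -
  interpret prob_space M by fact
  have "translated_measure M \<phi> g = density M f"
    by (rule translated_measure_eq_density) (rule assms(3))
  then have "AE x in M. f x = RN_deriv M (translated_measure M \<phi> g) x"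
    by (intro RN_deriv_unique assms(2)) (rule sym)
  then show ?thesis by (simp add: translation_deriv_def eq_commute)
qed

text \<open>Maps that agree off a null set \<open>N\<close> have images of \<open>U\<close> that
  agree off the images of \<open>N\<close>, so both maps must carry null sets to null sets. The
  lemma is needed because the action laws hold only almost everywhere, while derivatives are defined
  through images.\<close>

lemma emeasure_image_AE_cong:
  assumes ns: "nonsingular_action G M \<phi>" and g: "g \<in> carrier G"
    and eq: "AE x in M. \<phi> g x = \<theta> x"
    and \<theta>: "\<And>U. U \<in> sets M \<Longrightarrow> \<theta> ` U \<in> sets M"
    and null: "\<And>U. U \<in> sets M \<Longrightarrow> emeasure M U = 0 \<Longrightarrow> emeasure M (\<theta> ` U) = 0"
    and U: "U \<in> sets M"
  shows "emeasure M (\<phi> g ` U) = emeasure M (\<theta> ` U)"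
proof (rule emeasure_eq_AE)
  note D = nonsingular_actionD[OF ns]
  obtain N where N: "N \<in> null_sets M" "{x \<in> space M. \<phi> g x \<noteq> \<theta> x} \<subseteq> N"
    using eq by (auto simp: eventually_ae_filter)
  have "\<phi> g ` N \<in> null_sets M" "\<theta> ` N \<in> null_sets M"
    using N(1) D(4,5)[OF g] \<theta> null by (auto simp: null_sets_def)
  then have "AE y in M. y \<notin> \<phi> g ` N" "AE y in M. y \<notin> \<theta> ` N"
    by (auto intro: AE_not_in)
  then show "AE y in M. y \<in> \<phi> g ` U \<longleftrightarrow> y \<in> \<theta> ` U"
  proof eventually_elim
    case (elim y)
    have eq: "\<phi> g u = \<theta> u" if "u \<in> U" "y = \<phi> g u \<or> y = \<theta> u" for u
    proof -
      have "u \<notin> N" using that(2) elim by auto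
      then show ?thesis using that(1) N(2) sets.sets_into_space[OF U] by auto
    qed
    show ?case
    proof
      assume "y \<in> \<phi> g ` U"
      then obtain u where u: "u \<in> U" "y = \<phi> g u" by auto
      with eq[OF u(1)] show "y \<in> \<theta> ` U" by simp
    next
      assume "y \<in> \<theta> ` U"
      then obtain u where u: "u \<in> U" "y = \<theta> u" by auto
      with eq[OF u(1)] show "y \<in> \<phi> g ` U" by (intro image_eqI[of _ _ u]) simp_all
    qed
  qed
  show "\<phi> g ` U \<in> sets M" by (rule D(4)[OF g U])
  show "\<theta> ` U \<in> sets M" by (rule \<theta>[OF U])
qed

lemma translation_deriv_cocycle:
  assumes ns: "nonsingular_action G M \<phi>" and "group G"
    and g: "g \<in> carrier G" and h: "h \<in> carrier G"
  shows "AE x in M. translation_deriv M \<phi> (g \<otimes>\<^bsub>G\<^esub> h) x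
           = translation_deriv M \<phi> g (\<phi> h x) * translation_deriv M \<phi> h x"
proof (rule translation_deriv_unique)
  note D = nonsingular_actionD[OF ns]
  interpret group G by fact
  note [measurable] = D(2)[OF g] D(2)[OF h]
  show "prob_space M" by (rule D)
  show "(\<lambda>x. translation_deriv M \<phi> g (\<phi> h x) * translation_deriv M \<phi> h x) \<in> borel_measurable M"
    by measurable
  fix U assume U: "U \<in> sets M"
  have V [measurable]: "\<phi> h ` U \<in> sets M" by (rule D(4)[OF h U])
  have "emeasure M (\<phi> (g \<otimes>\<^bsub>G\<^esub> h) ` U) = emeasure M ((\<lambda>x. \<phi> g (\<phi> h x)) ` U)"
  proof (rule emeasure_image_AE_cong[OF ns _ _ _ _ U])
    show "AE x in M. \<phi> (g \<otimes>\<^bsub>G\<^esub> h) x = \<phi> g (\<phi> h x)"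
      using ns g h by (auto simp: nonsingular_action_def)
    show "(\<lambda>x. \<phi> g (\<phi> h x)) ` U \<in> sets M" if "U \<in> sets M" for U
      using D(4)[OF g D(4)[OF h that]] by (simp add: image_image)
    show "emeasure M ((\<lambda>x. \<phi> g (\<phi> h x)) ` U) = 0" if "U \<in> sets M" "emeasure M U = 0" for U
      using D(5)[OF g D(4)[OF h that(1)]] D(5)[OF h that(1)] that by (simp add: image_image)
  qed (use g h in auto)
  also have "\<dots> = emeasure (translated_measure M \<phi> g) (\<phi> h ` U)"
    by (simp add: nonsingular_action_translated(2)[OF ns g V] image_image)
  also have "\<dots> = (\<integral>\<^sup>+ x. translation_deriv M \<phi> g x * indicator (\<phi> h ` U) x \<partial>M)"
    unfolding nonsingular_action_translated(3)[OF ns g, symmetric]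
    by (rule emeasure_density[OF _ V]) measurable
  also have "\<dots> = (\<integral>\<^sup>+ x. translation_deriv M \<phi> h x *
      (translation_deriv M \<phi> g (\<phi> h x) * indicator (\<phi> h ` U) (\<phi> h x)) \<partial>M)"
    by (rule translation_deriv_change_of_variables[OF ns h]) measurable
  also have "\<dots> = (\<integral>\<^sup>+ x. translation_deriv M \<phi> g (\<phi> h x) * translation_deriv M \<phi> h x * indicator U x \<partial>M)"
  proof (rule nn_integral_cong)
    fix x assume x: "x \<in> space M"
    have "\<phi> h x \<in> \<phi> h ` U \<longleftrightarrow> x \<in> U"
      using inj_on_image_mem_iff[OF D(7)[OF h] x] sets.sets_into_space[OF U] by auto
    then show "translation_deriv M \<phi> h x *
      (translation_deriv M \<phi> g (\<phi> h x) * indicator (\<phi> h ` U) (\<phi> h x))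
      = translation_deriv M \<phi> g (\<phi> h x) * translation_deriv M \<phi> h x * indicator U x"
      by (auto simp: indicator_def mult_ac)
  qed
  finally show "emeasure M (\<phi> (g \<otimes>\<^bsub>G\<^esub> h) ` U) =
      (\<integral>\<^sup>+ x. translation_deriv M \<phi> g (\<phi> h x) * translation_deriv M \<phi> h x * indicator U x \<partial>M)" .
qed

lemma translation_deriv_one:
  assumes ns: "nonsingular_action G M \<phi>" and "group G"
  shows "AE x in M. translation_deriv M \<phi> \<one>\<^bsub>G\<^esub> x = 1"
proof (rule translation_deriv_unique)
  note D = nonsingular_actionD[OF ns]
  interpret group G by fact
  show "prob_space M" by (rule D)
  fix U assume U: "U \<in> sets M"
  have "emeasure M (\<phi> \<one>\<^bsub>G\<^esub> ` U) = emeasure M ((\<lambda>x. x) ` U)"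
    by (rule emeasure_image_AE_cong[OF ns]) (use ns U in \<open>auto simp: nonsingular_action_def\<close>)
  then show "emeasure M (\<phi> \<one>\<^bsub>G\<^esub> ` U) = (\<integral>\<^sup>+ x. 1 * indicator U x \<partial>M)"
    using U by simp
qed auto

section \<open>The Maharam extension over the two-sided exponential measure\<close>

lemma prob_space_two_sided_exp:
  assumes "0 < \<alpha>"
  shows "prob_space (two_sided_exp \<alpha>)"
proof
  let ?e = "\<lambda>x. ennreal (exponential_density \<alpha> x)"
  have one: "(\<integral>\<^sup>+ x. ?e x \<partial>lborel) = 1"
    using prob_space.emeasure_space_1[OF prob_space_exponential_density[OF assms]]
    by (simp add: emeasure_density)
  have "emeasure (two_sided_exp \<alpha>) (space (two_sided_exp \<alpha>))
      = (\<integral>\<^sup>+ t. ennreal (\<alpha> / 2 * exp (- \<alpha> * \<bar>t\<bar>)) \<partial>lborel)"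
    by (simp add: two_sided_exp_def emeasure_density)
  also have "\<dots> = (\<integral>\<^sup>+ t. ennreal (1/2) * (?e t + ?e (- t)) \<partial>lborel)"
  proof (rule nn_integral_cong_AE)
    \<comment> \<open>The density is the average of the exponential density and its reflection. At
      \<open>t = 0\<close> both contribute fully, so the identity holds only off that point.\<close>
    have "AE t in lborel. t \<noteq> (0::real)" by (rule AE_lborel_singleton)
    then show "AE t in lborel. ennreal (\<alpha> / 2 * exp (- \<alpha> * \<bar>t\<bar>)) = ennreal (1/2) * (?e t + ?e (- t))"
    proof eventually_elim
      case (elim t)
      then show ?case
        using assms by (auto simp: exponential_density_def ennreal_mult[symmetric] mult_ac abs_if simp del: ennreal_half)
    qed
  qed
  also have "\<dots> = ennreal (1/2) * ((\<integral>\<^sup>+ t. ?e t \<partial>lborel) + (\<integral>\<^sup>+ t. ?e (- t) \<partial>lborel))"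
    by (subst nn_integral_cmult) (auto intro!: arg_cong2[where f = "(*)"] nn_integral_add)
  also have "(\<integral>\<^sup>+ t. ?e (- t) \<partial>lborel) = (\<integral>\<^sup>+ t. ?e t \<partial>lborel)"
    using nn_integral_real_affine[of ?e "-1" 0] by simp
  also have "ennreal (1/2) * ((\<integral>\<^sup>+ t. ?e t \<partial>lborel) + (\<integral>\<^sup>+ t. ?e t \<partial>lborel)) = 1"
    unfolding one
    by (simp only: ennreal_1[symmetric] ennreal_plus[symmetric] ennreal_mult[symmetric] zero_le_one) simp
  finally show "emeasure (two_sided_exp \<alpha>) (space (two_sided_exp \<alpha>)) = 1" .
qed

lemma sets_two_sided_exp [simp, measurable_cong]: "sets (two_sided_exp \<alpha>) = sets borel"
  by (simp add: two_sided_exp_def)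

lemma space_two_sided_exp [simp]: "space (two_sided_exp \<alpha>) = UNIV"
  by (simp add: two_sided_exp_def)

text \<open>Lebesgue measure is translation invariant, so the weight is the quotient of the two
  densities. It lies between \<open>exp (- \<alpha> * \<bar>c\<bar>)\<close> and
  \<open>exp (\<alpha> * \<bar>c\<bar>)\<close>, which is why a small \<open>\<alpha>\<close> costs
  little.\<close>

lemma nn_integral_two_sided_exp_shift:
  assumes "0 < \<alpha>" and [measurable]: "F \<in> borel_measurable borel"
  shows "(\<integral>\<^sup>+ s. F s \<partial>two_sided_exp \<alpha>)
       = (\<integral>\<^sup>+ t. ennreal (exp (\<alpha> * \<bar>t\<bar> - \<alpha> * \<bar>t + c\<bar>)) * F (t + c) \<partial>two_sided_exp \<alpha>)"
proof -
  have "(\<integral>\<^sup>+ s. F s \<partial>two_sided_exp \<alpha>) = (\<integral>\<^sup>+ s. ennreal (\<alpha> / 2 * exp (- \<alpha> * \<bar>s\<bar>)) * F s \<partial>lborel)"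
    unfolding two_sided_exp_def by (rule nn_integral_density) auto
  also have "\<dots> = (\<integral>\<^sup>+ t. ennreal (\<alpha> / 2 * exp (- \<alpha> * \<bar>t + c\<bar>)) * F (t + c) \<partial>lborel)"
    using nn_integral_real_affine[of "\<lambda>s. ennreal (\<alpha> / 2 * exp (- \<alpha> * \<bar>s\<bar>)) * F s" 1 c]
    by (simp add: add.commute)
  also have "\<dots> = (\<integral>\<^sup>+ t. ennreal (\<alpha> / 2 * exp (- \<alpha> * \<bar>t\<bar>)) *
      (ennreal (exp (\<alpha> * \<bar>t\<bar> - \<alpha> * \<bar>t + c\<bar>)) * F (t + c)) \<partial>lborel)"
  proof (rule nn_integral_cong)
    fix t :: real
    have "\<alpha> / 2 * exp (- \<alpha> * \<bar>t + c\<bar>) = \<alpha> / 2 * exp (- \<alpha> * \<bar>t\<bar>) * exp (\<alpha> * \<bar>t\<bar> - \<alpha> * \<bar>t + c\<bar>)"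
      by (simp add: exp_add[symmetric])
    then show "ennreal (\<alpha> / 2 * exp (- \<alpha> * \<bar>t + c\<bar>)) * F (t + c) = ennreal (\<alpha> / 2 * exp (- \<alpha> * \<bar>t\<bar>)) *
      (ennreal (exp (\<alpha> * \<bar>t\<bar> - \<alpha> * \<bar>t + c\<bar>)) * F (t + c))"
      using assms(1) by (subst mult.assoc[symmetric], subst ennreal_mult[symmetric]) (auto simp: mult.assoc)
  qed
  also have "\<dots> = (\<integral>\<^sup>+ t. ennreal (exp (\<alpha> * \<bar>t\<bar> - \<alpha> * \<bar>t + c\<bar>)) * F (t + c) \<partial>two_sided_exp \<alpha>)"
    unfolding two_sided_exp_def by (rule nn_integral_density[symmetric]) auto
  finally show ?thesis .
qed

context
  fixes G :: "('g, 'b) monoid_scheme" and M :: "'x measure" and \<phi> :: "'g \<Rightarrow> 'x \<Rightarrow> 'x" and \<alpha> :: real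
  assumes ns: "nonsingular_action G M \<phi>" and \<alpha>: "0 < \<alpha>"
begin

interpretation M: prob_space M by (rule nonsingular_actionD[OF ns])
interpretation \<nu>: prob_space "two_sided_exp \<alpha>" by (rule prob_space_two_sided_exp[OF \<alpha>])
interpretation P: pair_prob_space M "two_sided_exp \<alpha>" ..

lemma measurable_maharam_map:
  assumes g: "g \<in> carrier G"
  shows "maharam_map M \<phi> g \<in> measurable (M \<Otimes>\<^sub>M two_sided_exp \<alpha>) (M \<Otimes>\<^sub>M two_sided_exp \<alpha>)"
proof -
  note [measurable] = nonsingular_actionD(2)[OF ns g]
  show ?thesis unfolding maharam_map_def by measurable
qed

text \<open>Bijectivity is required at every point, but the action laws hold only almost everywhere.
  The inverse is therefore built from \<open>inv_into\<close> and not from the map of the inverse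
  group element.\<close>

lemma bij_maharam_map:
  assumes g: "g \<in> carrier G"
  shows "bij_betw (maharam_map M \<phi> g) (space (M \<Otimes>\<^sub>M two_sided_exp \<alpha>)) (space (M \<Otimes>\<^sub>M two_sided_exp \<alpha>))"
proof (rule bij_betw_byWitness[where f' = "\<lambda>(y, s). (inv_into (space M) (\<phi> g) y,
      s - ln (enn2real (translation_deriv M \<phi> g (inv_into (space M) (\<phi> g) y))))"])
  note D = nonsingular_actionD[OF ns]
  have inv: "inv_into (space M) (\<phi> g) (\<phi> g x) = x" "\<phi> g (inv_into (space M) (\<phi> g) x) = x"
      "inv_into (space M) (\<phi> g) x \<in> space M" if "x \<in> space M" for x
    using D(3)[OF g] that measurable_space[OF D(8)[OF g] that]
    by (auto simp: bij_betw_inv_into_left bij_betw_inv_into_right)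
  show "\<forall>a\<in>space (M \<Otimes>\<^sub>M two_sided_exp \<alpha>).
      (case maharam_map M \<phi> g a of (y, s) \<Rightarrow> (inv_into (space M) (\<phi> g) y,
        s - ln (enn2real (translation_deriv M \<phi> g (inv_into (space M) (\<phi> g) y))))) = a"
    by (auto simp: maharam_map_def space_pair_measure inv)
  show "\<forall>a\<in>space (M \<Otimes>\<^sub>M two_sided_exp \<alpha>).
      maharam_map M \<phi> g (case a of (y, s) \<Rightarrow> (inv_into (space M) (\<phi> g) y,
        s - ln (enn2real (translation_deriv M \<phi> g (inv_into (space M) (\<phi> g) y))))) = a"
    by (auto simp: maharam_map_def space_pair_measure inv)
  show "maharam_map M \<phi> g ` space (M \<Otimes>\<^sub>M two_sided_exp \<alpha>) \<subseteq> space (M \<Otimes>\<^sub>M two_sided_exp \<alpha>)"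
    using D(6)[OF g] by (auto simp: maharam_map_def space_pair_measure)
  show "(\<lambda>(y, s). (inv_into (space M) (\<phi> g) y,
      s - ln (enn2real (translation_deriv M \<phi> g (inv_into (space M) (\<phi> g) y))))) `
      space (M \<Otimes>\<^sub>M two_sided_exp \<alpha>) \<subseteq> space (M \<Otimes>\<^sub>M two_sided_exp \<alpha>)"
    by (auto simp: space_pair_measure inv)
qed

lemma maharam_map_image:
  assumes g: "g \<in> carrier G" and U: "U \<in> sets (M \<Otimes>\<^sub>M two_sided_exp \<alpha>)"
  shows "maharam_map M \<phi> g ` U \<in> sets (M \<Otimes>\<^sub>M two_sided_exp \<alpha>)"
proof -
  note D = nonsingular_actionD[OF ns]
  note [measurable] = D(8)[OF g]
  define \<psi> where "\<psi> = (\<lambda>(y, s). (inv_into (space M) (\<phi> g) y,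
      s - ln (enn2real (translation_deriv M \<phi> g (inv_into (space M) (\<phi> g) y)))))"
  have \<psi>: "\<psi> \<in> measurable (M \<Otimes>\<^sub>M two_sided_exp \<alpha>) (M \<Otimes>\<^sub>M two_sided_exp \<alpha>)"
    unfolding \<psi>_def by measurable
  have inv: "maharam_map M \<phi> g (\<psi> z) = z" "\<psi> (maharam_map M \<phi> g z) = z"
      "maharam_map M \<phi> g z \<in> space (M \<Otimes>\<^sub>M two_sided_exp \<alpha>)"
    if "z \<in> space (M \<Otimes>\<^sub>M two_sided_exp \<alpha>)" for z
    using that D(3,6)[OF g]
    by (auto simp: maharam_map_def \<psi>_def space_pair_measure bij_betw_inv_into_left bij_betw_inv_into_right)
  have "maharam_map M \<phi> g ` U = \<psi> -` U \<inter> space (M \<Otimes>\<^sub>M two_sided_exp \<alpha>)"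
  proof (intro equalityI subsetI)
    fix z assume "z \<in> maharam_map M \<phi> g ` U"
    then show "z \<in> \<psi> -` U \<inter> space (M \<Otimes>\<^sub>M two_sided_exp \<alpha>)"
      using inv sets.sets_into_space[OF U] by auto
  next
    fix z assume "z \<in> \<psi> -` U \<inter> space (M \<Otimes>\<^sub>M two_sided_exp \<alpha>)"
    then show "z \<in> maharam_map M \<phi> g ` U"
      using inv(1)[of z] by (auto intro!: image_eqI[of _ _ "\<psi> z"])
  qed
  then show ?thesis using measurable_sets[OF \<psi> U] by simp
qed

text \<open>Tonelli leaves two substitutions: the one by \<open>\<phi> g\<close> in the base
  contributes the derivative of the base action, and for fixed \<open>x\<close> the translation by
  its logarithm contributes the exponential. The integrand without the indicator is thus the
  derivative of the extension.\<close>

lemma emeasure_maharam_map_image: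
  assumes g: "g \<in> carrier G" and U: "U \<in> sets (M \<Otimes>\<^sub>M two_sided_exp \<alpha>)"
  shows "emeasure (M \<Otimes>\<^sub>M two_sided_exp \<alpha>) (maharam_map M \<phi> g ` U)
    = (\<integral>\<^sup>+ z. (case z of (x, t) \<Rightarrow> translation_deriv M \<phi> g x *
         ennreal (exp (\<alpha> * \<bar>t\<bar> - \<alpha> * \<bar>t + ln (enn2real (translation_deriv M \<phi> g x))\<bar>))) *
         indicator U z \<partial>(M \<Otimes>\<^sub>M two_sided_exp \<alpha>))"
proof -
  let ?\<nu> = "two_sided_exp \<alpha>" and ?D = "translation_deriv M \<phi> g"
  let ?L = "\<lambda>x. ln (enn2real (?D x))"
  let ?V = "maharam_map M \<phi> g ` U"
  note D = nonsingular_actionD[OF ns]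
  note [measurable] = D(2)[OF g] U maharam_map_image[OF g U]
  have ind: "indicator ?V (\<phi> g x, t + ?L x) = (indicator U (x, t) :: ennreal)" if "x \<in> space M" for x t
  proof -
    have "maharam_map M \<phi> g (x, t) \<in> ?V \<longleftrightarrow> (x, t) \<in> U"
      by (rule inj_on_image_mem_iff[OF bij_betw_imp_inj_on[OF bij_maharam_map[OF g]]])
         (use that sets.sets_into_space[OF U] in \<open>auto simp: space_pair_measure\<close>)
    then show ?thesis by (simp add: maharam_map_def indicator_def)
  qed
  have "emeasure (M \<Otimes>\<^sub>M ?\<nu>) ?V = (\<integral>\<^sup>+ z. indicator ?V z \<partial>(M \<Otimes>\<^sub>M ?\<nu>))"
    by (rule nn_integral_indicator[symmetric]) measurable
  also have "\<dots> = (\<integral>\<^sup>+ x. \<integral>\<^sup>+ s. indicator ?V (x, s) \<partial>?\<nu> \<partial>M)"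
    by (subst \<nu>.nn_integral_fst[symmetric]) auto
  also have "\<dots> = (\<integral>\<^sup>+ x. ?D x * (\<integral>\<^sup>+ s. indicator ?V (\<phi> g x, s) \<partial>?\<nu>) \<partial>M)"
    by (rule translation_deriv_change_of_variables[OF ns g]) measurable
  also have "\<dots> = (\<integral>\<^sup>+ x. ?D x * (\<integral>\<^sup>+ t. ennreal (exp (\<alpha> * \<bar>t\<bar> - \<alpha> * \<bar>t + ?L x\<bar>)) * indicator U (x, t) \<partial>?\<nu>) \<partial>M)"
  proof (rule nn_integral_cong)
    fix x assume x: "x \<in> space M"
    then have [measurable]: "\<phi> g x \<in> space M" by (rule D(6)[OF g])
    have "(\<lambda>s. indicator ?V (\<phi> g x, s) :: ennreal) \<in> borel_measurable ?\<nu>" by measurable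
    then have "(\<lambda>s. indicator ?V (\<phi> g x, s) :: ennreal) \<in> borel_measurable borel" by simp
    from nn_integral_two_sided_exp_shift[OF \<alpha> this, of "?L x"]
    show "?D x * (\<integral>\<^sup>+ s. indicator ?V (\<phi> g x, s) \<partial>?\<nu>)
        = ?D x * (\<integral>\<^sup>+ t. ennreal (exp (\<alpha> * \<bar>t\<bar> - \<alpha> * \<bar>t + ?L x\<bar>)) * indicator U (x, t) \<partial>?\<nu>)"
      by (simp add: ind[OF x])
  qed
  also have "\<dots> = (\<integral>\<^sup>+ x. (\<integral>\<^sup>+ t. ?D x * ennreal (exp (\<alpha> * \<bar>t\<bar> - \<alpha> * \<bar>t + ?L x\<bar>)) * indicator U (x, t) \<partial>?\<nu>) \<partial>M)"
  proof (rule nn_integral_cong)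
    fix x assume [measurable]: "x \<in> space M"
    show "?D x * (\<integral>\<^sup>+ t. ennreal (exp (\<alpha> * \<bar>t\<bar> - \<alpha> * \<bar>t + ?L x\<bar>)) * indicator U (x, t) \<partial>?\<nu>)
      = (\<integral>\<^sup>+ t. ?D x * ennreal (exp (\<alpha> * \<bar>t\<bar> - \<alpha> * \<bar>t + ?L x\<bar>)) * indicator U (x, t) \<partial>?\<nu>)"
      by (subst nn_integral_cmult[symmetric]) (auto simp: mult.assoc)
  qed
  also have "\<dots> = (\<integral>\<^sup>+ z. (case z of (x, t) \<Rightarrow> ?D x *
         ennreal (exp (\<alpha> * \<bar>t\<bar> - \<alpha> * \<bar>t + ?L x\<bar>))) * indicator U z \<partial>(M \<Otimes>\<^sub>M ?\<nu>))"
    by (subst \<nu>.nn_integral_fst[symmetric]) auto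
  finally show ?thesis .
qed

text \<open>Null sets are preserved because the weight is almost everywhere positive. The group law
  in the real coordinate is the logarithm of the cocycle identity; finite and nonzero derivatives
  are essential there, since \<open>enn2real\<close> sends \<open>\<infinity>\<close> to
  \<open>0\<close> and additivity of \<open>ln\<close> is used for positive arguments.\<close>

lemma nonsingular_action_maharam:
  assumes "group G"
  shows "nonsingular_action G (M \<Otimes>\<^sub>M two_sided_exp \<alpha>) (maharam_map M \<phi>)"
  unfolding nonsingular_action_def
proof (intro conjI ballI)
  interpret group G by fact
  let ?\<nu> = "two_sided_exp \<alpha>"
  show "standard_prob_space (M \<Otimes>\<^sub>M ?\<nu>)"
    by (rule standard_prob_space_pair_real) (use ns \<nu>.prob_space_axioms in \<open>auto simp: nonsingular_action_def\<close>)
  show "AE z in M \<Otimes>\<^sub>M ?\<nu>. maharam_map M \<phi> \<one>\<^bsub>G\<^esub> z = z"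
  proof -
    have "AE x in M. \<phi> \<one>\<^bsub>G\<^esub> x = x \<and> translation_deriv M \<phi> \<one>\<^bsub>G\<^esub> x = 1"
      using ns translation_deriv_one[OF ns \<open>group G\<close>] by (auto simp: nonsingular_action_def)
    from AE_pair_fst[OF this M.sigma_finite_measure_axioms \<nu>.sigma_finite_measure_axioms]
    show ?thesis by eventually_elim (auto simp: maharam_map_def split: prod.splits)
  qed
  fix g assume g: "g \<in> carrier G"
  show "maharam_map M \<phi> g \<in> measurable (M \<Otimes>\<^sub>M ?\<nu>) (M \<Otimes>\<^sub>M ?\<nu>)" by (rule measurable_maharam_map[OF g])
  show "bij_betw (maharam_map M \<phi> g) (space (M \<Otimes>\<^sub>M ?\<nu>)) (space (M \<Otimes>\<^sub>M ?\<nu>))" by (rule bij_maharam_map[OF g])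
  have pos: "AE x in M. translation_deriv M \<phi> k x \<noteq> \<infinity> \<and> translation_deriv M \<phi> k x \<noteq> 0" if "k \<in> carrier G" for k
    using nonsingular_action_translated(4,5)[OF ns that] by auto
  {
    fix U assume U: "U \<in> sets (M \<Otimes>\<^sub>M ?\<nu>)"
    note [measurable] = U
    show "maharam_map M \<phi> g ` U \<in> sets (M \<Otimes>\<^sub>M ?\<nu>)" by (rule maharam_map_image[OF g U])
    let ?w = "\<lambda>z. (case z of (x, t) \<Rightarrow> translation_deriv M \<phi> g x *
         ennreal (exp (\<alpha> * \<bar>t\<bar> - \<alpha> * \<bar>t + ln (enn2real (translation_deriv M \<phi> g x))\<bar>)))"
    have "emeasure (M \<Otimes>\<^sub>M ?\<nu>) (maharam_map M \<phi> g ` U) = 0 \<longleftrightarrow> (AE z in M \<Otimes>\<^sub>M ?\<nu>. ?w z * indicator U z = 0)"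
      unfolding emeasure_maharam_map_image[OF g U] by (rule nn_integral_0_iff_AE) measurable
    also have "\<dots> \<longleftrightarrow> (AE z in M \<Otimes>\<^sub>M ?\<nu>. indicator U z = (0 :: ennreal))"
    proof (rule eventually_subst)
      from AE_pair_fst[OF pos[OF g] M.sigma_finite_measure_axioms \<nu>.sigma_finite_measure_axioms]
      show "AE z in M \<Otimes>\<^sub>M ?\<nu>. (?w z * indicator U z = 0) \<longleftrightarrow> (indicator U z = (0::ennreal))"
        by eventually_elim (auto simp: indicator_def split: prod.splits)
    qed
    also have "\<dots> \<longleftrightarrow> (\<integral>\<^sup>+ z. indicator U z \<partial>(M \<Otimes>\<^sub>M ?\<nu>)) = 0"
      by (rule nn_integral_0_iff_AE[symmetric]) measurable
    finally show "emeasure (M \<Otimes>\<^sub>M ?\<nu>) (maharam_map M \<phi> g ` U) = 0 \<longleftrightarrow> emeasure (M \<Otimes>\<^sub>M ?\<nu>) U = 0"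
      unfolding nn_integral_indicator[OF U] .
  }
  fix h assume h: "h \<in> carrier G"
  have "AE x in M. \<phi> (g \<otimes>\<^bsub>G\<^esub> h) x = \<phi> g (\<phi> h x)"
    using ns g h by (auto simp: nonsingular_action_def)
  with translation_deriv_cocycle[OF ns \<open>group G\<close> g h] pos[OF h] pos[OF m_closed[OF g h]]
  have "AE x in M. \<phi> (g \<otimes>\<^bsub>G\<^esub> h) x = \<phi> g (\<phi> h x) \<and>
      ln (enn2real (translation_deriv M \<phi> (g \<otimes>\<^bsub>G\<^esub> h) x)) =
      ln (enn2real (translation_deriv M \<phi> h x)) + ln (enn2real (translation_deriv M \<phi> g (\<phi> h x)))"
  proof eventually_elim
    case (elim x)
    have "0 < enn2real (translation_deriv M \<phi> h x)" "0 < enn2real (translation_deriv M \<phi> g (\<phi> h x))"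
      using elim by (auto simp: enn2real_positive_iff less_top zero_less_iff_neq_zero ennreal_mult_eq_top_iff)
    then show ?case
      using elim by (simp add: enn2real_mult ln_mult)
  qed
  from AE_pair_fst[OF this M.sigma_finite_measure_axioms \<nu>.sigma_finite_measure_axioms]
  show "AE z in M \<Otimes>\<^sub>M ?\<nu>. maharam_map M \<phi> (g \<otimes>\<^bsub>G\<^esub> h) z = maharam_map M \<phi> g (maharam_map M \<phi> h z)"
    by eventually_elim (auto simp: maharam_map_def split: prod.splits)
qed

text \<open>Let \<open>y\<close> be the logarithm of the base derivative. By the triangle inequality
  the inverse derivative is at most \<open>exp (\<alpha> * \<bar>y\<bar> - y)\<close>. For
  \<open>y \<ge> 0\<close> this is at most \<open>1\<close> because \<open>\<alpha> \<le> 1\<close>;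
  for \<open>y < 0\<close> it equals \<open>exp (- (1 + \<alpha>) * y)\<close>. The sum covers both
  cases uniformly in the real coordinate.\<close>

lemma AE_maharam_inverse_deriv_le:
  assumes g: "g \<in> carrier G" and "\<alpha> \<le> 1"
  shows "AE z in M \<Otimes>\<^sub>M two_sided_exp \<alpha>.
    inverse (translation_deriv (M \<Otimes>\<^sub>M two_sided_exp \<alpha>) (maharam_map M \<phi>) g z)
      \<le> 1 + ennreal (enn2real (translation_deriv M \<phi> g (fst z)) powr - (1 + \<alpha>))"
proof -
  let ?\<nu> = "two_sided_exp \<alpha>"
  have pos: "AE x in M. translation_deriv M \<phi> g x \<noteq> \<infinity> \<and> translation_deriv M \<phi> g x \<noteq> 0"
    using nonsingular_action_translated(4,5)[OF ns g] by auto
  have "AE z in M \<Otimes>\<^sub>M ?\<nu>. translation_deriv (M \<Otimes>\<^sub>M ?\<nu>) (maharam_map M \<phi>) g z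
     = (case z of (x, t) \<Rightarrow> translation_deriv M \<phi> g x *
         ennreal (exp (\<alpha> * \<bar>t\<bar> - \<alpha> * \<bar>t + ln (enn2real (translation_deriv M \<phi> g x))\<bar>)))"
  proof (rule translation_deriv_unique[OF P.prob_space_axioms])
    fix U assume "U \<in> sets (M \<Otimes>\<^sub>M ?\<nu>)"
    then show "emeasure (M \<Otimes>\<^sub>M ?\<nu>) (maharam_map M \<phi> g ` U) = (\<integral>\<^sup>+ z. (case z of (x, t) \<Rightarrow> translation_deriv M \<phi> g x *
         ennreal (exp (\<alpha> * \<bar>t\<bar> - \<alpha> * \<bar>t + ln (enn2real (translation_deriv M \<phi> g x))\<bar>))) *
         indicator U z \<partial>(M \<Otimes>\<^sub>M ?\<nu>))"
      by (rule emeasure_maharam_map_image[OF g])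
  qed measurable
  with AE_pair_fst[OF pos M.sigma_finite_measure_axioms \<nu>.sigma_finite_measure_axioms]
  show ?thesis
  proof eventually_elim
    case (elim z)
    define y where "y = ln (enn2real (translation_deriv M \<phi> g (fst z)))"
    obtain d where d: "translation_deriv M \<phi> g (fst z) = ennreal d" "0 < d"
      using elim(1) by (cases "translation_deriv M \<phi> g (fst z)") (auto simp: less_le)
    have y: "d = exp y" using d by (simp add: y_def)
    have "\<bar>snd z + y\<bar> \<le> \<bar>snd z\<bar> + \<bar>y\<bar>" by (rule abs_triangle_ineq)
    then have "\<alpha> * \<bar>snd z + y\<bar> - \<alpha> * \<bar>snd z\<bar> \<le> \<alpha> * \<bar>y\<bar>"
      using \<alpha> by (simp add: right_diff_distrib[symmetric])
    moreover have "\<alpha> * \<bar>y\<bar> - y \<le> max 0 (- (1 + \<alpha>) * y)"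
    proof (cases "0 \<le> y")
      case True
      then have "\<alpha> * y \<le> 1 * y" using assms(2) by (intro mult_right_mono) auto
      with True show ?thesis by simp
    qed (auto simp: algebra_simps)
    ultimately have le: "\<alpha> * \<bar>snd z + y\<bar> - \<alpha> * \<bar>snd z\<bar> - y \<le> max 0 (- (1 + \<alpha>) * y)" by linarith
    have "inverse (translation_deriv (M \<Otimes>\<^sub>M ?\<nu>) (maharam_map M \<phi>) g z)
      = inverse (ennreal (exp (y + \<alpha> * \<bar>snd z\<bar> - \<alpha> * \<bar>snd z + y\<bar>)))"
      using elim(2) d y by (simp add: split_beta y_def[symmetric] ennreal_mult[symmetric] exp_add[symmetric] add_diff_eq)
    also have "\<dots> = ennreal (exp (\<alpha> * \<bar>snd z + y\<bar> - \<alpha> * \<bar>snd z\<bar> - y))"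
      by (simp add: inverse_ennreal exp_minus[symmetric] algebra_simps)
    also have "\<dots> \<le> ennreal (exp (max 0 (- (1 + \<alpha>) * y)))"
      using le by (intro ennreal_leI) simp
    also have "\<dots> \<le> ennreal (1 + exp (- (1 + \<alpha>) * y))"
      by (intro ennreal_leI) (simp add: max_def)
    also have "\<dots> = 1 + ennreal (enn2real (translation_deriv M \<phi> g (fst z)) powr - (1 + \<alpha>))"
      using d y by (simp add: powr_def)
    finally show ?case .
  qed
qed

end

section \<open>Strong recurrence and the weight condition\<close>

text \<open>Jensen for \<open>t \<mapsto> 1 / t\<close>, by integrating the tangent inequality
  \<open>2 / s \<le> 1 / t + t / s\<^sup>2\<close>.\<close>

lemma inverse_weighted_sum_le:
  fixes w F :: "'k \<Rightarrow> ennreal"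
  assumes w: "(\<integral>\<^sup>+ k. w k \<partial>count_space A) = 1"
  shows "inverse (\<integral>\<^sup>+ k. w k * F k \<partial>count_space A) \<le> (\<integral>\<^sup>+ k. w k * inverse (F k) \<partial>count_space A)"
proof -
  let ?S = "\<integral>\<^sup>+ k. w k * F k \<partial>count_space A" and ?R = "\<integral>\<^sup>+ k. w k * inverse (F k) \<partial>count_space A"
  consider "?S = \<infinity>" | "?S = 0" | s where "?S = ennreal s" "0 < s"
    by (cases ?S) (auto simp: less_le)
  then show ?thesis
  proof cases
    case 2
    then have z: "\<forall>k\<in>A. w k * F k = 0"
      by (simp add: nn_integral_0_iff_AE AE_count_space)
    \<comment> \<open>Total weight one leaves some \<open>k\<close> with
      \<open>w k \<noteq> 0\<close>; there \<open>F k = 0\<close>, so that single term is already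
      infinite.\<close>
    have "?R = \<infinity>"
    proof (rule ccontr)
      assume "?R \<noteq> \<infinity>"
      then have "AE k in count_space A. w k * inverse (F k) \<noteq> \<infinity>"
        by (intro nn_integral_noteq_infinite) auto
      then have fin: "w k * inverse (F k) \<noteq> \<infinity>" if "k \<in> A" for k
        using that by (simp add: AE_count_space)
      have "w k = 0" if k: "k \<in> A" for k
      proof (rule ccontr)
        assume "w k \<noteq> 0"
        with z k have "F k = 0" by auto
        with fin[OF k] \<open>w k \<noteq> 0\<close> show False by (simp add: ennreal_mult_eq_top_iff)
      qed
      then have "(\<integral>\<^sup>+ k. w k \<partial>count_space A) = 0"
        by (simp add: nn_integral_0_iff_AE AE_count_space)
      with w show False by simp
    qed
    then show ?thesis by simp
  next
    case 3
    define c where "c = 1 / s"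
    have c: "0 < c" using 3 by (simp add: c_def)
    have tangent: "ennreal (2 * c) \<le> inverse t + ennreal (c\<^sup>2) * t" for t :: ennreal
    proof (cases t)
      case (real u)
      show ?thesis
      proof (cases "u = 0")
        case False
        then have u: "0 < u" using real by simp
        have "0 \<le> (1 - c * u)\<^sup>2 / u" using u by simp
        also have "\<dots> = inverse u + c\<^sup>2 * u - 2 * c"
          using u by (simp add: power2_eq_square field_simps)
        finally have "ennreal (2 * c) \<le> ennreal (inverse u + c\<^sup>2 * u)"
          by (intro ennreal_leI) simp
        also have "\<dots> = ennreal (inverse u) + ennreal (c\<^sup>2 * u)"
          using u by (intro ennreal_plus) auto
        finally show ?thesis
          using real u by (simp add: inverse_ennreal ennreal_mult)
      qed (use real in simp)
    next
      case top
      then show ?thesis using c by (simp add: ennreal_mult_top)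
    qed
    have "ennreal (2 * c) = (\<integral>\<^sup>+ k. ennreal (2 * c) * w k \<partial>count_space A)"
      by (simp add: nn_integral_cmult w)
    also have "\<dots> \<le> (\<integral>\<^sup>+ k. w k * inverse (F k) + ennreal (c\<^sup>2) * (w k * F k) \<partial>count_space A)"
    proof (rule nn_integral_mono)
      fix k
      have "ennreal (2 * c) * w k \<le> (inverse (F k) + ennreal (c\<^sup>2) * F k) * w k"
        by (rule mult_right_mono[OF tangent]) simp
      also have "\<dots> = w k * inverse (F k) + ennreal (c\<^sup>2) * (w k * F k)"
        by (simp only: distrib_right) (simp only: mult_ac)
      finally show "ennreal (2 * c) * w k \<le> w k * inverse (F k) + ennreal (c\<^sup>2) * (w k * F k)" .
    qed
    also have "\<dots> = ?R + ennreal (c\<^sup>2) * ?S"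
      by (subst nn_integral_add) (auto simp: nn_integral_cmult)
    also have "ennreal (c\<^sup>2) * ?S = ennreal c"
      using 3 by (simp add: c_def ennreal_mult[symmetric] power2_eq_square)
    finally have le: "ennreal (2 * c) \<le> ?R + ennreal c" .
    have "ennreal c \<le> ?R"
    proof (cases ?R)
      case (real v)
      then have "ennreal (2 * c) \<le> ennreal (v + c)" using le c by simp
      then have "2 * c \<le> v + c" using real c by (simp add: ennreal_le_iff del: ennreal_plus)
      then show ?thesis unfolding real(2) by (intro ennreal_leI) simp
    qed simp
    then show ?thesis using 3 by (simp add: c_def inverse_ennreal inverse_eq_divide)
  qed simp
qed

lemma (in group) bij_betw_mult_inv:
  assumes "g \<in> carrier G"
  shows "bij_betw (\<lambda>k. g \<otimes> inv k) (carrier G) (carrier G)"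
proof (rule bij_betw_byWitness[where f' = "\<lambda>h. inv h \<otimes> g"])
  show "\<forall>k\<in>carrier G. inv (g \<otimes> inv k) \<otimes> g = k"
    using assms by (simp add: inv_mult_group m_assoc)
  show "\<forall>h\<in>carrier G. g \<otimes> inv (inv h \<otimes> g) = h"
    using assms by (simp add: inv_mult_group m_assoc[symmetric])
qed (use assms in auto)

lemma (in group) bij_betw_left_mult:
  assumes "g \<in> carrier G"
  shows "bij_betw (\<lambda>k. g \<otimes> k) (carrier G) (carrier G)"
proof (rule bij_betw_byWitness[where f' = "\<lambda>h. inv g \<otimes> h"])
  show "\<forall>k\<in>carrier G. inv g \<otimes> (g \<otimes> k) = k" "\<forall>h\<in>carrier G. g \<otimes> (inv g \<otimes> h) = h"
    using assms by (simp_all add: m_assoc[symmetric])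
qed (use assms in auto)

lemma nn_integral_pmf_superset:
  assumes "set_pmf p \<subseteq> A"
  shows "(\<integral>\<^sup>+ x. ennreal (pmf p x) \<partial>count_space A) = 1"
proof -
  have "AE x in measure_pmf p. x \<in> A" using assms by (auto simp: AE_measure_pmf_iff)
  then show ?thesis unfolding nn_integral_pmf by (intro measure_pmf.emeasure_eq_1_AE) simp_all
qed

lemma (in group) nn_integral_pmf_translate:
  assumes "set_pmf p \<subseteq> carrier G" "g \<in> carrier G"
  shows "(\<integral>\<^sup>+ k. ennreal (pmf p (g \<otimes> inv k)) \<partial>count_space (carrier G)) = 1"
  unfolding nn_integral_bij_count_space[OF bij_betw_mult_inv[OF assms(2)], of "\<lambda>h. ennreal (pmf p h)"]
  by (rule nn_integral_pmf_superset[OF assms(1)])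

text \<open>For fixed \<open>g\<close> the numbers \<open>\<eta> n (g \<otimes> inv k)\<close> are
  probability weights in \<open>k\<close>, so the convexity inequality moves the inverse inside the
  sum, and each derivative is then integrated separately. The constant \<open>C\<close> lets one
  criterion serve both systems: it will be \<open>1\<close> for the Bernoulli action and
  \<open>2\<close> for its Maharam extension.\<close>

lemma (in group) strongly_recurrentI:
  fixes C :: ennreal
  assumes count: "countable (carrier G)" and ns: "nonsingular_action G M \<phi>"
    and \<eta>: "exp_weight_condition G m \<kappa> \<eta>" and C: "C < \<infinity>"
    and bound: "\<And>k. k \<in> carrier G \<Longrightarrow> (\<integral>\<^sup>+ x. inverse (translation_deriv M \<phi> k x) \<partial>M)
        \<le> C * ennreal (exp (\<kappa> * l2_norm_sq G (shift_diff G m k)))"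
  shows "strongly_recurrent G M \<phi> \<eta>"
  unfolding strongly_recurrent_def
proof (intro conjI ns)
  show ps: "prob_sequence_on G \<eta>" using \<eta> by (simp add: exp_weight_condition_def)
  let ?K = "count_space (carrier G)"
  let ?e = "\<lambda>k. ennreal (exp (\<kappa> * l2_norm_sq G (shift_diff G m k)))"
  let ?E = "\<lambda>n. \<integral>\<^sup>+ k. \<integral>\<^sup>+ g. ennreal ((pmf (\<eta> n) g)\<^sup>2 * pmf (\<eta> n) (g \<otimes> inv k) *
      exp (\<kappa> * l2_norm_sq G (shift_diff G m k))) \<partial>?K \<partial>?K"
  let ?L = "\<lambda>n. \<integral>\<^sup>+ g. ennreal ((pmf (\<eta> n) g)\<^sup>2) *
      (\<integral>\<^sup>+ x. inverse (\<integral>\<^sup>+ k. ennreal (pmf (\<eta> n) (g \<otimes> inv k)) * translation_deriv M \<phi> k x \<partial>?K) \<partial>M) \<partial>?K"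
  have E: "?E \<longlonglongrightarrow> 0" using \<eta> by (simp add: exp_weight_condition_def)
  have "?L n \<le> C * ?E n" for n
  proof -
    have supp: "set_pmf (\<eta> n) \<subseteq> carrier G" using ps by (simp add: prob_sequence_on_def)
    have [measurable]: "translation_deriv M \<phi> k \<in> borel_measurable M" for k
      by (simp add: translation_deriv_def)
    have "?L n \<le> (\<integral>\<^sup>+ g. \<integral>\<^sup>+ k. C * ennreal ((pmf (\<eta> n) g)\<^sup>2 * pmf (\<eta> n) (g \<otimes> inv k) *
        exp (\<kappa> * l2_norm_sq G (shift_diff G m k))) \<partial>?K \<partial>?K)"
    proof (rule nn_integral_mono)
      fix g assume "g \<in> space ?K"
      then have g: "g \<in> carrier G" by simp
      have "(\<integral>\<^sup>+ x. inverse (\<integral>\<^sup>+ k. ennreal (pmf (\<eta> n) (g \<otimes> inv k)) * translation_deriv M \<phi> k x \<partial>?K) \<partial>M)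
          \<le> (\<integral>\<^sup>+ x. \<integral>\<^sup>+ k. ennreal (pmf (\<eta> n) (g \<otimes> inv k)) * inverse (translation_deriv M \<phi> k x) \<partial>?K \<partial>M)"
        by (intro nn_integral_mono inverse_weighted_sum_le nn_integral_pmf_translate supp g)
      also have "\<dots> = (\<integral>\<^sup>+ k. \<integral>\<^sup>+ x. ennreal (pmf (\<eta> n) (g \<otimes> inv k)) * inverse (translation_deriv M \<phi> k x) \<partial>M \<partial>?K)"
        by (rule nn_integral_count_space_nn_integral[OF count]) measurable
      also have "\<dots> = (\<integral>\<^sup>+ k. ennreal (pmf (\<eta> n) (g \<otimes> inv k)) * (\<integral>\<^sup>+ x. inverse (translation_deriv M \<phi> k x) \<partial>M) \<partial>?K)"
        by (intro nn_integral_cong nn_integral_cmult) measurable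
      also have "\<dots> \<le> (\<integral>\<^sup>+ k. ennreal (pmf (\<eta> n) (g \<otimes> inv k)) * (C * ?e k) \<partial>?K)"
        by (intro nn_integral_mono mult_left_mono bound) auto
      finally have "ennreal ((pmf (\<eta> n) g)\<^sup>2) *
          (\<integral>\<^sup>+ x. inverse (\<integral>\<^sup>+ k. ennreal (pmf (\<eta> n) (g \<otimes> inv k)) * translation_deriv M \<phi> k x \<partial>?K) \<partial>M)
          \<le> ennreal ((pmf (\<eta> n) g)\<^sup>2) * (\<integral>\<^sup>+ k. ennreal (pmf (\<eta> n) (g \<otimes> inv k)) * (C * ?e k) \<partial>?K)"
        by (rule mult_left_mono) simp
      also have "\<dots> = (\<integral>\<^sup>+ k. ennreal ((pmf (\<eta> n) g)\<^sup>2) * (ennreal (pmf (\<eta> n) (g \<otimes> inv k)) * (C * ?e k)) \<partial>?K)"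
        by (rule nn_integral_cmult[symmetric]) simp
      also have "\<dots> = (\<integral>\<^sup>+ k. C * ennreal ((pmf (\<eta> n) g)\<^sup>2 * pmf (\<eta> n) (g \<otimes> inv k) *
          exp (\<kappa> * l2_norm_sq G (shift_diff G m k))) \<partial>?K)"
        by (rule nn_integral_cong) (simp add: ennreal_mult mult_ac)
      finally show "ennreal ((pmf (\<eta> n) g)\<^sup>2) *
          (\<integral>\<^sup>+ x. inverse (\<integral>\<^sup>+ k. ennreal (pmf (\<eta> n) (g \<otimes> inv k)) * translation_deriv M \<phi> k x \<partial>?K) \<partial>M)
          \<le> (\<integral>\<^sup>+ k. C * ennreal ((pmf (\<eta> n) g)\<^sup>2 * pmf (\<eta> n) (g \<otimes> inv k) *
          exp (\<kappa> * l2_norm_sq G (shift_diff G m k))) \<partial>?K)" .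
    qed
    also have "\<dots> = (\<integral>\<^sup>+ k. \<integral>\<^sup>+ g. C * ennreal ((pmf (\<eta> n) g)\<^sup>2 * pmf (\<eta> n) (g \<otimes> inv k) *
        exp (\<kappa> * l2_norm_sq G (shift_diff G m k))) \<partial>?K \<partial>?K)"
      by (rule nn_integral_count_space_nn_integral[OF count]) simp
    also have "\<dots> = C * ?E n"
      by (simp add: nn_integral_cmult)
    finally show ?thesis .
  qed
  moreover have "(\<lambda>n. C * ?E n) \<longlonglongrightarrow> 0"
    using ennreal_tendsto_cmult[OF _ E, of C] C by simp
  ultimately show "?L \<longlonglongrightarrow> 0"
    using tendsto_sandwich[where f = "\<lambda>_. 0" and g = ?L and h = "\<lambda>n. C * ?E n" and net = sequentially and c = 0] by simp
qed

text \<open>If every level set \<open>{l \<le> t}\<close> had at most \<open>C exp (a t)\<close> elements, then \<open>exp (- b l)\<close>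
  would be summable for every \<open>b > a\<close>.\<close>

lemma large_finite_level_set:
  fixes l :: "'k \<Rightarrow> real"
  assumes l: "\<And>g. g \<in> A \<Longrightarrow> 0 \<le> l g" and ab: "0 < a" "a < b" and C: "0 < C"
    and div: "(\<integral>\<^sup>+ g. ennreal (exp (- b * l g)) \<partial>count_space A) = \<infinity>"
  obtains t F where "finite F" "F \<subseteq> A" "\<And>g. g \<in> F \<Longrightarrow> l g \<le> t" "C * exp (a * t) \<le> real (card F)"
proof (rule ccontr)
  assume nt: "\<not> thesis"
  have hyp: "\<not> (finite F \<and> F \<subseteq> A \<and> (\<forall>g\<in>F. l g \<le> t) \<and> C * exp (a * t) \<le> real (card F))" for F t
    using that[of F t] nt by blast
  have small: "real (card F) < C * exp (a * t)"
    if "finite F" "F \<subseteq> A" "\<And>g. g \<in> F \<Longrightarrow> l g \<le> t" for F t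
    using hyp[of F t] that not_le by blast
  \<comment> \<open>The level sets may overlap: for \<open>j\<close> the floor of
    \<open>l g\<close>, the term at \<open>g\<close> is at most \<open>exp (- b * j)\<close> and
    \<open>g\<close> lies in \<open>L j\<close>. Allowing \<open>j + 1\<close> instead of
    \<open>j\<close> costs only the factor \<open>exp a\<close>, and the series over
    \<open>j\<close> becomes geometric with ratio \<open>exp (a - b)\<close>.\<close>
  define L where "L j = {g \<in> A. l g \<le> real j + 1}" for j :: nat
  have L_bound: "emeasure (count_space A) (L j) \<le> ennreal (C * exp (a * (real j + 1)))" for j
  proof -
    have "finite (L j)"
    \<comment> \<open>An infinite level set would contain finite subsets of every size, against
      \<open>small\<close>.\<close>
    proof (rule ccontr)
      assume inf: "infinite (L j)"
      obtain N :: nat where N: "C * exp (a * (real j + 1)) \<le> real N" using real_arch_simple by blast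
      obtain F where F: "finite F" "card F = N" "F \<subseteq> L j"
        using infinite_arbitrarily_large[OF inf] by blast
      have "real (card F) < C * exp (a * (real j + 1))"
        by (rule small) (use F in \<open>auto simp: L_def\<close>)
      with N F(2) show False by simp
    qed
    moreover from this have "real (card (L j)) < C * exp (a * (real j + 1))"
      by (intro small) (auto simp: L_def)
    moreover have "L j \<subseteq> A" by (auto simp: L_def)
    ultimately show ?thesis
      by (simp add: emeasure_count_space_finite ennreal_of_nat_eq_real_of_nat ennreal_leI)
  qed
  let ?q = "exp (a - b)"
  have geo: "(\<lambda>j. C * exp a * ?q ^ j) sums (C * exp a * (1 / (1 - ?q)))"
    using ab by (intro sums_mult geometric_sums) simp
  have "(\<integral>\<^sup>+ g. ennreal (exp (- b * l g)) \<partial>count_space A)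
      \<le> (\<integral>\<^sup>+ g. (\<Sum>j. ennreal (exp (- b * real j)) * indicator (L j) g) \<partial>count_space A)"
  proof (rule nn_integral_mono)
    fix g assume "g \<in> space (count_space A)"
    then have g: "g \<in> A" by simp
    define j where "j = nat \<lfloor>l g\<rfloor>"
    have j: "real j \<le> l g" "l g \<le> real j + 1" using l[OF g] unfolding j_def by linarith+
    have "ennreal (exp (- b * l g)) \<le> ennreal (exp (- b * real j)) * indicator (L j) g"
      using j g ab by (simp add: L_def ennreal_leI)
    also have "\<dots> \<le> (\<Sum>j. ennreal (exp (- b * real j)) * indicator (L j) g)"
    proof -
      have "h j \<le> (\<Sum>i. h i)" for h :: "nat \<Rightarrow> ennreal"
        using sum_le_suminf[OF summableI, of "{j}" h] by simp
      then show ?thesis .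
    qed
    finally show "ennreal (exp (- b * l g)) \<le> (\<Sum>j. ennreal (exp (- b * real j)) * indicator (L j) g)" .
  qed
  also have "\<dots> = (\<Sum>j. \<integral>\<^sup>+ g. ennreal (exp (- b * real j)) * indicator (L j) g \<partial>count_space A)"
    by (rule nn_integral_suminf) simp
  also have "\<dots> = (\<Sum>j. ennreal (exp (- b * real j)) * emeasure (count_space A) (L j))"
    by (intro arg_cong[where f = suminf] ext nn_integral_cmult_indicator) (auto simp: L_def)
  also have "\<dots> \<le> (\<Sum>j. ennreal (C * exp a * ?q ^ j))"
  proof (rule suminf_le)
    fix j
    have "ennreal (exp (- b * real j)) * emeasure (count_space A) (L j)
        \<le> ennreal (exp (- b * real j)) * ennreal (C * exp (a * (real j + 1)))"
      by (rule mult_left_mono[OF L_bound]) simp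
    also have "\<dots> = ennreal (C * exp a * ?q ^ j)"
      using C by (simp add: ennreal_mult[symmetric] exp_of_nat_mult[symmetric] exp_add[symmetric] algebra_simps)
    finally show "ennreal (exp (- b * real j)) * emeasure (count_space A) (L j) \<le> ennreal (C * exp a * ?q ^ j)" .
  qed auto
  also have "\<dots> = ennreal (C * exp a * (1 / (1 - ?q)))"
    by (rule suminf_ennreal_eq[OF _ geo]) (use C in simp)
  finally show False using div by (simp add: top_unique)
qed

section \<open>The cocycle of shift differences and the existence of weight sequences\<close>

lemma l2_norm_sq_nonneg: "0 \<le> l2_norm_sq G f"
  unfolding l2_norm_sq_def by (rule infsum_nonneg) simp

context group
begin

text \<open>The cocycle identity: evaluated at \<open>inv h \<otimes> j\<close>, the shift
  difference of \<open>inv h \<otimes> g\<close> is that of \<open>g\<close> at \<open>j\<close>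
  minus that of \<open>h\<close> at \<open>j\<close>. Left multiplication by \<open>inv h\<close>
  permutes the summation range.\<close>

lemma l2_norm_sq_shift_diff_reindex:
  assumes h: "h \<in> carrier G" and g: "g \<in> carrier G"
  shows "l2_norm_sq G (shift_diff G m (inv h \<otimes> g))
    = (\<Sum>\<^sub>\<infinity>j\<in>carrier G. (shift_diff G m g j - shift_diff G m h j)\<^sup>2)"
    and "(\<lambda>k. (shift_diff G m (inv h \<otimes> g) k)\<^sup>2) summable_on carrier G \<longleftrightarrow>
      (\<lambda>j. (shift_diff G m g j - shift_diff G m h j)\<^sup>2) summable_on carrier G"
proof -
  have bij: "bij_betw (\<lambda>j. inv h \<otimes> j) (carrier G) (carrier G)"
    by (rule bij_betw_left_mult) (use h in simp)
  have eq: "(shift_diff G m (inv h \<otimes> g) (inv h \<otimes> j))\<^sup>2 = (shift_diff G m g j - shift_diff G m h j)\<^sup>2"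
    if j: "j \<in> carrier G" for j
  proof -
    have "inv (inv h \<otimes> g) \<otimes> (inv h \<otimes> j) = inv g \<otimes> j"
      using g h j by (simp add: inv_mult_group m_assoc) (simp add: m_assoc[symmetric])
    then have "shift_diff G m (inv h \<otimes> g) (inv h \<otimes> j) = shift_diff G m g j - shift_diff G m h j"
      by (simp add: shift_diff_def)
    then show ?thesis by simp
  qed
  show "l2_norm_sq G (shift_diff G m (inv h \<otimes> g))
    = (\<Sum>\<^sub>\<infinity>j\<in>carrier G. (shift_diff G m g j - shift_diff G m h j)\<^sup>2)"
    unfolding l2_norm_sq_def
    by (subst infsum_reindex_bij_betw[OF bij, symmetric]) (rule infsum_cong, rule eq)
  show "(\<lambda>k. (shift_diff G m (inv h \<otimes> g) k)\<^sup>2) summable_on carrier G \<longleftrightarrow>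
      (\<lambda>j. (shift_diff G m g j - shift_diff G m h j)\<^sup>2) summable_on carrier G"
    by (subst summable_on_reindex_bij_betw[OF bij, symmetric]) (rule summable_on_cong, rule eq)
qed

text \<open>The case \<open>g = \<one>\<close> of the cocycle identity, where the shift difference
  of \<open>\<one>\<close> vanishes.\<close>

lemma l2_norm_sq_shift_diff_inv:
  assumes "h \<in> carrier G"
  shows "l2_norm_sq G (shift_diff G m (inv h)) = l2_norm_sq G (shift_diff G m h)"
proof -
  have "l2_norm_sq G (shift_diff G m (inv h)) = l2_norm_sq G (shift_diff G m (inv h \<otimes> \<one>))"
    using assms by simp
  also have "\<dots> = (\<Sum>\<^sub>\<infinity>j\<in>carrier G. (shift_diff G m \<one> j - shift_diff G m h j)\<^sup>2)"
    by (rule l2_norm_sq_shift_diff_reindex) (use assms in auto)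
  also have "\<dots> = l2_norm_sq G (shift_diff G m h)"
    unfolding l2_norm_sq_def by (rule infsum_cong) (simp add: shift_diff_def power2_commute)
  finally show ?thesis .
qed

text \<open>Termwise \<open>(a - b)^2 \<le> 2 * a^2 + 2 * b^2\<close> after reindexing. With both
  norms at most \<open>t\<close> the result is \<open>4 * t\<close>, which is where the
  \<open>4\<close> in the divergence hypothesis comes from.\<close>

lemma l2_norm_sq_shift_diff_le:
  assumes sm: "\<And>g. g \<in> carrier G \<Longrightarrow> (\<lambda>k. (shift_diff G m g k)\<^sup>2) summable_on carrier G"
    and h: "h \<in> carrier G" and g: "g \<in> carrier G"
  shows "l2_norm_sq G (shift_diff G m (inv h \<otimes> g))
    \<le> 2 * l2_norm_sq G (shift_diff G m g) + 2 * l2_norm_sq G (shift_diff G m h)"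
proof -
  have "l2_norm_sq G (shift_diff G m (inv h \<otimes> g))
      = (\<Sum>\<^sub>\<infinity>j\<in>carrier G. (shift_diff G m g j - shift_diff G m h j)\<^sup>2)"
    by (rule l2_norm_sq_shift_diff_reindex(1)[OF h g])
  also have "\<dots> \<le> (\<Sum>\<^sub>\<infinity>j\<in>carrier G. 2 * (shift_diff G m g j)\<^sup>2 + 2 * (shift_diff G m h j)\<^sup>2)"
  proof (rule infsum_mono)
    show "(\<lambda>j. (shift_diff G m g j - shift_diff G m h j)\<^sup>2) summable_on carrier G"
      using l2_norm_sq_shift_diff_reindex(2)[OF h g, of m] sm[of "inv h \<otimes> g"] g h by simp
    show "(\<lambda>j. 2 * (shift_diff G m g j)\<^sup>2 + 2 * (shift_diff G m h j)\<^sup>2) summable_on carrier G"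
      using sm g h by (intro summable_on_add summable_on_cmult_right) auto
    fix j
    have "0 \<le> (shift_diff G m g j + shift_diff G m h j)\<^sup>2" by simp
    then show "(shift_diff G m g j - shift_diff G m h j)\<^sup>2 \<le> 2 * (shift_diff G m g j)\<^sup>2 + 2 * (shift_diff G m h j)\<^sup>2"
      by (simp add: power2_eq_square algebra_simps)
  qed
  also have "\<dots> = 2 * l2_norm_sq G (shift_diff G m g) + 2 * l2_norm_sq G (shift_diff G m h)"
    unfolding l2_norm_sq_def using sm g h
    by (subst infsum_add) (auto simp: infsum_cmult_right' intro!: summable_on_cmult_right)
  finally show ?thesis .
qed

text \<open>A nonzero term has \<open>g\<close> and \<open>h = g \<otimes> inv k\<close> in
  \<open>F\<close>, so \<open>k = inv h \<otimes> g\<close> and its squared norm is at most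
  \<open>4 * t\<close>. One of the two factors at \<open>g\<close> supplies
  \<open>1 / card F\<close>; the other one and the factor at \<open>h\<close> sum to one over
  \<open>k\<close> and \<open>g\<close>.\<close>

lemma exp_weight_uniform_le:
  assumes count: "countable (carrier G)"
    and sm: "\<And>g. g \<in> carrier G \<Longrightarrow> (\<lambda>k. (shift_diff G m g k)\<^sup>2) summable_on carrier G"
    and \<kappa>: "0 < \<kappa>" and F: "finite F" "F \<noteq> {}" "F \<subseteq> carrier G"
    and t: "\<And>g. g \<in> F \<Longrightarrow> l2_norm_sq G (shift_diff G m g) \<le> t"
  shows "(\<integral>\<^sup>+ k. \<integral>\<^sup>+ g. ennreal ((pmf (pmf_of_set F) g)\<^sup>2 * pmf (pmf_of_set F) (g \<otimes> inv k) *
              exp (\<kappa> * l2_norm_sq G (shift_diff G m k)))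
            \<partial>count_space (carrier G) \<partial>count_space (carrier G))
      \<le> ennreal (exp (4 * \<kappa> * t) / real (card F))"
proof -
  let ?K = "count_space (carrier G)" and ?p = "pmf (pmf_of_set F)"
  let ?e = "\<lambda>k. exp (\<kappa> * l2_norm_sq G (shift_diff G m k))"
  have supp: "set_pmf (pmf_of_set F) \<subseteq> carrier G" using F by simp
  have "(\<integral>\<^sup>+ k. \<integral>\<^sup>+ g. ennreal ((?p g)\<^sup>2 * ?p (g \<otimes> inv k) * ?e k) \<partial>?K \<partial>?K)
      = (\<integral>\<^sup>+ g. \<integral>\<^sup>+ k. ennreal ((?p g)\<^sup>2 * ?p (g \<otimes> inv k) * ?e k) \<partial>?K \<partial>?K)"
    by (rule nn_integral_count_space_nn_integral[OF count, symmetric]) simp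
  also have "\<dots> \<le> (\<integral>\<^sup>+ g. \<integral>\<^sup>+ k. ennreal (exp (4 * \<kappa> * t) / real (card F)) * (ennreal (?p g) * ennreal (?p (g \<otimes> inv k))) \<partial>?K \<partial>?K)"
  proof (intro nn_integral_mono)
    fix g k assume "g \<in> space ?K" "k \<in> space ?K"
    then have gk: "g \<in> carrier G" "k \<in> carrier G" by auto
    let ?h = "g \<otimes> inv k"
    have "(?p g)\<^sup>2 * ?p ?h * ?e k \<le> exp (4 * \<kappa> * t) / real (card F) * (?p g * ?p ?h)"
    proof (cases "g \<in> F \<and> ?h \<in> F")
      case True
      have k: "k = inv ?h \<otimes> g" using gk by (simp add: inv_mult_group m_assoc)
      have "l2_norm_sq G (shift_diff G m k) \<le> 2 * l2_norm_sq G (shift_diff G m g) + 2 * l2_norm_sq G (shift_diff G m ?h)"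
        by (subst k, rule l2_norm_sq_shift_diff_le[OF sm]) (use gk in auto)
      also have "\<dots> \<le> 4 * t" using t[of g] t[of ?h] True by simp
      finally have "?e k \<le> exp (4 * \<kappa> * t)" using \<kappa> by simp
      moreover have "(?p g)\<^sup>2 * ?p ?h = 1 / real (card F) * (?p g * ?p ?h)"
        using True F by (simp add: power2_eq_square)
      ultimately have "(?p g)\<^sup>2 * ?p ?h * ?e k \<le> 1 / real (card F) * (?p g * ?p ?h) * exp (4 * \<kappa> * t)"
        by (simp add: divide_right_mono mult_left_mono)
      then show ?thesis by (simp add: mult_ac)
    next
      case False
      then show ?thesis using F by auto
    qed
    then have "ennreal ((?p g)\<^sup>2 * ?p ?h * ?e k) \<le> ennreal (exp (4 * \<kappa> * t) / real (card F) * (?p g * ?p ?h))"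
      by (rule ennreal_leI)
    then show "ennreal ((?p g)\<^sup>2 * ?p ?h * ?e k)
        \<le> ennreal (exp (4 * \<kappa> * t) / real (card F)) * (ennreal (?p g) * ennreal (?p ?h))"
      by (simp only: ennreal_mult pmf_nonneg mult_nonneg_nonneg divide_nonneg_nonneg exp_ge_zero of_nat_0_le_iff)
  qed
  also have "\<dots> = ennreal (exp (4 * \<kappa> * t) / real (card F)) * (\<integral>\<^sup>+ g. ennreal (?p g) *
      (\<integral>\<^sup>+ k. ennreal (?p (g \<otimes> inv k)) \<partial>?K) \<partial>?K)"
    by (simp add: nn_integral_cmult)
  also have "(\<integral>\<^sup>+ g. ennreal (?p g) * (\<integral>\<^sup>+ k. ennreal (?p (g \<otimes> inv k)) \<partial>?K) \<partial>?K) = (\<integral>\<^sup>+ g. ennreal (?p g) \<partial>?K)"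
    by (rule nn_integral_cong) (simp add: nn_integral_pmf_translate[OF supp])
  also have "\<dots> = 1" by (rule nn_integral_pmf_superset[OF supp])
  finally show ?thesis by simp
qed

lemma exp_weight_condition_exists:
  assumes count: "countable (carrier G)"
    and sm: "\<And>g. g \<in> carrier G \<Longrightarrow> (\<lambda>k. (shift_diff G m g k)\<^sup>2) summable_on carrier G"
    and \<kappa>: "0 < \<kappa>\<^sub>1" "\<kappa>\<^sub>1 < \<kappa>"
    and div: "(\<integral>\<^sup>+ g. ennreal (exp (- 4 * \<kappa> * l2_norm_sq G (shift_diff G m g))) \<partial>count_space (carrier G)) = \<infinity>"
  shows "\<exists>\<eta>. exp_weight_condition G m \<kappa>\<^sub>1 \<eta>"
proof -
  let ?l = "\<lambda>g. l2_norm_sq G (shift_diff G m g)"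
  \<comment> \<open>With \<open>C = n + 1\<close> the weight sum will be at most
    \<open>1 / (n + 1)\<close>. The strict gap between \<open>4 * \<kappa>\<^sub>1\<close> and
    \<open>4 * \<kappa>\<close> is what the level set argument consumes.\<close>
  have "\<exists>t F. finite F \<and> F \<subseteq> carrier G \<and> (\<forall>g\<in>F. ?l g \<le> t) \<and> real (Suc n) * exp (4 * \<kappa>\<^sub>1 * t) \<le> real (card F)" for n
  proof (rule large_finite_level_set[where A = "carrier G" and l = ?l and a = "4 * \<kappa>\<^sub>1" and b = "4 * \<kappa>" and C = "real (Suc n)"])
    show "(\<integral>\<^sup>+ g. ennreal (exp (- (4 * \<kappa>) * ?l g)) \<partial>count_space (carrier G)) = \<infinity>" using div by simp
  qed (use \<kappa> l2_norm_sq_nonneg in auto)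
  then obtain t F where F: "\<And>n. finite (F n)" "\<And>n. F n \<subseteq> carrier G" "\<And>n g. g \<in> F n \<Longrightarrow> ?l g \<le> t n"
      "\<And>n. real (Suc n) * exp (4 * \<kappa>\<^sub>1 * t n) \<le> real (card (F n))"
    by metis
  have card_pos: "0 < real (card (F n))" for n
    by (rule less_le_trans[OF _ F(4)]) simp
  then have ne: "F n \<noteq> {}" for n by (metis card.empty less_irrefl of_nat_0)
  let ?E = "\<lambda>n. \<integral>\<^sup>+ k. \<integral>\<^sup>+ g. ennreal ((pmf (pmf_of_set (F n)) g)\<^sup>2 * pmf (pmf_of_set (F n)) (g \<otimes> inv k) *
              exp (\<kappa>\<^sub>1 * ?l k)) \<partial>count_space (carrier G) \<partial>count_space (carrier G)"
  have "?E n \<le> ennreal (1 / real (Suc n))" for n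
  proof -
    have "?E n \<le> ennreal (exp (4 * \<kappa>\<^sub>1 * t n) / real (card (F n)))"
      by (rule exp_weight_uniform_le[OF count sm \<kappa>(1) F(1) ne F(2) F(3)])
    also have "\<dots> \<le> ennreal (1 / real (Suc n))"
      using F(4)[of n] card_pos[of n] by (intro ennreal_leI) (simp add: field_simps)
    finally show ?thesis .
  qed
  moreover have "(\<lambda>n. ennreal (1 / real (Suc n))) \<longlonglongrightarrow> 0"
    using tendsto_ennrealI[OF LIMSEQ_inverse_real_of_nat] by (simp add: inverse_eq_divide)
  ultimately have "?E \<longlonglongrightarrow> 0"
    using tendsto_sandwich[where f = "\<lambda>_. 0" and g = ?E and h = "\<lambda>n. ennreal (1 / real (Suc n))" and net = sequentially and c = 0] by simp
  moreover have "prob_sequence_on G (\<lambda>n. pmf_of_set (F n))"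
    using F ne by (simp add: prob_sequence_on_def)
  ultimately have "exp_weight_condition G m \<kappa>\<^sub>1 (\<lambda>n. pmf_of_set (F n))"
    unfolding exp_weight_condition_def by simp
  then show ?thesis by blast
qed

end

section \<open>Moments of two-point densities\<close>

text \<open>Right side minus left side is convex on \<open>{0<..R}\<close>: its second derivative is
  nonnegative because \<open>v powr (b - 2)\<close> increases with \<open>v\<close> when
  \<open>2 \<le> b\<close>. At \<open>1\<close> the difference and its first derivative both vanish,
  so it lies above its zero tangent.\<close>

lemma powr_le_quadratic:
  fixes u R b :: real
  assumes u: "0 < u" "u \<le> R" and R: "1 \<le> R" and b: "2 \<le> b"
  shows "u powr b \<le> 1 + b * (u - 1) + b * (b - 1) / 2 * R powr (b - 2) * (u - 1)\<^sup>2"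
proof -
  define K where "K = b * (b - 1) / 2 * R powr (b - 2)"
  let ?g = "\<lambda>v. 1 + b * (v - 1) + K * (v - 1)\<^sup>2 - v powr b"
  let ?g' = "\<lambda>v. b + 2 * K * (v - 1) - b * v powr (b - 1)"
  let ?g'' = "\<lambda>v. 2 * K - b * ((b - 1) * v powr (b - 2))"
  have "?g' 1 * (u - 1) \<le> ?g u - ?g 1"
  proof (rule f''_imp_f'[of "{0<..R}" ?g ?g' ?g''])
    show "convex {0<..R}" by simp
    fix v assume v: "v \<in> {0<..R}"
    show "DERIV ?g v :> ?g' v"
      using has_real_derivative_powr[of v b] v by (auto intro!: derivative_eq_intros)
    have "DERIV (\<lambda>v. v powr (b - 1)) v :> (b - 1) * v powr (b - 2)"
      using has_real_derivative_powr[of v "b - 1"] v by simp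
    then show "DERIV ?g' v :> ?g'' v"
      using v by (auto intro!: derivative_eq_intros)
    have "v powr (b - 2) \<le> R powr (b - 2)" using v b by (intro powr_mono2) auto
    then have "b * (b - 1) * v powr (b - 2) \<le> b * (b - 1) * R powr (b - 2)"
      using b by (intro mult_left_mono) auto
    then show "0 \<le> ?g'' v" by (simp add: K_def mult.assoc)
  qed (use u R in auto)
  then show ?thesis by (simp add: K_def)
qed

text \<open>The moment is rewritten as a mean with respect to \<open>q\<close>: with
  \<open>u = p / q\<close>, the summand \<open>p * (q / p) powr - (1 + \<alpha>)\<close> is
  \<open>q * u powr (2 + \<alpha>)\<close>. Expanding at \<open>u = 1\<close> makes the deviation
  from \<open>1\<close> quadratic in \<open>p - q\<close>.\<close>

lemma two_point_moment_le:
  fixes p q \<delta> \<alpha> c :: real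
  assumes \<delta>: "0 < \<delta>" "\<delta> < 1/2" and p: "p \<in> {\<delta>..1 - \<delta>}" and q: "q \<in> {\<delta>..1 - \<delta>}" and \<alpha>: "0 \<le> \<alpha>"
    and c: "(2 + \<alpha>) * (1 + \<alpha>) / 2 * ((1 - \<delta>) / \<delta>) powr \<alpha> / (\<delta> * (1 - \<delta>)) \<le> c"
  shows "p * (q / p) powr - (1 + \<alpha>) + (1 - p) * ((1 - q) / (1 - p)) powr - (1 + \<alpha>) \<le> exp (c * (p - q)\<^sup>2)"
proof -
  define R where "R = (1 - \<delta>) / \<delta>"
  define K where "K = (2 + \<alpha>) * (1 + \<alpha>) / 2 * R powr \<alpha>"
  have R: "1 \<le> R" using \<delta> by (simp add: R_def field_simps)
  have K: "0 \<le> K" using \<alpha> by (simp add: K_def)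
  have summand: "y * (z / y) powr - (1 + \<alpha>) \<le> z + (2 + \<alpha>) * (y - z) + K * ((y - z)\<^sup>2 / z)"
    if y: "y \<in> {\<delta>..1 - \<delta>}" and z: "z \<in> {\<delta>..1 - \<delta>}" for y z
  proof -
    have pos: "0 < y" "0 < z" using y z \<delta> by auto
    let ?u = "y / z"
    have uR: "?u \<le> R" unfolding R_def using y z \<delta> by (intro frac_le) auto
    have "y * (z / y) powr - (1 + \<alpha>) = z * ?u powr (2 + \<alpha>)"
    proof -
      have "(z / y) powr - (1 + \<alpha>) = ?u powr (1 + \<alpha>)"
      proof -
        have "(z / y) powr - (1 + \<alpha>) = inverse ((z / y) powr (1 + \<alpha>))" by (rule powr_minus)
        also have "\<dots> = ?u powr (1 + \<alpha>)" using pos by (simp add: powr_divide)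
        finally show ?thesis .
      qed
      moreover have "?u powr (2 + \<alpha>) = ?u * ?u powr (1 + \<alpha>)"
        using pos powr_mult_base[of ?u "1 + \<alpha>"] by (simp add: add.assoc)
      ultimately show ?thesis using pos by simp
    qed
    also have "\<dots> \<le> z * (1 + (2 + \<alpha>) * (?u - 1) + K * (?u - 1)\<^sup>2)"
      using powr_le_quadratic[of ?u R "2 + \<alpha>"] pos uR R \<alpha>
      by (intro mult_left_mono) (auto simp: K_def mult_ac)
    also have "\<dots> = z + (2 + \<alpha>) * (y - z) + K * ((y - z)\<^sup>2 / z)"
      using pos by (simp add: field_simps power2_eq_square)
    finally show ?thesis .
  qed
  have "p * (q / p) powr - (1 + \<alpha>) + (1 - p) * ((1 - q) / (1 - p)) powr - (1 + \<alpha>)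
      \<le> (q + (2 + \<alpha>) * (p - q) + K * ((p - q)\<^sup>2 / q)) +
        ((1 - q) + (2 + \<alpha>) * ((1 - p) - (1 - q)) + K * (((1 - p) - (1 - q))\<^sup>2 / (1 - q)))"
    by (intro add_mono summand) (use p q in auto)
  \<comment> \<open>The linear terms of the two points are opposite and cancel, since both pairs of
    masses sum to one.\<close>
  also have "\<dots> = 1 + K * ((p - q)\<^sup>2 / q + (p - q)\<^sup>2 / (1 - q))"
    by (simp add: algebra_simps power2_commute)
  also have "(p - q)\<^sup>2 / q + (p - q)\<^sup>2 / (1 - q) = (p - q)\<^sup>2 / (q * (1 - q))"
    using q \<delta> by (simp add: field_simps)
  also have "1 + K * ((p - q)\<^sup>2 / (q * (1 - q))) \<le> 1 + K * ((p - q)\<^sup>2 / (\<delta> * (1 - \<delta>)))"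
  proof -
    have "0 \<le> (q - \<delta>) * (1 - \<delta> - q)" using q by (intro mult_nonneg_nonneg) auto
    then have "\<delta> * (1 - \<delta>) \<le> q * (1 - q)" by (simp add: algebra_simps)
    moreover have "0 < \<delta> * (1 - \<delta>)" using \<delta> by simp
    ultimately show ?thesis using K by (intro add_left_mono mult_left_mono divide_left_mono) auto
  qed
  also have "\<dots> = 1 + K / (\<delta> * (1 - \<delta>)) * (p - q)\<^sup>2" by simp
  also have "\<dots> \<le> 1 + c * (p - q)\<^sup>2"
    using c by (intro add_left_mono mult_right_mono) (auto simp: K_def R_def)
  also have "\<dots> \<le> exp (c * (p - q)\<^sup>2)" by (rule exp_ge_add_one_self)
  finally show ?thesis .
qed

text \<open>The second moment of the ratio is exactly one plus the chi-squared divergence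
  \<open>(p - q)^2 / (p * (1 - p))\<close>. It serves the convergence of the infinite product,
  whereas the negative moments serve the recurrence estimate.\<close>

lemma two_point_square_le:
  fixes p q \<delta> :: real
  assumes \<delta>: "0 < \<delta>" "\<delta> < 1/2" and p: "p \<in> {\<delta>..1 - \<delta>}" and q: "q \<in> {\<delta>..1 - \<delta>}"
  shows "p * (q / p)\<^sup>2 + (1 - p) * ((1 - q) / (1 - p))\<^sup>2 \<le> exp ((p - q)\<^sup>2 / (\<delta> * (1 - \<delta>)))"
proof -
  have pos: "0 < p" "0 < 1 - p" using p \<delta> by auto
  have "p * (q / p)\<^sup>2 + (1 - p) * ((1 - q) / (1 - p))\<^sup>2 = q\<^sup>2 / p + (1 - q)\<^sup>2 / (1 - p)"
    using pos by (simp add: power_divide power2_eq_square)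
  also have "\<dots> = 1 + (p - q)\<^sup>2 / (p * (1 - p))"
  proof -
    have "(q\<^sup>2 / p + (1 - q)\<^sup>2 / (1 - p)) * (p * (1 - p)) = q\<^sup>2 * (1 - p) + (1 - q)\<^sup>2 * p"
      using pos by (simp add: field_simps)
    also have "\<dots> = p * (1 - p) + (p - q)\<^sup>2" by (simp add: power2_eq_square algebra_simps)
    also have "\<dots> = (1 + (p - q)\<^sup>2 / (p * (1 - p))) * (p * (1 - p))"
      using pos by (simp add: distrib_right)
    finally show ?thesis using pos by (simp del: mult_cancel_right add: mult_right_cancel)
  qed
  also have "\<dots> \<le> 1 + (p - q)\<^sup>2 / (\<delta> * (1 - \<delta>))"
  proof -
    have "0 \<le> (p - \<delta>) * (1 - \<delta> - p)" using p by (intro mult_nonneg_nonneg) auto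
    then have "\<delta> * (1 - \<delta>) \<le> p * (1 - p)" by (simp add: algebra_simps)
    moreover have "0 < \<delta> * (1 - \<delta>)" using \<delta> by simp
    ultimately show ?thesis by (intro add_left_mono divide_left_mono) auto
  qed
  also have "\<dots> \<le> exp ((p - q)\<^sup>2 / (\<delta> * (1 - \<delta>)))" by (rule exp_ge_add_one_self)
  finally show ?thesis .
qed

lemma exists_moment_exponent:
  fixes \<delta> c :: real
  assumes \<delta>: "0 < \<delta>" "\<delta> < 1/2" and c: "1 / (\<delta> * (1 - \<delta>)) < c"
  obtains \<alpha>\<^sub>0 where "0 < \<alpha>\<^sub>0" "\<alpha>\<^sub>0 \<le> 1"
    "\<And>\<alpha>. 0 \<le> \<alpha> \<Longrightarrow> \<alpha> < \<alpha>\<^sub>0 \<Longrightarrow> (2 + \<alpha>) * (1 + \<alpha>) / 2 * ((1 - \<delta>) / \<delta>) powr \<alpha> / (\<delta> * (1 - \<delta>)) \<le> c"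
proof -
  let ?F = "\<lambda>\<alpha>. (2 + \<alpha>) * (1 + \<alpha>) / 2 * ((1 - \<delta>) / \<delta>) powr \<alpha> / (\<delta> * (1 - \<delta>))"
  have "(?F \<longlongrightarrow> ?F 0) (at 0)"
    using \<delta> by (intro tendsto_intros) auto
  moreover have "?F 0 < c" using c \<delta> by simp
  ultimately have "\<forall>\<^sub>F \<alpha> in at 0. ?F \<alpha> < c" by (rule order_tendstoD(2))
  then obtain d where d: "0 < d" "\<And>\<alpha>. \<alpha> \<noteq> 0 \<Longrightarrow> dist \<alpha> 0 < d \<Longrightarrow> ?F \<alpha> < c"
    by (auto simp: eventually_at)
  show thesis
  \<comment> \<open>The cap \<open>1\<close> meets the condition \<open>\<alpha> \<le> 1\<close> of
    the Maharam bound. The limit at \<open>0\<close> says nothing about \<open>\<alpha> = 0\<close>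
    itself, hence the case split.\<close>
  proof (rule that[of "min d 1"])
    fix \<alpha> :: real assume "0 \<le> \<alpha>" "\<alpha> < min d 1"
    then show "?F \<alpha> \<le> c"
      using d(2)[of \<alpha>] \<open>?F 0 < c\<close> by (cases "\<alpha> = 0") (auto intro: less_imp_le)
  qed (use d in auto)
qed

section \<open>The Bernoulli action\<close>

locale bernoulli_shift = group G for G :: "('g, 'b) monoid_scheme" (structure) +
  fixes m :: "'g \<Rightarrow> nat measure" and \<delta> :: real
  assumes count: "countable (carrier G)"
    and \<delta>: "0 < \<delta>" "\<delta> < 1 / 2"
    and prob: "\<And>g. g \<in> carrier G \<Longrightarrow> prob_space (m g)"
    and sets_m: "\<And>g. g \<in> carrier G \<Longrightarrow> sets (m g) = Pow {0, 1}"
    and mass: "\<And>g. g \<in> carrier G \<Longrightarrow> measure (m g) {0} \<in> {\<delta>..1 - \<delta>}"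
    and sm: "\<And>g. g \<in> carrier G \<Longrightarrow> (\<lambda>k. (shift_diff G m g k)\<^sup>2) summable_on carrier G"
begin

abbreviation "X \<equiv> bernoulli_space G m"

abbreviation "P h \<equiv> measure (m h) {0}"

lemma space_m: "g \<in> carrier G \<Longrightarrow> space (m g) = {0, 1}"
  using sets_eq_imp_space_eq[of "m g" "count_space {0, 1}"] sets_m[of g] by simp

lemma nn_integral_m:
  assumes g: "g \<in> carrier G"
  shows "(\<integral>\<^sup>+ y. u y \<partial>m g) = u 0 * ennreal (P g) + u 1 * ennreal (1 - P g)"
proof -
  interpret prob_space "m g" by (rule prob[OF g])
  have sing: "{a} \<in> sets (m g)" if "a \<in> {0, 1}" for a using that sets_m[OF g] by auto
  have "measure (m g) {1} = measure (m g) (space (m g) - {0})"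
    using space_m[OF g] by (intro arg_cong[where f = "measure (m g)"]) auto
  also have "\<dots> = 1 - P g" by (rule prob_compl) (use sing in auto)
  finally have one: "measure (m g) {1} = 1 - P g" .
  have "(\<integral>\<^sup>+ y. u y \<partial>m g) = (\<integral>\<^sup>+ y. u y * indicator {0, 1} y \<partial>m g)"
    by (rule nn_integral_cong) (simp add: space_m[OF g] indicator_def)
  also have "\<dots> = (\<Sum>y\<in>{0, 1}. u y * emeasure (m g) {y})"
    by (rule nn_integral_indicator_finite) (use sing in auto)
  finally show ?thesis using one by (simp add: emeasure_eq_measure)
qed

lemma measurable_m: "g \<in> carrier G \<Longrightarrow> u \<in> borel_measurable (m g)"
proof -
  assume "g \<in> carrier G"
  then have sets: "sets (m g) = sets (count_space {0, 1})" by (simp only: sets_m sets_count_space)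
  show ?thesis unfolding measurable_cong_sets[OF sets refl] by simp
qed

text \<open>The density of \<open>m (k \<otimes> h)\<close> with respect to \<open>m h\<close>. All
  \<open>y \<noteq> 0\<close> are treated like \<open>1\<close>, so that it is positive at every
  natural number, as \<open>product_density\<close> demands.\<close>

definition ratio :: "'g \<Rightarrow> 'g \<Rightarrow> nat \<Rightarrow> real" where
  "ratio k h y = (if y = 0 then P (k \<otimes> h) / P h else (1 - P (k \<otimes> h)) / (1 - P h))"

lemma mass_pos: "g \<in> carrier G \<Longrightarrow> 0 < P g" "g \<in> carrier G \<Longrightarrow> P g < 1"
  using mass[of g] \<delta> by auto

lemma ratio_pos: "k \<in> carrier G \<Longrightarrow> h \<in> carrier G \<Longrightarrow> 0 < ratio k h y"
  using mass_pos[of h] mass_pos[of "k \<otimes> h"] by (simp add: ratio_def)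

lemma density_ratio:
  assumes k: "k \<in> carrier G" and h: "h \<in> carrier G"
  shows "density (m h) (\<lambda>y. ennreal (ratio k h y)) = m (k \<otimes> h)"
proof (rule measure_eqI)
  have kh: "k \<otimes> h \<in> carrier G" using k h by simp
  show "sets (density (m h) (\<lambda>y. ennreal (ratio k h y))) = sets (m (k \<otimes> h))"
    using sets_m k h by simp
  fix A assume "A \<in> sets (density (m h) (\<lambda>y. ennreal (ratio k h y)))"
  then have A: "A \<in> sets (m h)" "A \<in> sets (m (k \<otimes> h))" using sets_m k h by auto
  have r: "ennreal (ratio k h 0) * ennreal (P h) = ennreal (P (k \<otimes> h))"
    "ennreal (ratio k h 1) * ennreal (1 - P h) = ennreal (1 - P (k \<otimes> h))"
    using mass_pos[OF h] mass_pos[OF kh] by (simp_all add: ratio_def ennreal_mult[symmetric])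
  have "emeasure (density (m h) (\<lambda>y. ennreal (ratio k h y))) A
      = (\<integral>\<^sup>+ y. ennreal (ratio k h y) * indicator A y \<partial>m h)"
    by (rule emeasure_density[OF measurable_m[OF h] A(1)])
  also have "\<dots> = indicator A 0 * (ennreal (ratio k h 0) * ennreal (P h)) +
      indicator A 1 * (ennreal (ratio k h 1) * ennreal (1 - P h))"
    unfolding nn_integral_m[OF h] by (simp add: mult_ac)
  also have "\<dots> = (\<integral>\<^sup>+ y. indicator A y \<partial>m (k \<otimes> h))"
    unfolding r nn_integral_m[OF kh] by simp
  also have "\<dots> = emeasure (m (k \<otimes> h)) A" by (rule nn_integral_indicator[OF A(2)])
  finally show "emeasure (density (m h) (\<lambda>y. ennreal (ratio k h y))) A = emeasure (m (k \<otimes> h)) A" .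
qed

lemma shift_diff_inv_sq:
  assumes "k \<in> carrier G" "h \<in> carrier G"
  shows "(shift_diff G m (inv k) h)\<^sup>2 = (P h - P (k \<otimes> h))\<^sup>2"
  using assms by (simp add: shift_diff_def)

lemma summable_mass_diff:
  assumes "k \<in> carrier G"
  shows "(\<lambda>h. c * (P h - P (k \<otimes> h))\<^sup>2) summable_on carrier G"
proof (rule summable_on_cmult_right)
  have "(\<lambda>h. (shift_diff G m (inv k) h)\<^sup>2) summable_on carrier G" using sm assms by simp
  also have "?this \<longleftrightarrow> (\<lambda>h. (P h - P (k \<otimes> h))\<^sup>2) summable_on carrier G"
    by (rule summable_on_cong) (rule shift_diff_inv_sq[OF assms])
  finally show "(\<lambda>h. (P h - P (k \<otimes> h))\<^sup>2) summable_on carrier G" .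
qed

text \<open>The ratios for \<open>k\<close> involve the shift difference of \<open>inv k\<close>,
  while the weight condition is stated for \<open>k\<close>; invariance of the norm under inversion
  reconciles the two.\<close>

lemma infsum_mass_diff:
  assumes "k \<in> carrier G"
  shows "(\<Sum>\<^sub>\<infinity>h\<in>carrier G. c * (P h - P (k \<otimes> h))\<^sup>2) = c * l2_norm_sq G (shift_diff G m k)"
proof -
  have "l2_norm_sq G (shift_diff G m k) = l2_norm_sq G (shift_diff G m (inv k))"
    by (rule l2_norm_sq_shift_diff_inv[OF assms, symmetric])
  also have "\<dots> = (\<Sum>\<^sub>\<infinity>h\<in>carrier G. (P h - P (k \<otimes> h))\<^sup>2)"
    unfolding l2_norm_sq_def by (rule infsum_cong) (simp add: shift_diff_inv_sq assms)
  finally show ?thesis by (simp add: infsum_cmult_right')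
qed

text \<open>The square-summability hypothesis enters here: the second-moment exponent at
  \<open>h\<close> is a constant times the squared shift difference of \<open>inv k\<close> at
  \<open>h\<close>.\<close>

lemma product_density_ratio:
  assumes k: "k \<in> carrier G"
  shows "product_density (carrier G) m (ratio k) (\<lambda>h. 1 / (\<delta> * (1 - \<delta>)) * (P h - P (k \<otimes> h))\<^sup>2)"
proof (rule product_density.intro)
  fix h assume h: "h \<in> carrier G"
  then have kh: "k \<otimes> h \<in> carrier G" using k by simp
  note pos = mass_pos[OF h] mass_pos[OF kh]
  show "(\<integral>\<^sup>+ y. ennreal (ratio k h y) \<partial>m h) = 1"
  proof -
    have "ennreal (ratio k h 0) * ennreal (P h) + ennreal (ratio k h 1) * ennreal (1 - P h)
        = ennreal (P (k \<otimes> h)) + ennreal (1 - P (k \<otimes> h))"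
      using pos by (simp add: ratio_def ennreal_mult[symmetric])
    also have "\<dots> = ennreal (P (k \<otimes> h) + (1 - P (k \<otimes> h)))"
      using pos by (intro ennreal_plus[symmetric]) auto
    finally show ?thesis unfolding nn_integral_m[OF h] by simp
  qed
  have "ennreal ((ratio k h 0)\<^sup>2) * ennreal (P h) + ennreal ((ratio k h 1)\<^sup>2) * ennreal (1 - P h)
      = ennreal (P h * (ratio k h 0)\<^sup>2 + (1 - P h) * (ratio k h 1)\<^sup>2)"
    using pos by (subst ennreal_plus) (simp_all add: ennreal_mult mult.commute)
  also have "\<dots> \<le> ennreal (exp (1 / (\<delta> * (1 - \<delta>)) * (P h - P (k \<otimes> h))\<^sup>2))"
    using two_point_square_le[OF \<delta> mass[OF h] mass[OF kh]] by (intro ennreal_leI) (simp add: ratio_def)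
  finally show "(\<integral>\<^sup>+ y. ennreal ((ratio k h y)\<^sup>2) \<partial>m h) \<le> ennreal (exp (1 / (\<delta> * (1 - \<delta>)) * (P h - P (k \<otimes> h))\<^sup>2))"
    unfolding nn_integral_m[OF h] .
  show "0 \<le> 1 / (\<delta> * (1 - \<delta>)) * (P h - P (k \<otimes> h))\<^sup>2" using \<delta> by simp
  show "ratio k h \<in> borel_measurable (m h)" by (rule measurable_m[OF h])
  show "0 < ratio k h y" for y by (rule ratio_pos[OF k h])
  show "prob_space (m h)" by (rule prob[OF h])
next
  show "countable (carrier G)" by (rule count)
  show "(\<lambda>h. 1 / (\<delta> * (1 - \<delta>)) * (P h - P (k \<otimes> h))\<^sup>2) summable_on carrier G"
    by (rule summable_mass_diff[OF k])
qed

section \<open>The shift as a nonsingular action\<close>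

lemma space_X: "space X = carrier G \<rightarrow>\<^sub>E {0, 1}"
  unfolding bernoulli_space_def space_PiM by (rule PiE_cong) (simp add: space_m)

lemma bernoulli_map_mult:
  assumes "g \<in> carrier G" "h \<in> carrier G"
  shows "bernoulli_map G (g \<otimes> h) x = bernoulli_map G g (bernoulli_map G h x)"
  by (rule ext) (simp add: bernoulli_map_def inv_mult_group m_assoc assms)

lemma bernoulli_map_one: "x \<in> space X \<Longrightarrow> bernoulli_map G \<one> x = x"
  by (auto simp: bernoulli_map_def space_X PiE_iff extensional_def fun_eq_iff)

lemma bernoulli_map_inv:
  assumes "g \<in> carrier G" "x \<in> space X"
  shows "bernoulli_map G g (bernoulli_map G (inv g) x) = x" "bernoulli_map G (inv g) (bernoulli_map G g x) = x"
  using assms bernoulli_map_one[OF assms(2)] by (simp_all add: bernoulli_map_mult[symmetric])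

lemma measurable_bernoulli_map:
  assumes g: "g \<in> carrier G"
  shows "bernoulli_map G g \<in> measurable X X"
  unfolding bernoulli_map_def bernoulli_space_def
proof (rule measurable_restrict)
  fix h assume h: "h \<in> carrier G"
  then have gh: "inv g \<otimes> h \<in> carrier G" using g by simp
  have "(\<lambda>x. x (inv g \<otimes> h)) \<in> measurable (PiM (carrier G) m) (m (inv g \<otimes> h))"
    using gh by (rule measurable_component_singleton)
  moreover have "sets (m (inv g \<otimes> h)) = sets (m h)" by (simp only: sets_m gh h)
  ultimately show "(\<lambda>x. x (inv g \<otimes> h)) \<in> measurable (PiM (carrier G) m) (m h)"
    by (simp cong: measurable_cong_sets)
qed

lemma bernoulli_map_space: "g \<in> carrier G \<Longrightarrow> x \<in> space X \<Longrightarrow> bernoulli_map G g x \<in> space X"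
  using measurable_space[OF measurable_bernoulli_map] .

lemma bernoulli_map_image:
  assumes g: "g \<in> carrier G" and U: "U \<subseteq> space X"
  shows "bernoulli_map G g ` U = bernoulli_map G (inv g) -` U \<inter> space X"
proof (intro equalityI subsetI)
  fix y assume "y \<in> bernoulli_map G g ` U"
  then show "y \<in> bernoulli_map G (inv g) -` U \<inter> space X"
    using U bernoulli_map_inv[OF g] bernoulli_map_space[OF g] by auto
next
  fix y assume "y \<in> bernoulli_map G (inv g) -` U \<inter> space X"
  then show "y \<in> bernoulli_map G g ` U"
    using bernoulli_map_inv(1)[OF g, of y] by (intro image_eqI[of _ _ "bernoulli_map G (inv g) y"]) auto
qed

text \<open>The translated measure is the distribution of \<open>bernoulli_map G (inv k)\<close>,
  whose coordinate at \<open>h\<close> reads \<open>x (k \<otimes> h)\<close>; hence it is the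
  product of the measures \<open>m (k \<otimes> h)\<close>. The moment bound is delivered together
  with \<open>f\<close> because it is proved from the approximating partial products, which the
  conclusion hides.\<close>

lemma bernoulli_density:
  assumes k: "k \<in> carrier G"
  obtains f where "f \<in> borel_measurable X" "\<And>x. 0 \<le> f x"
    "\<And>U. U \<in> sets X \<Longrightarrow> emeasure X (bernoulli_map G k ` U) = (\<integral>\<^sup>+ x. ennreal (f x) * indicator U x \<partial>X)"
    "\<And>\<alpha> c. 0 \<le> \<alpha> \<Longrightarrow> (2 + \<alpha>) * (1 + \<alpha>) / 2 * ((1 - \<delta>) / \<delta>) powr \<alpha> / (\<delta> * (1 - \<delta>)) \<le> c \<Longrightarrow>
      (\<integral>\<^sup>+ x. ennreal (f x powr - (1 + \<alpha>)) \<partial>X) \<le> ennreal (exp (c * l2_norm_sq G (shift_diff G m k)))"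
proof -
  interpret R: product_density "carrier G" m "ratio k" "\<lambda>h. 1 / (\<delta> * (1 - \<delta>)) * (P h - P (k \<otimes> h))\<^sup>2"
    by (rule product_density_ratio[OF k])
  let ?N = "\<lambda>h. m (k \<otimes> h)"
  obtain J f where J: "\<And>n. finite (J n)" "\<And>n. J n \<subseteq> carrier G"
    and f: "f \<in> borel_measurable (PiM (carrier G) m)" "\<And>x. 0 \<le> f x"
      "AE x in PiM (carrier G) m. (\<lambda>n. R.pr (J n) x) \<longlonglongrightarrow> f x"
      "density (PiM (carrier G) m) (\<lambda>x. ennreal (f x)) = PiM (carrier G) ?N"
    by (rule R.density_PiM[of ?N, OF density_ratio[OF k, symmetric]]) (assumption, rule that, assumption+)
  have sets_N: "sets (PiM (carrier G) ?N) = sets (PiM (carrier G) m)"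
    by (simp add: f(4)[symmetric])
  show thesis
  proof (rule that[of f])
    show "f \<in> borel_measurable X" using f(1) by (simp add: bernoulli_space_def)
    show "0 \<le> f x" for x by (rule f(2))
    fix U assume U: "U \<in> sets X"
    have U': "U \<in> sets (PiM (carrier G) ?N)"
      using U by (simp add: sets_N bernoulli_space_def)
    have meas: "bernoulli_map G (inv k) \<in> measurable (PiM (carrier G) m) (PiM (carrier G) ?N)"
      unfolding measurable_cong_sets[OF refl sets_N]
      using measurable_bernoulli_map[of "inv k"] k by (simp add: bernoulli_space_def)
    have "PiM (carrier G) ?N = distr (PiM (carrier G) m) (PiM (carrier G) ?N) (\<lambda>\<omega>. \<lambda>n\<in>carrier G. \<omega> (k \<otimes> n))"
      by (rule distr_PiM_reindex[symmetric]) (use prob k bij_betw_left_mult[OF k] in \<open>auto simp: bij_betw_def\<close>)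
    also have "(\<lambda>\<omega>. \<lambda>n\<in>carrier G. \<omega> (k \<otimes> n)) = bernoulli_map G (inv k)"
      by (rule ext)+ (simp add: bernoulli_map_def k)
    finally have N_eq: "PiM (carrier G) ?N = distr (PiM (carrier G) m) (PiM (carrier G) ?N) (bernoulli_map G (inv k))" .
    have "(\<integral>\<^sup>+ x. ennreal (f x) * indicator U x \<partial>X) = emeasure (PiM (carrier G) ?N) U"
      unfolding f(4)[symmetric] using U f(1) by (simp add: emeasure_density bernoulli_space_def)
    also have "\<dots> = emeasure (PiM (carrier G) m) (bernoulli_map G (inv k) -` U \<inter> space (PiM (carrier G) m))"
      by (subst N_eq) (rule emeasure_distr[OF meas U'])
    also have "\<dots> = emeasure X (bernoulli_map G k ` U)"
      using bernoulli_map_image[OF k sets.sets_into_space[OF U]] by (simp add: bernoulli_space_def)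
    finally show "emeasure X (bernoulli_map G k ` U) = (\<integral>\<^sup>+ x. ennreal (f x) * indicator U x \<partial>X)" by simp
  next
    fix \<alpha> c :: real assume \<alpha>: "0 \<le> \<alpha>"
      and c: "(2 + \<alpha>) * (1 + \<alpha>) / 2 * ((1 - \<delta>) / \<delta>) powr \<alpha> / (\<delta> * (1 - \<delta>)) \<le> c"
    have c0: "0 \<le> c" using \<delta> \<alpha> by (intro order_trans[OF _ c]) auto
    have "(\<integral>\<^sup>+ x. ennreal (f x powr - (1 + \<alpha>)) \<partial>PiM (carrier G) m)
        \<le> ennreal (exp (\<Sum>\<^sub>\<infinity>h\<in>carrier G. c * (P h - P (k \<otimes> h))\<^sup>2))"
    proof (rule R.nn_integral_powr_limit_le[OF J f(2,3)])
      fix h assume h: "h \<in> carrier G"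
      then have kh: "k \<otimes> h \<in> carrier G" using k by simp
      note pos = mass_pos[OF h] mass_pos[OF kh]
      have "ennreal (ratio k h 0 powr - (1 + \<alpha>)) * ennreal (P h) + ennreal (ratio k h 1 powr - (1 + \<alpha>)) * ennreal (1 - P h)
          = ennreal (P h * ratio k h 0 powr - (1 + \<alpha>) + (1 - P h) * ratio k h 1 powr - (1 + \<alpha>))"
        using pos by (subst ennreal_plus) (simp_all add: ennreal_mult mult.commute)
      also have "\<dots> \<le> ennreal (exp (c * (P h - P (k \<otimes> h))\<^sup>2))"
        using two_point_moment_le[OF \<delta> mass[OF h] mass[OF kh] \<alpha> c] by (intro ennreal_leI) (simp add: ratio_def)
      finally show "(\<integral>\<^sup>+ y. ennreal (ratio k h y powr - (1 + \<alpha>)) \<partial>m h) \<le> ennreal (exp (c * (P h - P (k \<otimes> h))\<^sup>2))"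
        unfolding nn_integral_m[OF h] .
      show "0 \<le> c * (P h - P (k \<otimes> h))\<^sup>2" using c0 by simp
    qed (rule summable_mass_diff[OF k])
    then show "(\<integral>\<^sup>+ x. ennreal (f x powr - (1 + \<alpha>)) \<partial>X) \<le> ennreal (exp (c * l2_norm_sq G (shift_diff G m k)))"
      by (simp only: bernoulli_space_def infsum_mass_diff[OF k])
  qed
qed

lemma emeasure_bernoulli_map_image_null:
  assumes k: "k \<in> carrier G" and U: "U \<in> sets X" "emeasure X U = 0"
  shows "emeasure X (bernoulli_map G k ` U) = 0"
proof -
  obtain f where f: "f \<in> borel_measurable X" "\<And>x. 0 \<le> f x"
    "\<And>U. U \<in> sets X \<Longrightarrow> emeasure X (bernoulli_map G k ` U) = (\<integral>\<^sup>+ x. ennreal (f x) * indicator U x \<partial>X)"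
    "\<And>\<alpha> c. 0 \<le> \<alpha> \<Longrightarrow> (2 + \<alpha>) * (1 + \<alpha>) / 2 * ((1 - \<delta>) / \<delta>) powr \<alpha> / (\<delta> * (1 - \<delta>)) \<le> c \<Longrightarrow>
      (\<integral>\<^sup>+ x. ennreal (f x powr - (1 + \<alpha>)) \<partial>X) \<le> ennreal (exp (c * l2_norm_sq G (shift_diff G m k)))"
    by (rule bernoulli_density[OF k]) (rule that, assumption+)
  have "AE x in X. x \<notin> U" using U by (auto intro: AE_not_in simp: null_sets_def)
  then have "(\<integral>\<^sup>+ x. ennreal (f x) * indicator U x \<partial>X) = (\<integral>\<^sup>+ x. 0 \<partial>X)"
    by (intro nn_integral_cong_AE) (auto elim: eventually_mono simp: indicator_def)
  then show ?thesis using f(3)[OF U(1)] by simp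
qed

lemma nonsingular_bernoulli: "nonsingular_action G X (bernoulli_map G)"
  unfolding nonsingular_action_def
proof (intro conjI ballI)
  show "standard_prob_space X"
    unfolding bernoulli_space_def
    by (rule standard_prob_space_PiM_finite_discrete[OF count, of "{0, 1}"]) (use prob sets_m in auto)
  show "AE x in X. bernoulli_map G \<one> x = x" by (rule AE_I2) (rule bernoulli_map_one)
  fix g assume g: "g \<in> carrier G"
  then have ig: "inv g \<in> carrier G" by simp
  show "bernoulli_map G g \<in> measurable X X" by (rule measurable_bernoulli_map[OF g])
  show "bij_betw (bernoulli_map G g) (space X) (space X)"
    by (rule bij_betw_byWitness[where f' = "bernoulli_map G (inv g)"])
       (use bernoulli_map_inv[OF g] bernoulli_map_space g in auto)
  have im: "bernoulli_map G h ` U \<in> sets X" if "h \<in> carrier G" "U \<in> sets X" for h U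
    unfolding bernoulli_map_image[OF that(1) sets.sets_into_space[OF that(2)]]
    by (rule measurable_sets[OF measurable_bernoulli_map]) (use that in auto)
  show "bernoulli_map G g ` U \<in> sets X" if "U \<in> sets X" for U by (rule im[OF g that])
  show "emeasure X (bernoulli_map G g ` U) = 0 \<longleftrightarrow> emeasure X U = 0" if U: "U \<in> sets X" for U
  proof
    \<comment> \<open>The converse is absolute continuity for \<open>inv g\<close>. Almost
      everywhere positivity of the limit density is thus a consequence of nonsingularity and not an
      ingredient of it.\<close>
    assume "emeasure X (bernoulli_map G g ` U) = 0"
    then have "emeasure X (bernoulli_map G (inv g) ` bernoulli_map G g ` U) = 0"
      by (rule emeasure_bernoulli_map_image_null[OF ig im[OF g U]])
    moreover have "bernoulli_map G (inv g) ` bernoulli_map G g ` U = (\<lambda>x. x) ` U"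
      unfolding image_image using bernoulli_map_inv(2)[OF g] sets.sets_into_space[OF U]
      by (intro image_cong) auto
    ultimately show "emeasure X U = 0" by simp
  qed (rule emeasure_bernoulli_map_image_null[OF g U])
  show "AE x in X. bernoulli_map G (g \<otimes> h) x = bernoulli_map G g (bernoulli_map G h x)" if "h \<in> carrier G" for h
    by (rule AE_I2) (rule bernoulli_map_mult[OF g that])
qed

lemma bernoulli_deriv_moment_le:
  assumes k: "k \<in> carrier G" and \<alpha>: "0 \<le> \<alpha>"
    and c: "(2 + \<alpha>) * (1 + \<alpha>) / 2 * ((1 - \<delta>) / \<delta>) powr \<alpha> / (\<delta> * (1 - \<delta>)) \<le> c"
  shows "(\<integral>\<^sup>+ x. ennreal (enn2real (translation_deriv X (bernoulli_map G) k x) powr - (1 + \<alpha>)) \<partial>X)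
      \<le> ennreal (exp (c * l2_norm_sq G (shift_diff G m k)))"
proof -
  obtain f where f: "f \<in> borel_measurable X" "\<And>x. 0 \<le> f x"
    "\<And>U. U \<in> sets X \<Longrightarrow> emeasure X (bernoulli_map G k ` U) = (\<integral>\<^sup>+ x. ennreal (f x) * indicator U x \<partial>X)"
    "\<And>\<alpha> c. 0 \<le> \<alpha> \<Longrightarrow> (2 + \<alpha>) * (1 + \<alpha>) / 2 * ((1 - \<delta>) / \<delta>) powr \<alpha> / (\<delta> * (1 - \<delta>)) \<le> c \<Longrightarrow>
      (\<integral>\<^sup>+ x. ennreal (f x powr - (1 + \<alpha>)) \<partial>X) \<le> ennreal (exp (c * l2_norm_sq G (shift_diff G m k)))"
    by (rule bernoulli_density[OF k]) (rule that, assumption+)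
  have "AE x in X. translation_deriv X (bernoulli_map G) k x = ennreal (f x)"
  proof (rule translation_deriv_unique)
    show "prob_space X" by (rule nonsingular_actionD(1)[OF nonsingular_bernoulli])
    show "(\<lambda>x. ennreal (f x)) \<in> borel_measurable X" using f(1) by measurable
  qed (rule f(3))
  then have "(\<integral>\<^sup>+ x. ennreal (enn2real (translation_deriv X (bernoulli_map G) k x) powr - (1 + \<alpha>)) \<partial>X)
      = (\<integral>\<^sup>+ x. ennreal (f x powr - (1 + \<alpha>)) \<partial>X)"
    by (intro nn_integral_cong_AE) (auto elim!: eventually_mono simp: f(2))
  with f(4)[OF \<alpha> c] show ?thesis by simp
qed

section \<open>Strong recurrence of the Bernoulli action and of its Maharam extension\<close>

lemma strongly_recurrent_bernoulli:
  assumes c: "1 / (\<delta> * (1 - \<delta>)) < c" and \<eta>: "exp_weight_condition G m c \<eta>"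
  shows "strongly_recurrent G X (bernoulli_map G) \<eta>"
proof (rule strongly_recurrentI[OF count nonsingular_bernoulli \<eta>, of 1])
  fix k assume k: "k \<in> carrier G"
  \<comment> \<open>The exponent is left as \<open>1 + 0\<close> to match the moment bound at
    \<open>\<alpha> = 0\<close>. The two sides would differ at a zero of the derivative, where the
    inverse is \<open>\<infinity>\<close> but \<open>powr\<close> gives \<open>0\<close>; so almost
    everywhere positivity is essential.\<close>
  have "AE x in X. inverse (translation_deriv X (bernoulli_map G) k x)
      = ennreal (enn2real (translation_deriv X (bernoulli_map G) k x) powr - (1 + 0))"
    using nonsingular_action_translated(4,5)[OF nonsingular_bernoulli k]
  proof eventually_elim
    case (elim x)
    then obtain d where "translation_deriv X (bernoulli_map G) k x = ennreal d" "0 < d"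
      by (cases "translation_deriv X (bernoulli_map G) k x") (auto simp: less_le)
    then show ?case by (simp add: inverse_ennreal powr_minus)
  qed
  then have "(\<integral>\<^sup>+ x. inverse (translation_deriv X (bernoulli_map G) k x) \<partial>X)
      = (\<integral>\<^sup>+ x. ennreal (enn2real (translation_deriv X (bernoulli_map G) k x) powr - (1 + 0)) \<partial>X)"
    by (rule nn_integral_cong_AE)
  also have "\<dots> \<le> ennreal (exp (c * l2_norm_sq G (shift_diff G m k)))"
    by (rule bernoulli_deriv_moment_le[OF k]) (use c \<delta> in auto)
  finally show "(\<integral>\<^sup>+ x. inverse (translation_deriv X (bernoulli_map G) k x) \<partial>X)
      \<le> 1 * ennreal (exp (c * l2_norm_sq G (shift_diff G m k)))" by simp
qed simp

lemma strongly_recurrent_maharam: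
  assumes \<alpha>: "0 < \<alpha>" "\<alpha> \<le> 1"
    and c: "(2 + \<alpha>) * (1 + \<alpha>) / 2 * ((1 - \<delta>) / \<delta>) powr \<alpha> / (\<delta> * (1 - \<delta>)) \<le> c"
    and \<eta>: "exp_weight_condition G m c \<eta>"
  shows "strongly_recurrent G (X \<Otimes>\<^sub>M two_sided_exp \<alpha>) (maharam_map X (bernoulli_map G)) \<eta>"
proof (rule strongly_recurrentI[OF count nonsingular_action_maharam[OF nonsingular_bernoulli \<alpha>(1) is_group] \<eta>, of 2])
  fix k assume k: "k \<in> carrier G"
  let ?\<nu> = "two_sided_exp \<alpha>" and ?D = "translation_deriv X (bernoulli_map G) k"
  let ?l = "l2_norm_sq G (shift_diff G m k)"
  interpret X: prob_space X by (rule nonsingular_actionD(1)[OF nonsingular_bernoulli])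
  interpret \<nu>: prob_space ?\<nu> by (rule prob_space_two_sided_exp[OF \<alpha>(1)])
  have c0: "0 \<le> c" using \<delta> \<alpha> by (intro order_trans[OF _ c]) auto
  have "(\<integral>\<^sup>+ z. inverse (translation_deriv (X \<Otimes>\<^sub>M ?\<nu>) (maharam_map X (bernoulli_map G)) k z) \<partial>(X \<Otimes>\<^sub>M ?\<nu>))
      \<le> (\<integral>\<^sup>+ z. 1 + ennreal (enn2real (?D (fst z)) powr - (1 + \<alpha>)) \<partial>(X \<Otimes>\<^sub>M ?\<nu>))"
    by (rule nn_integral_mono_AE) (rule AE_maharam_inverse_deriv_le[OF nonsingular_bernoulli \<alpha>(1) k \<alpha>(2)])
  also have "\<dots> = (\<integral>\<^sup>+ x. \<integral>\<^sup>+ t. 1 + ennreal (enn2real (?D x) powr - (1 + \<alpha>)) \<partial>?\<nu> \<partial>X)"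
    by (subst \<nu>.nn_integral_fst[symmetric]) auto
  also have "\<dots> = (\<integral>\<^sup>+ x. 1 + ennreal (enn2real (?D x) powr - (1 + \<alpha>)) \<partial>X)"
    using \<nu>.emeasure_space_1 by (intro nn_integral_cong) simp
  also have "\<dots> = 1 + (\<integral>\<^sup>+ x. ennreal (enn2real (?D x) powr - (1 + \<alpha>)) \<partial>X)"
    by (subst nn_integral_add) (auto simp: X.emeasure_space_1)
  also have "\<dots> \<le> ennreal (exp (c * ?l)) + ennreal (exp (c * ?l))"
  proof (rule add_mono)
    \<comment> \<open>The additive \<open>1\<close> is absorbed into the exponential, which produces
      the constant \<open>2\<close>.\<close>
    have "1 \<le> exp (c * ?l)" using c0 l2_norm_sq_nonneg[of G "shift_diff G m k"] by simp
    then have "ennreal 1 \<le> ennreal (exp (c * ?l))" by (rule ennreal_leI)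
    then show "1 \<le> ennreal (exp (c * ?l))" by simp
    show "(\<integral>\<^sup>+ x. ennreal (enn2real (?D x) powr - (1 + \<alpha>)) \<partial>X) \<le> ennreal (exp (c * ?l))"
      by (rule bernoulli_deriv_moment_le[OF k _ c]) (use \<alpha> in simp)
  qed
  also have "\<dots> = 2 * ennreal (exp (c * ?l))" by (rule mult_2[symmetric])
  finally show "(\<integral>\<^sup>+ z. inverse (translation_deriv (X \<Otimes>\<^sub>M ?\<nu>) (maharam_map X (bernoulli_map G)) k z) \<partial>(X \<Otimes>\<^sub>M ?\<nu>))
      \<le> 2 * ennreal (exp (c * ?l))" .
qed simp

end

theorem proposition5p3:
  fixes G :: "('g, 'b) monoid_scheme"
    and m :: "'g \<Rightarrow> nat measure"
    and \<delta> \<kappa> :: real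
  assumes "group G" and "countable (carrier G)"
    and "0 < \<delta>" and "\<delta> < 1 / 2"
    and "\<And>g. g \<in> carrier G \<Longrightarrow> prob_space (m g)"
    and "\<And>g. g \<in> carrier G \<Longrightarrow> sets (m g) = Pow {0, 1}"
    and "\<And>g. g \<in> carrier G \<Longrightarrow> measure (m g) {0} \<in> {\<delta>..1 - \<delta>}"
    and "\<And>g. g \<in> carrier G \<Longrightarrow> (\<lambda>k. (shift_diff G m g k)\<^sup>2) summable_on carrier G"
    and "1 / (\<delta> * (1 - \<delta>)) < \<kappa>"
    and "(\<integral>\<^sup>+ g. ennreal (exp (- 4 * \<kappa> * l2_norm_sq G (shift_diff G m g)))
            \<partial>count_space (carrier G)) = \<infinity>"
  shows "nonsingular_action G (bernoulli_space G m) (bernoulli_map G) \<and>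
         strongly_conservative G (bernoulli_space G m) (bernoulli_map G) \<and>
         (\<forall>\<kappa>\<^sub>1. 1 / (\<delta> * (1 - \<delta>)) < \<kappa>\<^sub>1 \<and> \<kappa>\<^sub>1 < \<kappa> \<longrightarrow>
            (\<exists>\<eta>. exp_weight_condition G m \<kappa>\<^sub>1 \<eta>) \<and>
            (\<forall>\<eta>. exp_weight_condition G m \<kappa>\<^sub>1 \<eta> \<longrightarrow>
                 strongly_recurrent G (bernoulli_space G m) (bernoulli_map G) \<eta>) \<and>
            (\<exists>\<alpha>\<^sub>0>0. \<forall>\<eta>. exp_weight_condition G m \<kappa>\<^sub>1 \<eta> \<longrightarrow>
               (\<forall>\<alpha>\<in>{0<..<\<alpha>\<^sub>0}.
                  strongly_recurrent G (bernoulli_space G m \<Otimes>\<^sub>M two_sided_exp \<alpha>)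
                    (maharam_map (bernoulli_space G m) (bernoulli_map G)) \<eta>)))"
proof -
  interpret bernoulli_shift G m \<delta>
    by (intro bernoulli_shift.intro bernoulli_shift_axioms.intro) (fact assms)+
  have exists: "\<exists>\<eta>. exp_weight_condition G m \<kappa>\<^sub>1 \<eta>" if "1 / (\<delta> * (1 - \<delta>)) < \<kappa>\<^sub>1" "\<kappa>\<^sub>1 < \<kappa>" for \<kappa>\<^sub>1
  proof (rule exp_weight_condition_exists[OF count sm _ that(2) assms(10)])
    have "0 < 1 / (\<delta> * (1 - \<delta>))" using \<delta> by simp
    then show "0 < \<kappa>\<^sub>1" using that(1) by linarith
  qed
  have maharam: "\<exists>\<alpha>\<^sub>0>0. \<forall>\<eta>. exp_weight_condition G m \<kappa>\<^sub>1 \<eta> \<longrightarrow> (\<forall>\<alpha>\<in>{0<..<\<alpha>\<^sub>0}.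
      strongly_recurrent G (X \<Otimes>\<^sub>M two_sided_exp \<alpha>) (maharam_map X (bernoulli_map G)) \<eta>)"
    if \<kappa>\<^sub>1: "1 / (\<delta> * (1 - \<delta>)) < \<kappa>\<^sub>1" for \<kappa>\<^sub>1
  proof -
    \<comment> \<open>The threshold depends on \<open>\<delta>\<close> and
      \<open>\<kappa>\<^sub>1\<close> only and is fixed before \<open>\<eta>\<close>, as the order
      of quantifiers requires.\<close>
    obtain \<alpha>\<^sub>0 where \<alpha>\<^sub>0: "0 < \<alpha>\<^sub>0" "\<alpha>\<^sub>0 \<le> 1"
      "\<And>\<alpha>. 0 \<le> \<alpha> \<Longrightarrow> \<alpha> < \<alpha>\<^sub>0 \<Longrightarrow> (2 + \<alpha>) * (1 + \<alpha>) / 2 * ((1 - \<delta>) / \<delta>) powr \<alpha> / (\<delta> * (1 - \<delta>)) \<le> \<kappa>\<^sub>1"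
      by (rule exists_moment_exponent[OF \<delta> \<kappa>\<^sub>1]) (rule that, assumption+)
    show ?thesis
    proof (intro exI[of _ \<alpha>\<^sub>0] conjI allI impI ballI \<alpha>\<^sub>0(1))
      fix \<eta> \<alpha> assume \<eta>: "exp_weight_condition G m \<kappa>\<^sub>1 \<eta>" and \<alpha>: "\<alpha> \<in> {0<..<\<alpha>\<^sub>0}"
      show "strongly_recurrent G (X \<Otimes>\<^sub>M two_sided_exp \<alpha>) (maharam_map X (bernoulli_map G)) \<eta>"
        by (rule strongly_recurrent_maharam[OF _ _ \<alpha>\<^sub>0(3) \<eta>]) (use \<alpha> \<alpha>\<^sub>0(2) in auto)
    qed
  qed
  \<comment> \<open>Strong conservativity asks for a single sequence, so any intermediate exponent
    will do.\<close>
  obtain \<kappa>\<^sub>1 where "1 / (\<delta> * (1 - \<delta>)) < \<kappa>\<^sub>1" "\<kappa>\<^sub>1 < \<kappa>" using dense[OF assms(9)] by blast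
  then have "strongly_conservative G X (bernoulli_map G)"
    unfolding strongly_conservative_def using exists strongly_recurrent_bernoulli by blast
  with nonsingular_bernoulli exists strongly_recurrent_bernoulli maharam show ?thesis by blast
qed

end
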